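(* Let $E$ be a finite set, let $P,Q\subseteq\mathbb{Z}^E$ be M-convex sets, and let $p,q\colon 2^E\to\mathbb{Z}$ be the corresponding submodular set functions. Then the following conditions are equivalent (each of them characterizes that $Q$ is a quotient of $P$, written $P\twoheadrightarrow Q$). (1) (compliant functions) For all $X\subseteq Y\subseteq E$: $q(Y)-q(X)\le p(Y)-p(X)$. (2) (containment of bases) For every $\sigma\in\mathrm{Sym}(E)$, the vertices $x_\sigma$ of $P$ and $y_\sigma$ of $Q$ satisfy $x_\sigma\ge y_\sigma$ coordinatewise. (3) (submodular polyhedron containment) For all $X\subseteq E$: $S(q_{/X})\subseteq S(p_{/X})$. (4) (top and bottom) There exists an M$^\natural$-convex set $R\subseteq\mathbb{Z}^E$ such that $P=R^\uparrow$ is the top layer and $Q=R^\downarrow$ is the bottom layer of $R$. (This M$^\natural$-convex set is $R=G(p,q^\#)\cap\mathbb{Z}^E$.) (5) (deletion-contraction) There exist a finite set $X$ and an M-convex set $R\subseteq\mathbb{Z}^{\widetilde E}$ with $\widetilde E=E\sqcup X$ such that $P=R\setminus X$ is the deletion and $Q=R/X$ is the contraction of $R$. (Moreover, $X$ can be picked to be a singleton.) (6) (exchange property) For all $x\in Q$, $y\in P$ and $i\in\mathrm{supp}^+(x-y)$, there exists $j\in\mathrm{supp}^-(x-y)$ such that $x-e_i+e_j\in Q$ and $y+e_i-e_j\in P$. (7) (induction) There exist a finite set $\widetilde E$, an M-convex set $\Gamma\subseteq\mathbb{Z}^E\times\mathbb{Z}^{\widetilde E}$ and an M-convex set $W\subseteq\mathbb{Z}^{\widetilde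 E}$ such that $P=\pi_E(\Gamma)^\uparrow$ and $Q=\mathrm{ind}_\Gamma(W)$. (8) ($\mathcal{R}$-ordered linking sets) There exist linking sets $\Gamma,\Delta\subseteq\mathbb{Z}^E\times\mathbb{Z}^E$ such that $P$ and $Q$ are the top layers of the left sets of $\Gamma$ and $\Delta$ respectively, and $\Gamma\preceq_{\mathcal{R}}\Delta$, where $\preceq_{\mathcal R}$ is Green's right preorder on the monoid of linking sets on $E$. (9) (matroid quotient lift) Any compatible matroid lifts $M,N$ of $P$ and $Q$ form a matroid quotient $M\twoheadrightarrow N$. (10) (compressed quotient) The Minkowski sum $P+Q$ is a flag M-convex set of type $\big((\mathrm{rk}(Q)+\ell,\mathrm{rk}(P)+\ell),\phi\big)$ for some surjection $\phi$ onto $E$ and some $\ell\in\mathbb{Z}$.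
   Context: Notation. For $x\in\mathbb{Z}^E$ and $A\subseteq E$, $x(A)=\sum_{i\in A}x_i$; $e_i$ is the $i$-th unit vector; $\mathrm{supp}^+(x-y)=\{i: x_i>y_i\}$ and $\mathrm{supp}^-(x-y)=\mathrm{supp}^+(y-x)$; $H_k=\{x: x(E)=k\}$. M-convex sets. A non-empty $P\subseteq\mathbb{Z}^E$ is M-convex if for all $x,y\in P$ and $i\in\mathrm{supp}^+(x-y)$ there is $j\in\mathrm{supp}^-(x-y)$ with $x-e_i+e_j\in P$ and $y+e_i-e_j\in P$. M-convex sets are assumed bounded (finite) unless explicitly allowed to be unbounded. The sum $x(E)$ is constant on $P$; it is the rank $\mathrm{rk}(P)$. The submodular function corresponding to $P$ is $p(A)=\max\{x(A): x\in P\}$ (so $p(\emptyset)=0$); one has $P=B(p)\cap\mathbb{Z}^E$, where $B(p)=\{x\in\mathbb{R}^E: x(A)\le p(A)\ \forall A\subseteq E,\ x(E)=p(E)\}$. For $\sigma\in\mathrm{Sym}(E)$ (with $E$ identified with $\{1,\dots,n\}$), the vertex $x_\sigma$ of $P$ is the unique maximizer over $P$ of $\sum_i c_ix_i$ for any $c$ with $c_{\sigma(1)}>c_{\sigma(2)}>\dots>c_{\sigma(n)}$. Submodular polyhedra. $S(p)=\{x: x(A)\le p(A)\ \forall A\}$. The contraction of $p$ by $X\subseteq E$ is $p_{/X}\colon 2^{E\setminus X}\to\mathbb{Z}$, $p_{/X}(A)=p(A\cup X)-p(X)$. The dual of $q$ is $q^\#(A)=q(E)-q(E\setminus A)$. $G(p,q^\#)=\{x\in\mathbb{R}^E: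 q^\#(A)\le x(A)\le p(A)\ \forall A\subseteq E\}$. M$^\natural$-convex sets. A non-empty bounded set $R\subseteq\mathbb{Z}^E$ is M$^\natural$-convex if for all $x,y\in R$: (i) if $x(E)>y(E)$ there is $i\in\mathrm{supp}^+(x-y)$ with $x-e_i\in R$, $y+e_i\in R$; (ii) if $x(E)=y(E)$, for every $i\in\mathrm{supp}^+(x-y)$ there is $j\in\mathrm{supp}^-(x-y)$ with $x-e_i+e_j\in R$ and $y+e_i-e_j\in R$. The top layer $R^\uparrow$ (resp. bottom layer $R^\downarrow$) is the set of points of $R$ with maximal (resp. minimal) coordinate sum. Deletion and contraction. For M-convex $R\subseteq\mathbb{Z}^{E\sqcup X}$ let $\pi_E(R)=\{x\in\mathbb{Z}^E:\exists y,\ (x,y)\in R\}$. The deletion is $R\setminus X=\pi_E(R)^\uparrow$ and the contraction is $R/X=\pi_E(R)^\downarrow$. Induction. For $\Gamma\subseteq\mathbb{Z}^E\times\mathbb{Z}^{\widetilde E}$ M-convex and $W\subseteq\mathbb{Z}^{\widetilde E}$: $\mathrm{ind}_\Gamma(W)=\{x\in\mathbb{Z}^E:\exists y\in W,\ (x,-y)\in\Gamma\}$, and $\pi_E(\Gamma)$ is the coordinate projection to $\mathbb{Z}^E$. Monoid of linking sets on $E$. Its elements are all (possibly unbounded, possibly empty) M-convex sets $\Gamma\subseteq\mathbb{Z}^E\times\mathbb{Z}^E$, called linking sets, with product $\Gamma*\Delta=\{(x,-z):\exists y\in\mathbb{Z}^E,\ (x,-y)\in\Gamma,\ (y,-z)\in\Delta\}$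 and identity $\{(x,-x):x\in\mathbb{Z}^E\}$. The left set of $\Gamma$ is its projection to the first factor $\mathbb{Z}^E$. Green's right preorder: $\Gamma\preceq_{\mathcal R}\Delta$ iff there is a linking set $X$ with $\Gamma*X=\Delta$. Lifts. A surjection $\phi\colon V\to E$ of finite sets induces $\pi_\phi\colon\mathbb{Z}^V\to\mathbb{Z}^E$ (also $\mathbb{R}^V\to\mathbb{R}^E$), $\pi_\phi(y)_i=\sum_{j\in\phi^{-1}(i)}y_j$. For $v\in\mathbb{Z}^E$, a box $B=\prod_{j\in V}([\underline b_j,\overline b_j]\cap\mathbb{Z})\subseteq\mathbb{Z}^V$, and an M-convex $P\subseteq\pi_\phi(B)+v$, put $L^B_{\phi,v}(P)=\{y\in B:\pi_\phi(y)+v\in P\}$; this is an M-convex set mapped onto $P$ by $y\mapsto\pi_\phi(y)+v$. Compatible matroid lifts of $P,Q$ are M-convex sets $M,N\subseteq\{0,1\}^V$ such that for some surjection $\phi\colon V\to E$, some $v\in\mathbb{Z}^E$ and some box $B\subseteq\mathbb{Z}^V$ with $M,N\subseteq B$ and $P,Q\subseteq\pi_\phi(B)+v$ one has $M=L^B_{\phi,v}(P)$ and $N=L^B_{\phi,v}(Q)$. M-convex subsets of $\{0,1\}^V$ are exactly (indicator vectors of) bases of matroids on $V$; matroids $M,N$ form a matroid quotient $M\twoheadrightarrow N$ if their rank functions satisfy $\mathrm{rk}_N(Y)-\mathrm{rk}_N(X)\le\mathrm{rk}_M(Y)-\mathrm{rk}_M(X)$ for all $X\subseteq Y\subseteq V$.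 Flag M-convex sets. Let $\Delta(m,V)$ be the hypersimplex, i.e. the convex hull of the points of $\{0,1\}^V$ with coordinate sum $m$. For a strictly increasing tuple $r=(r_1,\dots,r_k)$ of positive integers and a surjection $\phi\colon V\to E$, a flag M-convex polytope of type $(r,\phi)$ is a translate by an integer vector of a polytope $\pi_\phi(S)\subseteq\mathbb{R}^E$, where $S\subseteq\mathbb{R}^V$ is a generalized permutohedron (a polytope all of whose edges are parallel to vectors $e_i-e_j$) whose vertices are a subset of the vertices of $\sum_{j=1}^k\Delta(r_j,V)$. A flag M-convex set of type $(r,\phi)$ is the set of integer points of a flag M-convex polytope of type $(r,\phi)$.
   Formalization: As stated, (10) is not equivalent to (1)–(9). It is proved with the added requirement S=S₁+S₂, S₁⊆Δ(rk(Q)+ℓ,V), S₂⊆Δ(rk(P)+ℓ,V), with Q, P the integer points of their images under one common integer translation; types may be weakly increasing and nonnegative. *)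

theory Defs
  imports "HOL-Analysis.Analysis" "HOL-Library.Function_Algebras" "HOL-Library.Set_Algebras"
begin

section \<open>Vectors over finite ground sets\<close>

text \<open>
  The conditions of the theorem quantify over ground sets, so a vector over a finite set \<open>E\<close>
  (an element of \<open>\<int>\<^sup>E\<close> or \<open>\<real>\<^sup>E\<close>) is a function vanishing outside \<open>E\<close>. Vector addition and the
  Minkowski sum are the pointwise operations of \<open>Function_Algebras\<close> and \<open>Set_Algebras\<close>;
  with the following instance the library's \<open>polytope\<close>, \<open>face_of\<close> and \<open>extreme_point_of\<close>
  apply to such vectors. The coordinate sum \<open>x(A)\<close> is \<open>sum x A\<close>. Auxiliary finite sets are
  taken inside \<open>nat\<close>, and \<open>E \<squnion> X\<close> is the disjoint sum \<open>E <+> X\<close>, so that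
  \<open>case_sum x y\<close> is the vector \<open>(x, y)\<close>.
\<close>

instantiation "fun" :: (type, real_vector) real_vector
begin

definition scaleR_fun :: "real \<Rightarrow> ('a \<Rightarrow> 'b) \<Rightarrow> 'a \<Rightarrow> 'b"
  where "scaleR_fun a f = (\<lambda>x. a *\<^sub>R f x)"

instance
  by standard (auto simp: scaleR_fun_def fun_eq_iff scaleR_add_right scaleR_add_left)

end

definition vecs :: "'a set \<Rightarrow> ('a \<Rightarrow> 'b::zero) set"
  where "vecs E = {x. \<forall>i. i \<notin> E \<longrightarrow> x i = 0}"

definition unit_vec :: "'a \<Rightarrow> 'a \<Rightarrow> 'b::zero_neq_one"
  where "unit_vec i = (\<lambda>j. if j = i then 1 else 0)"

definition supp_pos :: "('a \<Rightarrow> int) \<Rightarrow> 'a set"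
  where "supp_pos d = {i. d i > 0}"

definition supp_neg :: "('a \<Rightarrow> int) \<Rightarrow> 'a set"
  where "supp_neg d = supp_pos (- d)"

definition real_vec :: "('a \<Rightarrow> int) \<Rightarrow> 'a \<Rightarrow> real"
  where "real_vec x = (\<lambda>i. real_of_int (x i))"

definition int_points :: "('a \<Rightarrow> real) set \<Rightarrow> ('a \<Rightarrow> int) set"
  where "int_points S = {x. real_vec x \<in> S}"

section \<open>M-convex sets\<close>

text \<open>Possibly empty, possibly unbounded:\<close>

definition m_convex_unbounded :: "'a set \<Rightarrow> ('a \<Rightarrow> int) set \<Rightarrow> bool"
  where "m_convex_unbounded E P \<longleftrightarrow> P \<subseteq> vecs E \<and>
    (\<forall>x\<in>P. \<forall>y\<in>P. \<forall>i\<in>supp_pos (x - y). \<exists>j\<in>supp_neg (x - y).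
       x - unit_vec i + unit_vec j \<in> P \<and> y + unit_vec i - unit_vec j \<in> P)"

definition m_convex :: "'a set \<Rightarrow> ('a \<Rightarrow> int) set \<Rightarrow> bool"
  where "m_convex E P \<longleftrightarrow> P \<noteq> {} \<and> finite P \<and> m_convex_unbounded E P"

definition rk :: "'a set \<Rightarrow> ('a \<Rightarrow> int) set \<Rightarrow> int"
  where "rk E P = (THE k. \<forall>x\<in>P. sum x E = k)"

definition submod :: "('a \<Rightarrow> int) set \<Rightarrow> 'a set \<Rightarrow> int"
  where "submod P A = Max ((\<lambda>x. sum x A) ` P)"

text \<open>
  \<open>\<sigma> : {1..n} \<rightarrow> E\<close> is a bijection, i.e. a permutation of \<open>E\<close> composed with an identification
  of \<open>E\<close> with \<open>{1..n}\<close>.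
\<close>

definition vertex :: "'a set \<Rightarrow> ('a \<Rightarrow> int) set \<Rightarrow> (nat \<Rightarrow> 'a) \<Rightarrow> 'a \<Rightarrow> int"
  where "vertex E P \<sigma> = (THE x. x \<in> P \<and>
    (\<forall>c :: 'a \<Rightarrow> real. (\<forall>i\<in>{1..card E}. \<forall>j\<in>{1..card E}. i < j \<longrightarrow> c (\<sigma> i) > c (\<sigma> j)) \<longrightarrow>
       (\<forall>z\<in>P. z \<noteq> x \<longrightarrow> (\<Sum>i\<in>E. c i * real_of_int (z i)) < (\<Sum>i\<in>E. c i * real_of_int (x i)))))"

section \<open>Submodular polyhedra\<close>

definition submod_polyhedron :: "'a set \<Rightarrow> ('a set \<Rightarrow> int) \<Rightarrow> ('a \<Rightarrow> real) set"
  where "submod_polyhedron E p = {x \<in> vecs E. \<forall>A\<subseteq>E. sum x A \<le> real_of_int (p A)}"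

definition contract :: "('a set \<Rightarrow> int) \<Rightarrow> 'a set \<Rightarrow> 'a set \<Rightarrow> int"
  where "contract p X A = p (A \<union> X) - p X"

definition dual :: "'a set \<Rightarrow> ('a set \<Rightarrow> int) \<Rightarrow> 'a set \<Rightarrow> int"
  where "dual E q A = q E - q (E - A)"

text \<open>\<open>g_polymatroid E p r\<close> is \<open>G(p, r)\<close>; it is applied to \<open>r = dual E q\<close>.\<close>

definition g_polymatroid :: "'a set \<Rightarrow> ('a set \<Rightarrow> int) \<Rightarrow> ('a set \<Rightarrow> int) \<Rightarrow> ('a \<Rightarrow> real) set"
  where "g_polymatroid E p r =
    {x \<in> vecs E. \<forall>A\<subseteq>E. real_of_int (r A) \<le> sum x A \<and> sum x A \<le> real_of_int (p A)}"

section \<open>Layers, deletion, contraction, induction\<close>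

definition mnat_convex :: "'a set \<Rightarrow> ('a \<Rightarrow> int) set \<Rightarrow> bool"
  where "mnat_convex E R \<longleftrightarrow> R \<noteq> {} \<and> finite R \<and> R \<subseteq> vecs E \<and>
    (\<forall>x\<in>R. \<forall>y\<in>R.
       (sum x E > sum y E \<longrightarrow>
          (\<exists>i\<in>supp_pos (x - y). x - unit_vec i \<in> R \<and> y + unit_vec i \<in> R)) \<and>
       (sum x E = sum y E \<longrightarrow>
          (\<forall>i\<in>supp_pos (x - y). \<exists>j\<in>supp_neg (x - y).
             x - unit_vec i + unit_vec j \<in> R \<and> y + unit_vec i - unit_vec j \<in> R)))"

definition top_layer :: "'a set \<Rightarrow> ('a \<Rightarrow> int) set \<Rightarrow> ('a \<Rightarrow> int) set"
  where "top_layer E R = {x \<in> R. \<forall>y\<in>R. sum y E \<le> sum x E}"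

definition bottom_layer :: "'a set \<Rightarrow> ('a \<Rightarrow> int) set \<Rightarrow> ('a \<Rightarrow> int) set"
  where "bottom_layer E R = {x \<in> R. \<forall>y\<in>R. sum x E \<le> sum y E}"

definition proj_left :: "('a + 'b \<Rightarrow> int) set \<Rightarrow> ('a \<Rightarrow> int) set"
  where "proj_left R = {x. \<exists>y. case_sum x y \<in> R}"

definition deletion :: "'a set \<Rightarrow> ('a + 'b \<Rightarrow> int) set \<Rightarrow> ('a \<Rightarrow> int) set"
  where "deletion E R = top_layer E (proj_left R)"

definition contraction :: "'a set \<Rightarrow> ('a + 'b \<Rightarrow> int) set \<Rightarrow> ('a \<Rightarrow> int) set"
  where "contraction E R = bottom_layer E (proj_left R)"

definition ind :: "('a + 'b \<Rightarrow> int) set \<Rightarrow> ('b \<Rightarrow> int) set \<Rightarrow> ('a \<Rightarrow> int) set"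
  where "ind \<Gamma> W = {x. \<exists>y\<in>W. case_sum x (- y) \<in> \<Gamma>}"

section \<open>The monoid of linking sets\<close>

definition linking_set :: "'a set \<Rightarrow> ('a + 'a \<Rightarrow> int) set \<Rightarrow> bool"
  where "linking_set E \<Gamma> \<longleftrightarrow> m_convex_unbounded (E <+> E) \<Gamma>"

definition link_prod ::
    "('a + 'a \<Rightarrow> int) set \<Rightarrow> ('a + 'a \<Rightarrow> int) set \<Rightarrow> ('a + 'a \<Rightarrow> int) set"
  where "link_prod \<Gamma> \<Delta> =
    {case_sum x (- z) | x z. \<exists>y. case_sum x (- y) \<in> \<Gamma> \<and> case_sum y (- z) \<in> \<Delta>}"

definition green_R :: "'a set \<Rightarrow> ('a + 'a \<Rightarrow> int) set \<Rightarrow> ('a + 'a \<Rightarrow> int) set \<Rightarrow> bool"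
  where "green_R E \<Gamma> \<Delta> \<longleftrightarrow> (\<exists>X. linking_set E X \<and> link_prod \<Gamma> X = \<Delta>)"

section \<open>Matroid lifts\<close>

definition push :: "'v set \<Rightarrow> ('v \<Rightarrow> 'a) \<Rightarrow> ('v \<Rightarrow> 'b::comm_monoid_add) \<Rightarrow> 'a \<Rightarrow> 'b"
  where "push V \<phi> y = (\<lambda>i. sum y {j \<in> V. \<phi> j = i})"

definition int_box :: "'v set \<Rightarrow> ('v \<Rightarrow> int) \<Rightarrow> ('v \<Rightarrow> int) \<Rightarrow> ('v \<Rightarrow> int) set"
  where "int_box V a b = {y \<in> vecs V. \<forall>j\<in>V. a j \<le> y j \<and> y j \<le> b j}"

definition box_lift :: "'v set \<Rightarrow> ('v \<Rightarrow> 'a) \<Rightarrow> ('a \<Rightarrow> int) \<Rightarrow> ('v \<Rightarrow> int) set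
    \<Rightarrow> ('a \<Rightarrow> int) set \<Rightarrow> ('v \<Rightarrow> int) set"
  where "box_lift V \<phi> v B P = {y \<in> B. push V \<phi> y + v \<in> P}"

definition compatible_matroid_lifts :: "'a set \<Rightarrow> ('a \<Rightarrow> int) set \<Rightarrow> ('a \<Rightarrow> int) set
    \<Rightarrow> 'v set \<Rightarrow> ('v \<Rightarrow> int) set \<Rightarrow> ('v \<Rightarrow> int) set \<Rightarrow> bool"
  where "compatible_matroid_lifts E P Q V M N \<longleftrightarrow>
    m_convex V M \<and> m_convex V N \<and>
    M \<subseteq> {y. range y \<subseteq> {0, 1}} \<and> N \<subseteq> {y. range y \<subseteq> {0, 1}} \<and>
    (\<exists>\<phi> v a b. \<phi> ` V = E \<and> v \<in> vecs E \<and>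
       M \<subseteq> int_box V a b \<and> N \<subseteq> int_box V a b \<and>
       P \<subseteq> (\<lambda>y. push V \<phi> y + v) ` int_box V a b \<and>
       Q \<subseteq> (\<lambda>y. push V \<phi> y + v) ` int_box V a b \<and>
       M = box_lift V \<phi> v (int_box V a b) P \<and> N = box_lift V \<phi> v (int_box V a b) Q)"

text \<open>Rank function of the matroid whose bases have the elements of \<open>M\<close> as indicator vectors:\<close>

definition matroid_rank :: "('v \<Rightarrow> int) set \<Rightarrow> 'v set \<Rightarrow> nat"
  where "matroid_rank M A = Max {card I | I. I \<subseteq> A \<and> (\<exists>y\<in>M. I \<subseteq> {j. y j = 1})}"

definition matroid_quotient :: "'v set \<Rightarrow> ('v \<Rightarrow> int) set \<Rightarrow> ('v \<Rightarrow> int) set \<Rightarrow> bool"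
  where "matroid_quotient V M N \<longleftrightarrow> (\<forall>X Y. X \<subseteq> Y \<longrightarrow> Y \<subseteq> V \<longrightarrow>
    int (matroid_rank N Y) - int (matroid_rank N X)
      \<le> int (matroid_rank M Y) - int (matroid_rank M X))"

section \<open>Flag M-convex sets\<close>

definition hypersimplex :: "'v set \<Rightarrow> int \<Rightarrow> ('v \<Rightarrow> real) set"
  where "hypersimplex V m =
    convex hull {x \<in> vecs V. (\<forall>j\<in>V. x j = 0 \<or> x j = 1) \<and> sum x V = real_of_int m}"

text \<open>The edges of a polytope are its faces that are nondegenerate segments.\<close>

definition generalized_permutohedron :: "'v set \<Rightarrow> ('v \<Rightarrow> real) set \<Rightarrow> bool"
  where "generalized_permutohedron V S \<longleftrightarrow> polytope S \<and> S \<subseteq> vecs V \<and>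
    (\<forall>a b. a \<noteq> b \<longrightarrow> closed_segment a b face_of S \<longrightarrow>
       (\<exists>i\<in>V. \<exists>j\<in>V. \<exists>t. b - a = t *\<^sub>R (unit_vec i - unit_vec j)))"

text \<open>
  The tuple \<open>r\<close> is only required to be weakly increasing and nonnegative. With strictly
  increasing positive tuples, the pair of ranks of \<open>Q\<close> and \<open>P\<close>, shifted by \<open>\<ell>\<close>, would not be
  a type at all if \<open>P = Q\<close> (and the trivial quotient \<open>P = Q\<close> satisfies all other conditions),
  and no nonempty flag M-convex set would exist over the empty ground set.
\<close>

definition flag_permutohedron :: "'v set \<Rightarrow> int list \<Rightarrow> ('v \<Rightarrow> real) set \<Rightarrow> bool"
  where "flag_permutohedron V r S \<longleftrightarrow>
    sorted r \<and> (\<forall>m\<in>set r. 0 \<le> m) \<and> generalized_permutohedron V S \<and>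
    {x. x extreme_point_of S} \<subseteq> {x. x extreme_point_of (\<Sum>m\<leftarrow>r. hypersimplex V m)}"

definition push_translate ::
    "'v set \<Rightarrow> ('v \<Rightarrow> 'a) \<Rightarrow> ('a \<Rightarrow> int) \<Rightarrow> ('v \<Rightarrow> real) set \<Rightarrow> ('a \<Rightarrow> real) set"
  where "push_translate V \<phi> v S = (\<lambda>y. push V \<phi> y + real_vec v) ` S"

definition flag_m_convex_set ::
    "'a set \<Rightarrow> int list \<Rightarrow> 'v set \<Rightarrow> ('v \<Rightarrow> 'a) \<Rightarrow> ('a \<Rightarrow> int) set \<Rightarrow> bool"
  where "flag_m_convex_set E r V \<phi> F \<longleftrightarrow> finite V \<and> \<phi> ` V = E \<and>
    (\<exists>S v. flag_permutohedron V r S \<and> v \<in> vecs E \<and> F = int_points (push_translate V \<phi> v S))"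

text \<open>
  In the compressed quotient condition, ``the Minkowski sum \<open>P + Q\<close> is a flag M-convex set''
  has to be read as a statement about the sum together with its summands. As a statement about
  the set \<open>P + Q\<close> alone it does not imply that \<open>Q\<close> is a quotient of \<open>P\<close>: for
  \<open>E = {1, 2}\<close>, \<open>P = {(-4, 5)}\<close>, \<open>Q = {(0, 0)}\<close>, the set \<open>P + Q\<close> is a translate of the image
  of a vertex of \<open>\<Delta>(1, E) + \<Delta>(2, E)\<close>, but \<open>P\<close> does not dominate \<open>Q\<close>. Dropping translations does
  not help: \<open>{(2, 2)} + {(3, 0), (2, 1), (1, 2), (0, 3)}\<close> equals
  \<open>{(3, 1), (2, 2), (1, 3)} + {(2, 1), (1, 2)}\<close>; the latter is a quotient pair, the former is not.
  The following says that \<open>Q\<close> and \<open>P\<close> are the images, under a common translation, of the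
  summands \<open>S\<^sub>1 \<subseteq> \<Delta>(r\<^sub>1, V)\<close> and \<open>S\<^sub>2 \<subseteq> \<Delta>(r\<^sub>2, V)\<close> of such an \<open>S\<close>.
\<close>

definition flag_summands :: "'a set \<Rightarrow> int \<Rightarrow> int \<Rightarrow> 'v set \<Rightarrow> ('v \<Rightarrow> 'a)
    \<Rightarrow> ('a \<Rightarrow> int) set \<Rightarrow> ('a \<Rightarrow> int) set \<Rightarrow> bool"
  where "flag_summands E r1 r2 V \<phi> Q P \<longleftrightarrow>
    (\<exists>S1 S2 v. polytope S1 \<and> S1 \<subseteq> hypersimplex V r1 \<and>
       polytope S2 \<and> S2 \<subseteq> hypersimplex V r2 \<and>
       flag_permutohedron V [r1, r2] (S1 + S2) \<and> v \<in> vecs E \<and>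
       Q = int_points (push_translate V \<phi> v S1) \<and> P = int_points (push_translate V \<phi> v S2))"

section \<open>Equivalence of a list of conditions\<close>

definition all_equivalent :: "bool list \<Rightarrow> bool"
  where "all_equivalent cs \<longleftrightarrow> (\<forall>a\<in>set cs. \<forall>b\<in>set cs. a \<longleftrightarrow> b)"

end

theory Submission
  imports Defs
begin

text \<open>
  An M-convex set is the set of integer points of the base polyhedron of its submodular function.
  Every condition is compared with compliance (1). Common maximisers of \<open>x(X)\<close> and \<open>x(Y)\<close> for
  \<open>X \<subseteq> Y\<close> turn exchange properties into inequalities, and uncrossing of tight sets turns
  compliance back into the exchange property (6). Compliance says that \<open>p\<close>, and \<open>q\<close> on the sets
  containing an extra element, glue to a submodular function, whose base polyhedron provides the
  witnesses for (4), (5), (7), (8). In (5), (7), (8) a single exchange between points over \<open>Q\<close> and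
  \<open>P\<close> yields (6), because \<open>P\<close> is a top layer. For (9) and (10) the exchange property lifts along
  0/1 boxes; extreme points of \<open>\<Delta>(r\<^sub>1, V) + \<Delta>(r\<^sub>2, V)\<close> are the sums of nested vertices.
\<close>

section \<open>M-convex sets and their submodular functions\<close>

text \<open>The pivot is the relation \<open>exch Q P\<close>, because for \<open>Q = P\<close> it
  is M-convexity itself: a single uncrossing argument gives (6) from compliance and, with p = q, the
  M-convexity of integer base polyhedra, and a single lifting argument treats one set as well as a
  pair. Two conditions resist this. The addition to (4) speaks of every R with layers P and Q, so
  all layers in between must be determined; they are, because for fixed A the maximum of x(A) grows
  by exactly 1 per layer until it reaches p(A) and then stays there. In (10) the hypothesis concerns
  the edges of a real polytope, for which no exchange property is available; a vertex that maximises
  x(X) and x(Y) together is extracted from the edge directions by perturbing a linear functional. In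
  the other direction of (10), P + Q must contain every integer point of its convex hull; this rests
  on the M-convexity of P + Q, which the discrete sandwich theorem provides.\<close>

abbreviation lower :: "('a \<Rightarrow> 'b) \<Rightarrow> 'a \<Rightarrow> 'a \<Rightarrow> 'a \<Rightarrow> 'b::ring_1"
  where "lower x i j \<equiv> x - unit_vec i + unit_vec j"

abbreviation raise :: "('a \<Rightarrow> 'b) \<Rightarrow> 'a \<Rightarrow> 'a \<Rightarrow> 'a \<Rightarrow> 'b::ring_1"
  where "raise x i j \<equiv> x + unit_vec i - unit_vec j"

definition exch :: "('a \<Rightarrow> int) set \<Rightarrow> ('a \<Rightarrow> int) set \<Rightarrow> bool"
  where "exch Q P \<longleftrightarrow> (\<forall>x\<in>Q. \<forall>y\<in>P. \<forall>i\<in>supp_pos (x - y). \<exists>j\<in>supp_neg (x - y).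
    x - unit_vec i + unit_vec j \<in> Q \<and> raise y i j \<in> P)"

lemma supp_pos_diff_iff [simp]: "i \<in> supp_pos (x - y) \<longleftrightarrow> y i < x i"
  by (simp add: supp_pos_def)

lemma supp_neg_diff_iff [simp]: "j \<in> supp_neg (x - y) \<longleftrightarrow> x j < y j"
  by (simp add: supp_neg_def supp_pos_def)

lemma exchI:
  assumes "\<And>x y i. x \<in> Q \<Longrightarrow> y \<in> P \<Longrightarrow> y i < x i \<Longrightarrow>
    \<exists>j. x j < y j \<and> lower x i j \<in> Q \<and> raise y i j \<in> P"
  shows "exch Q P"
  using assms unfolding exch_def by (simp add: Bex_def)

lemma exchE:
  assumes "exch Q P" "x \<in> Q" "y \<in> P" "y i < x i"
  obtains j where "x j < y j" "lower x i j \<in> Q" "raise y i j \<in> P"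
proof -
  have "\<exists>j\<in>supp_neg (x - y). x - unit_vec i + unit_vec j \<in> Q \<and> raise y i j \<in> P"
    using assms unfolding exch_def by simp
  then show ?thesis using that by auto
qed

lemma m_convex_unbounded_iff: "m_convex_unbounded E P \<longleftrightarrow> P \<subseteq> vecs E \<and> exch P P"
  by (simp add: m_convex_unbounded_def exch_def)

lemma m_convex_iff: "m_convex E P \<longleftrightarrow> P \<noteq> {} \<and> finite P \<and> P \<subseteq> vecs E \<and> exch P P"
  by (simp add: m_convex_def m_convex_unbounded_iff)

lemma m_convexD:
  assumes "m_convex E P"
  shows "P \<noteq> {}" "finite P" "P \<subseteq> vecs E" "exch P P"
  using assms by (simp_all add: m_convex_iff)

lemma vecs_neq_in:
  assumes "x \<in> vecs E" "y \<in> vecs E" "x i \<noteq> y i"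
  shows "i \<in> E"
proof (rule ccontr)
  assume "i \<notin> E"
  then have "x i = 0" "y i = 0" using assms(1,2) by (simp_all add: vecs_def)
  then show False using assms(3) by simp
qed

lemma unit_vec_apply: "unit_vec i j = (if j = i then 1 else 0)"
  by (simp add: unit_vec_def)

lemma sum_fun_add: "sum (x + y) A = sum x A + sum y A"
  for x y :: "'a \<Rightarrow> 'b::comm_monoid_add"
  by (simp add: plus_fun_def sum.distrib)

lemma sum_fun_diff: "sum (x - y) A = sum x A - sum y A"
  for x y :: "'a \<Rightarrow> 'b::ab_group_add"
  by (simp add: fun_diff_def sum_subtractf)

lemma sum_unit_vec: "finite A \<Longrightarrow> sum (unit_vec i) A = of_bool (i \<in> A)"
  for A :: "'a set"
  by (simp add: unit_vec_def sum.delta')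

lemma sum_exchange:
  fixes x :: "'a \<Rightarrow> 'b::ring_1"
  assumes "finite A"
  shows "sum (lower x i j) A = sum x A - of_bool (i \<in> A) + of_bool (j \<in> A)"
    and "sum (raise x i j) A = sum x A + of_bool (i \<in> A) - of_bool (j \<in> A)"
    and "(\<Sum>k\<in>A. x k - unit_vec i k + unit_vec j k) = sum x A - of_bool (i \<in> A) + of_bool (j \<in> A)"
    and "(\<Sum>k\<in>A. x k + unit_vec i k - unit_vec j k) = sum x A + of_bool (i \<in> A) - of_bool (j \<in> A)"
  using assms
  by (simp_all only: sum_fun_add sum_fun_diff sum_unit_vec sum.distrib sum_subtractf)

lemma sum_less_imp_ex:
  fixes x y :: "'a \<Rightarrow> int"
  assumes "sum y A < sum x A"
  obtains i where "i \<in> A" "y i < x i"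
proof -
  have "\<exists>i\<in>A. y i < x i"
  proof (rule ccontr)
    assume "\<not> ?thesis"
    then have "sum x A \<le> sum y A" by (intro sum_mono) (simp add: not_less)
    then show False using assms by simp
  qed
  then show ?thesis using that by blast
qed

section \<open>Exchange, distance and linear maximisers\<close>

definition l1_dist :: "'a set \<Rightarrow> ('a \<Rightarrow> int) \<Rightarrow> ('a \<Rightarrow> int) \<Rightarrow> nat"
  where "l1_dist E x y = nat (\<Sum>i\<in>E. \<bar>x i - y i\<bar>)"

text \<open>Both coordinates touched by the exchange approach those of y and no other coordinate
  moves. This distance is the termination measure of the exchange arguments.\<close>

lemma l1_dist_exchange_less:
  assumes "finite E" "i \<in> E" "y i < x i" "x j < y j"
  shows "l1_dist E (lower x i j) y < l1_dist E x y"
proof -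
  have "(\<Sum>k\<in>E. \<bar>(lower x i j) k - y k\<bar>) < (\<Sum>k\<in>E. \<bar>x k - y k\<bar>)"
    using assms by (intro sum_strict_mono_ex1) (auto simp: unit_vec_apply)
  moreover have "(\<Sum>k\<in>E. \<bar>(lower x i j) k - y k\<bar>) \<ge> 0"
    by (intro sum_nonneg) auto
  ultimately show ?thesis
    unfolding l1_dist_def by linarith
qed

lemma l1_dist_exchange_less':
  assumes "finite E" "j \<in> E" "y i < x i" "x j < y j"
  shows "l1_dist E (raise y i j) x < l1_dist E y x"
  using l1_dist_exchange_less[OF assms(1,2), of x y i] assms(3,4) by (simp add: algebra_simps)

text \<open>If x(E) exceeded y(E), an exchange at a coordinate where x is larger would keep x(E) and
  bring x closer to y, so induction on the distance excludes it.\<close>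

lemma exch_sum_le:
  assumes fin: "finite E" and P: "P \<subseteq> vecs E" and ex: "exch P P" and "x \<in> P" "y \<in> P"
  shows "sum x E \<le> sum y E"
  using \<open>x \<in> P\<close>
proof (induction "l1_dist E x y" arbitrary: x rule: less_induct)
  case less
  show ?case
  proof (rule ccontr)
    assume neg: "\<not> ?thesis"
    then obtain i where i: "i \<in> E" "y i < x i"
      using sum_less_imp_ex[of y E x] by auto
    obtain j where j: "x j < y j" "lower x i j \<in> P"
      using exchE[OF ex less.prems \<open>y \<in> P\<close> i(2)] by blast
    have "j \<in> E"
      using vecs_neq_in[of x E y j] P less.prems \<open>y \<in> P\<close> j(1) by auto
    then have "sum (lower x i j) E = sum x E"
      using fin i by (simp add: sum_exchange)
    then show False
      using less.hyps[OF l1_dist_exchange_less[where x = x, OF fin i j(1)] j(2)] neg by simp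
  qed
qed

lemma exch_sum_eq:
  assumes "finite E" "P \<subseteq> vecs E" "exch P P" "x \<in> P" "y \<in> P"
  shows "sum x E = sum y E"
  using exch_sum_le[OF assms(1-3)] assms(4,5) by (intro antisym) blast+

definition weight :: "'a set \<Rightarrow> ('a \<Rightarrow> real) \<Rightarrow> ('a \<Rightarrow> int) \<Rightarrow> real"
  where "weight E c x = (\<Sum>i\<in>E. c i * real_of_int (x i))"

lemma weight_exchange:
  assumes "finite E" "i \<in> E" "j \<in> E"
  shows "weight E c (lower x i j) = weight E c x - c i + c j"
proof -
  have "weight E c (lower x i j) =
      (\<Sum>k\<in>E. c k * real_of_int (x k) - (if k = i then c k else 0) + (if k = j then c k else 0))"
    unfolding weight_def by (intro sum.cong) (auto simp: unit_vec_apply algebra_simps)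
  also have "\<dots> = weight E c x - (\<Sum>k\<in>E. if k = i then c k else 0) + (\<Sum>k\<in>E. if k = j then c k else 0)"
    by (simp only: weight_def sum.distrib sum_subtractf)
  finally show ?thesis
    by (simp only: sum.delta[OF assms(1)] assms if_True)
qed

text \<open>Suppose y has more than x on A, hence less outside A, and exchange x with y at such an
  outside coordinate i. Optimality of x for c forbids the partner j to lie in A, where c is larger.
  So y moves towards x without changing y(A), and induction on the distance applies.\<close>

lemma exch_weight_max_imp_sum_max:
  assumes fin: "finite E" and P: "P \<subseteq> vecs E" and ex: "exch P P"
    and x: "x \<in> P" and max: "\<And>z. z \<in> P \<Longrightarrow> weight E c z \<le> weight E c x"
    and A: "A \<subseteq> E" and c: "\<And>i j. j \<in> A \<Longrightarrow> i \<in> E - A \<Longrightarrow> c i < c j"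
    and "y \<in> P"
  shows "sum y A \<le> sum x A"
  using \<open>y \<in> P\<close>
proof (induction "l1_dist E y x" arbitrary: y rule: less_induct)
  case less
  show ?case
  proof (rule ccontr)
    assume neg: "\<not> ?thesis"
    have "sum x E = sum y E"
      by (rule exch_sum_eq[OF fin P ex x less.prems])
    moreover have "sum z E = sum z (E - A) + sum z A" for z :: "'a \<Rightarrow> int"
      using sum.subset_diff[OF A fin, of z] by simp
    note this[of x] this[of y]
    ultimately have "sum y (E - A) < sum x (E - A)"
      using neg by linarith
    then obtain i where i: "i \<in> E - A" "y i < x i"
      using sum_less_imp_ex by blast
    obtain j where j: "x j < y j" "lower x i j \<in> P" "raise y i j \<in> P"
      using exchE[OF ex x less.prems i(2)] by blast
    have jE: "j \<in> E"
      using vecs_neq_in[of x E y j] P x less.prems j(1) by auto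
    have "weight E c (lower x i j) \<le> weight E c x"
      using max j(2) by blast
    then have "c j \<le> c i"
      using fin i jE by (simp add: weight_exchange)
    then have "j \<notin> A"
      using c[of j i] i by force
    then have "sum (raise y i j) A = sum y A"
      using finite_subset[OF A fin] i by (simp add: sum_exchange)
    moreover have "sum (raise y i j) A \<le> sum x A"
      by (rule less.hyps[OF l1_dist_exchange_less'[OF fin jE i(2) j(1)] j(3)])
    ultimately show False
      using neg by linarith
  qed
qed

lemma finite_has_maximizer:
  fixes f :: "'a \<Rightarrow> 'b::linorder"
  assumes "finite P" "P \<noteq> {}"
  obtains x where "x \<in> P" "\<And>z. z \<in> P \<Longrightarrow> f z \<le> f x"
proof -
  have "Max (f ` P) \<in> f ` P"
    using assms by (intro Max_in) auto
  then obtain x where x: "x \<in> P" "Max (f ` P) = f x" by auto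
  have "f z \<le> f x" if "z \<in> P" for z
    using that assms x(2) Max_ge[of "f ` P" "f z"] by auto
  then show ?thesis using that x by blast
qed

lemma finite_has_minimizer:
  fixes f :: "'a \<Rightarrow> nat"
  assumes "finite P" "P \<noteq> {}"
  obtains x where "x \<in> P" "\<And>z. z \<in> P \<Longrightarrow> f x \<le> f z"
proof -
  obtain z where "z \<in> P" using assms(2) by blast
  then show ?thesis
    using that arg_min_nat_lemma[of "\<lambda>x. x \<in> P" z f] by blast
qed

lemma submod_ge: "finite P \<Longrightarrow> x \<in> P \<Longrightarrow> sum x A \<le> submod P A"
  by (simp add: submod_def)

lemma submod_eqI:
  assumes "finite P" "x \<in> P" "\<And>y. y \<in> P \<Longrightarrow> sum y A \<le> sum x A"
  shows "submod P A = sum x A"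
  unfolding submod_def using assms by (intro Max_eqI) auto

lemma submod_attained:
  assumes "finite P" "P \<noteq> {}"
  obtains x where "x \<in> P" "sum x A = submod P A"
proof -
  obtain x where x: "x \<in> P" "\<And>z. z \<in> P \<Longrightarrow> sum z A \<le> sum x A"
    using finite_has_maximizer[OF assms, of "\<lambda>x. sum x A"] by blast
  show ?thesis
    by (rule that[OF x(1)]) (rule submod_eqI[OF assms(1) x, symmetric])
qed

lemma submod_empty: "finite P \<Longrightarrow> P \<noteq> {} \<Longrightarrow> submod P {} = 0"
  by (rule submod_attained[of P "{}"]) auto

lemma m_convex_sum_eq:
  assumes "finite E" "m_convex E P" "x \<in> P"
  shows "sum x E = submod P E"
proof -
  have P: "P \<noteq> {}" "finite P" "P \<subseteq> vecs E" "exch P P"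
    using assms(2) by (auto simp: m_convex_iff)
  obtain y where y: "y \<in> P" "sum y E = submod P E"
    using submod_attained[OF P(2,1)] by blast
  show ?thesis
    using exch_sum_eq[OF assms(1) P(3,4) assms(3) y(1)] y(2) by simp
qed

lemma m_convex_chain:
  assumes fin: "finite E" and P: "m_convex E P" and "X \<subseteq> Y" "Y \<subseteq> E"
  obtains x where "x \<in> P" "sum x X = submod P X" "sum x Y = submod P Y"
proof -
  note P' = m_convexD[OF P]
  \<comment> \<open>X and Y are both upper level sets of this weight, so one maximiser serves
    both.\<close>
  define c :: "'a \<Rightarrow> real" where "c = (\<lambda>i. if i \<in> X then 2 else if i \<in> Y then 1 else 0)"
  obtain x where x: "x \<in> P" "\<And>z. z \<in> P \<Longrightarrow> weight E c z \<le> weight E c x"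
    using finite_has_maximizer[OF P'(2,1)] by blast
  have "sum y X \<le> sum x X" if "y \<in> P" for y
    by (rule exch_weight_max_imp_sum_max[OF fin P'(3,4) x _ _ that])
      (use assms in \<open>auto simp: c_def\<close>)
  moreover have "sum y Y \<le> sum x Y" if "y \<in> P" for y
    by (rule exch_weight_max_imp_sum_max[OF fin P'(3,4) x _ _ that])
      (use assms in \<open>auto simp: c_def\<close>)
  ultimately show ?thesis
    by (intro that[OF x(1)]) (auto intro!: submod_eqI[OF P'(2) x(1), symmetric])
qed

section \<open>Submodular functions and integer base points\<close>

definition submodular_on :: "'a set \<Rightarrow> ('a set \<Rightarrow> int) \<Rightarrow> bool"
  where "submodular_on E r \<longleftrightarrow> r {} = 0 \<and>
    (\<forall>A B. A \<subseteq> E \<longrightarrow> B \<subseteq> E \<longrightarrow> r (A \<union> B) + r (A \<inter> B) \<le> r A + r B)"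

lemma submodular_onD:
  assumes "submodular_on E r" "A \<subseteq> E" "B \<subseteq> E"
  shows "r (A \<union> B) + r (A \<inter> B) \<le> r A + r B"
  using assms by (simp add: submodular_on_def)

definition base_points :: "'a set \<Rightarrow> ('a set \<Rightarrow> int) \<Rightarrow> ('a \<Rightarrow> int) set"
  where "base_points E r = {x \<in> vecs E. (\<forall>A\<subseteq>E. sum x A \<le> r A) \<and> sum x E = r E}"

text \<open>One point that is maximal on both A \<inter> B and A \<union> B reduces the inequality
  to additivity of x.\<close>

lemma submodular_on_submod:
  assumes fin: "finite E" and P: "m_convex E P"
  shows "submodular_on E (submod P)"
  unfolding submodular_on_def
proof (intro conjI allI impI)
  have P': "P \<noteq> {}" "finite P"
    using P by (auto simp: m_convex_iff)
  then show "submod P {} = 0"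
    by (simp add: submod_empty)
  fix A B assume AB: "A \<subseteq> E" "B \<subseteq> E"
  have "A \<inter> B \<subseteq> A \<union> B" "A \<union> B \<subseteq> E"
    using AB by auto
  then obtain x where x: "x \<in> P" "sum x (A \<inter> B) = submod P (A \<inter> B)" "sum x (A \<union> B) = submod P (A \<union> B)"
    using m_convex_chain[OF fin P] by blast
  have "sum x (A \<union> B) + sum x (A \<inter> B) = sum x A + sum x B"
    using AB fin by (simp add: finite_subset sum.union_inter)
  also have "\<dots> \<le> submod P A + submod P B"
    using x(1) P' by (intro add_mono submod_ge)
  finally show "submod P (A \<union> B) + submod P (A \<inter> B) \<le> submod P A + submod P B"
    using x by simp
qed

text \<open>
  The directions in which one can leave \<open>x\<close> are transitive, so the coordinates that cannot be
  increased at the expense of \<open>i\<close> form a tight set.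
\<close>

lemma m_convex_exchange_trans:
  assumes ex: "exch P P"
    and 1: "lower x k j \<in> P" and 2: "lower x i k \<in> P"
    and "i \<noteq> j" "k \<noteq> j" "k \<noteq> i"
  shows "lower x i j \<in> P"
proof -
  \<comment> \<open>The difference u - w is positive only at k and negative only at i and j, so k
    can be exchanged only against i or j; both outcomes produce \<open>lower x i j\<close>.\<close>
  define u where "u = x - unit_vec i + unit_vec k"
  define w where "w = x - unit_vec k + unit_vec j"
  have "w k < u k"
    using assms by (simp add: u_def w_def unit_vec_apply)
  then obtain l where l: "u l < w l" "lower u k l \<in> P" "raise w k l \<in> P"
    using exchE[OF ex] 1 2 unfolding u_def w_def by blast
  have "l = i \<or> l = j"
    using l(1) assms(4-) by (auto simp: u_def w_def unit_vec_apply split: if_splits)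
  then show ?thesis
  proof
    assume "l = i"
    then have "raise w k l = x - unit_vec i + unit_vec j"
      by (simp add: w_def)
    then show ?thesis using l by simp
  next
    assume "l = j"
    then have "lower u k l = x - unit_vec i + unit_vec j"
      by (simp add: u_def)
    then show ?thesis using l by simp
  qed
qed

text \<open>Exchange a y with y(A) > x(A) against x at some j in A. The partner k again lies in A:
  otherwise k is i or can be raised at the expense of i, and then so can j, by transitivity in the
  second case. Hence y(A) is unchanged while y approaches x.\<close>

lemma m_convex_tight_set:
  assumes fin: "finite E" and P: "P \<subseteq> vecs E" and ex: "exch P P" and x: "x \<in> P" and i: "i \<in> E"
    and A: "A = {j \<in> E. j \<noteq> i \<and> lower x i j \<notin> P}"
    and "y \<in> P"
  shows "sum y A \<le> sum x A"
  using \<open>y \<in> P\<close>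
proof (induction "l1_dist E y x" arbitrary: y rule: less_induct)
  case less
  show ?case
  proof (rule ccontr)
    assume neg: "\<not> ?thesis"
    then obtain j where j: "j \<in> A" "x j < y j"
      using sum_less_imp_ex[of x A y] by auto
    obtain k where k: "y k < x k" "lower y j k \<in> P" "raise x j k \<in> P"
      using exchE[OF ex less.prems x j(2)] by blast
    have kE: "k \<in> E"
      using vecs_neq_in[of x E y k] P x less.prems k(1) by auto
    have jE: "j \<in> E" "j \<noteq> i" "lower x i j \<notin> P"
      using j A by auto
    have eq: "raise x j k = x - unit_vec k + unit_vec j"
      by simp
    have "k \<noteq> i"
      using k(3) jE(3) unfolding eq by auto
    moreover have "k \<noteq> j"
      using k(1) j(2) by auto
    ultimately have "lower x i k \<notin> P"
      using m_convex_exchange_trans[OF ex, of x k j i] k(3) jE unfolding eq by auto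
    then have "k \<in> A"
      using A kE \<open>k \<noteq> i\<close> by auto
    have "finite A"
      using A fin by auto
    then have "sum (lower y j k) A = sum y A"
      using j(1) \<open>k \<in> A\<close> by (simp add: sum_exchange)
    moreover have "sum (lower y j k) A \<le> sum x A"
      by (rule less.hyps[OF l1_dist_exchange_less[where x = y and y = x, OF fin jE(1) j(2) k(1)] k(2)])
    ultimately show False
      using neg by linarith
  qed
qed

text \<open>For z in the base polyhedron take x in P nearest to z. If they differ, x exceeds z at
  some i; let A collect the coordinates that cannot be raised at the expense of i. Then z(A) <= p(A)
  = x(A), and outside A no coordinate of x lies below z, since raising it would bring x nearer. With
  the strict excess at i this contradicts x(E) = z(E).\<close>

lemma m_convex_eq_base_points:
  assumes fin: "finite E" and P: "m_convex E P"
  shows "P = base_points E (submod P)"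
proof (rule subset_antisym)
  note P' = m_convexD[OF P]
  show "P \<subseteq> base_points E (submod P)"
  proof
    fix x assume "x \<in> P"
    then show "x \<in> base_points E (submod P)"
      using P'(3) m_convex_sum_eq[OF fin P] submod_ge[OF P'(2)] unfolding base_points_def by blast
  qed
  show "base_points E (submod P) \<subseteq> P"
  proof
    fix z assume z: "z \<in> base_points E (submod P)"
    obtain x where x: "x \<in> P" "\<And>u. u \<in> P \<Longrightarrow> l1_dist E x z \<le> l1_dist E u z"
      using finite_has_minimizer[OF P'(2,1), of "\<lambda>u. l1_dist E u z"] by blast
    have sum: "sum x E = sum z E"
      using m_convex_sum_eq[OF fin P x(1)] z by (simp add: base_points_def)
    have zE: "z \<in> vecs E" and xE: "x \<in> vecs E"
      using z x P' by (auto simp: base_points_def)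
    have "x = z"
    proof (rule ccontr)
      assume "x \<noteq> z"
      then obtain k where k: "x k \<noteq> z k" by auto
      have kE: "k \<in> E" by (rule vecs_neq_in[OF xE zE k])
      have "\<exists>i\<in>E. z i < x i"
      proof (rule ccontr)
        assume "\<not> ?thesis"
        then have "\<And>i. i \<in> E \<Longrightarrow> x i \<le> z i" by (meson not_le)
        then have "sum x E < sum z E"
          using k kE by (intro sum_strict_mono_ex1 fin) (auto simp: order.strict_iff_order)
        then show False using sum by simp
      qed
      then obtain i where i: "i \<in> E" "z i < x i" by auto
      define A where "A = {j \<in> E. j \<noteq> i \<and> lower x i j \<notin> P}"
      have "submod P A = sum x A"
        by (rule submod_eqI[OF P'(2) x(1)]) (rule m_convex_tight_set[OF fin P'(3,4) x(1) i(1) A_def])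
      moreover have "sum z A \<le> submod P A"
        using z unfolding base_points_def A_def by auto
      moreover have "sum z (E - A) < sum x (E - A)"
      proof (rule sum_strict_mono_ex1)
        show "finite (E - A)" using fin by auto
        show "\<exists>a\<in>E - A. z a < x a" using i by (auto simp: A_def)
        show "\<forall>a\<in>E - A. z a \<le> x a"
        proof (intro ballI, rule ccontr)
          fix a assume a: "a \<in> E - A" "\<not> z a \<le> x a"
          then have "a \<noteq> i" using i by auto
          then have "lower x i a \<in> P" using a by (auto simp: A_def)
          then have "l1_dist E x z \<le> l1_dist E (lower x i a) z" using x(2) by blast
          moreover have "l1_dist E (lower x i a) z < l1_dist E x z"
            using l1_dist_exchange_less[where x = x and y = z, OF fin i] a by auto
          ultimately show False by simp
        qed
      qed
      moreover have "sum u E = sum u A + sum u (E - A)" for u :: "'a \<Rightarrow> int"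
        using sum.subset_diff[of A E u] fin by (simp add: A_def)
      note this[of x] this[of z]
      ultimately show False using sum by linarith
    qed
    then show "z \<in> P" using x by simp
  qed
qed

section \<open>Compliance and the exchange property\<close>

definition compliant :: "'a set \<Rightarrow> ('a set \<Rightarrow> int) \<Rightarrow> ('a set \<Rightarrow> int) \<Rightarrow> bool"
  where "compliant E q p \<longleftrightarrow> (\<forall>X Y. X \<subseteq> Y \<longrightarrow> Y \<subseteq> E \<longrightarrow> q Y - q X \<le> p Y - p X)"

lemma compliantD: "compliant E q p \<Longrightarrow> X \<subseteq> Y \<Longrightarrow> Y \<subseteq> E \<Longrightarrow> q Y - q X \<le> p Y - p X"
  by (simp add: compliant_def)

lemma base_points_leD: "x \<in> base_points E r \<Longrightarrow> A \<subseteq> E \<Longrightarrow> sum x A \<le> r A"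
  by (simp add: base_points_def)

lemma tight_Un_Int:
  assumes fin: "finite E" and r: "submodular_on E r" and x: "x \<in> base_points E r"
    and A: "A \<subseteq> E" "sum x A = r A" and B: "B \<subseteq> E" "sum x B = r B"
  shows "sum x (A \<union> B) = r (A \<union> B)" "sum x (A \<inter> B) = r (A \<inter> B)"
proof -
  have "sum x (A \<union> B) + sum x (A \<inter> B) = sum x A + sum x B"
    using A B fin by (intro sum.union_inter) (auto intro: finite_subset)
  moreover have "sum x (A \<union> B) \<le> r (A \<union> B)" "sum x (A \<inter> B) \<le> r (A \<inter> B)"
    using A B by (auto intro!: base_points_leD[OF x])
  ultimately show "sum x (A \<union> B) = r (A \<union> B)" "sum x (A \<inter> B) = r (A \<inter> B)"
    using submodular_onD[OF r A(1) B(1)] A(2) B(2) by linarith+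
qed

text \<open>The intersection of tight sets is tight, so one of least cardinality lies in all others.
  An element j of T belongs to every tight set around i, so raising i and lowering j violates no
  bound.\<close>

lemma least_tight_set:
  assumes fin: "finite E" and r: "submodular_on E r" and x: "x \<in> base_points E r" and i: "i \<in> E"
  obtains T where "i \<in> T" "T \<subseteq> E" "sum x T = r T"
    "\<And>A. A \<subseteq> E \<Longrightarrow> i \<in> A \<Longrightarrow> sum x A = r A \<Longrightarrow> T \<subseteq> A"
proof -
  define \<T> where "\<T> = {A. A \<subseteq> E \<and> i \<in> A \<and> sum x A = r A}"
  have "finite \<T>" using fin by (auto simp: \<T>_def)
  have "E \<in> \<T>" using x i by (auto simp: \<T>_def base_points_def)
  obtain T where T: "T \<in> \<T>" "\<And>A. A \<in> \<T> \<Longrightarrow> card T \<le> card A"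
    using finite_has_minimizer[of \<T> card] \<open>finite \<T>\<close> \<open>E \<in> \<T>\<close> by blast
  have "T \<subseteq> A" if "A \<in> \<T>" for A
  proof -
    have "T \<inter> A \<in> \<T>"
      using T(1) that tight_Un_Int(2)[OF fin r x, of T A] by (auto simp: \<T>_def)
    moreover have "finite T" using T(1) fin by (auto simp: \<T>_def intro: finite_subset)
    ultimately have "T \<inter> A = T"
      using T(2) by (intro card_seteq) auto
    then show ?thesis by auto
  qed
  then show ?thesis using that T(1) by (auto simp: \<T>_def)
qed

text \<open>The mirror image of the previous lemma, by closure under union: an element j outside U
  lies in no tight set that avoids i, so lowering i and raising j violates no bound.\<close>

lemma greatest_tight_set:
  assumes fin: "finite E" and r: "submodular_on E r" and x: "x \<in> base_points E r"
  obtains U where "i \<notin> U" "U \<subseteq> E" "sum x U = r U"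
    "\<And>A. A \<subseteq> E \<Longrightarrow> i \<notin> A \<Longrightarrow> sum x A = r A \<Longrightarrow> A \<subseteq> U"
proof -
  define \<T> where "\<T> = {A. A \<subseteq> E \<and> i \<notin> A \<and> sum x A = r A}"
  have "finite \<T>" using fin by (auto simp: \<T>_def)
  have "{} \<in> \<T>" using r by (auto simp: \<T>_def submodular_on_def)
  obtain T where T: "T \<in> \<T>" "\<And>A. A \<in> \<T> \<Longrightarrow> card A \<le> card T"
    using finite_has_maximizer[of \<T> card] \<open>finite \<T>\<close> \<open>{} \<in> \<T>\<close> by blast
  have "A \<subseteq> T" if "A \<in> \<T>" for A
  proof -
    have "T \<union> A \<in> \<T>"
      using T(1) that tight_Un_Int(1)[OF fin r x, of T A] by (auto simp: \<T>_def)
    moreover have "finite (T \<union> A)" using T(1) that fin by (auto simp: \<T>_def intro: finite_subset)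
    ultimately have "T = T \<union> A"
      using T(2) by (intro card_seteq) auto
    then show ?thesis by auto
  qed
  then show ?thesis using that T(1) by (auto simp: \<T>_def)
qed

text \<open>Let T be the least set around i tight for y, and U the greatest set avoiding i tight for
  x. Every j in T - U can be the partner in both bases. If none had \<open>x j < y j\<close>, then
  x(T - U) > y(T - U) since i is in T - U, against x(T - U) <= q(T \<union> U) - q(U) <= q(T) - q(T
  \<inter> U) <= p(T) - p(T \<inter> U) <= y(T - U); compliance is the third inequality.\<close>

lemma compliant_imp_exch_base_points:
  assumes fin: "finite E" and p: "submodular_on E p" and q: "submodular_on E q"
    and compl: "compliant E q p"
  shows "exch (base_points E q) (base_points E p)"
proof (rule exchI)
  fix x y i assume x: "x \<in> base_points E q" and y: "y \<in> base_points E p" and i: "y i < x i"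
  have xyE: "x \<in> vecs E" "y \<in> vecs E" using x y by (auto simp: base_points_def)
  have iE: "i \<in> E" using vecs_neq_in[OF xyE] i by force
  obtain T where T: "i \<in> T" "T \<subseteq> E" "sum y T = p T"
    "\<And>A. A \<subseteq> E \<Longrightarrow> i \<in> A \<Longrightarrow> sum y A = p A \<Longrightarrow> T \<subseteq> A"
    using least_tight_set[OF fin p y iE] by blast
  obtain U where U: "i \<notin> U" "U \<subseteq> E" "sum x U = q U"
    "\<And>A. A \<subseteq> E \<Longrightarrow> i \<notin> A \<Longrightarrow> sum x A = q A \<Longrightarrow> A \<subseteq> U"
    using greatest_tight_set[OF fin q x] by blast
  have finT: "finite T" "finite U" using T U fin by (auto intro: finite_subset)
  have "\<exists>j\<in>T - U. x j < y j"
  proof (rule ccontr)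
    assume "\<not> ?thesis"
    then have "sum y (T - U) < sum x (T - U)"
      using i T(1) U(1) finT by (intro sum_strict_mono_ex1) force+
    moreover have "sum x (T - U) \<le> q (T \<union> U) - q U"
    proof -
      have "sum x (T \<union> U) = sum x (T - U) + sum x U"
        using sum.subset_diff[of U "T \<union> U" x] finT by (simp add: Un_Diff)
      then show ?thesis using base_points_leD[OF x, of "T \<union> U"] T U by simp
    qed
    moreover have "q (T \<union> U) - q U \<le> q T - q (T \<inter> U)"
      using submodular_onD[OF q T(2) U(2)] by simp
    moreover have "q T - q (T \<inter> U) \<le> p T - p (T \<inter> U)"
      using compliantD[OF compl, of "T \<inter> U" T] T by auto
    moreover have "p T - p (T \<inter> U) \<le> sum y (T - U)"
    proof -
      have "sum y T = sum y (T - U) + sum y (T \<inter> U)"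
        using sum.Int_Diff[OF finT(1), of y U] by simp
      then show ?thesis using base_points_leD[OF y, of "T \<inter> U"] T by auto
    qed
    ultimately show False by linarith
  qed
  then obtain j where j: "j \<in> T" "j \<notin> U" "x j < y j" by auto
  have jE: "j \<in> E" using j T by auto
  have "lower x i j \<in> base_points E q"
    unfolding base_points_def
  proof (intro CollectI conjI allI impI)
    show "lower x i j \<in> vecs E"
      using xyE iE jE by (auto simp: vecs_def unit_vec_apply)
    show "sum (lower x i j) E = q E"
      using x iE jE fin by (simp add: sum_exchange base_points_def)
    fix A assume A: "A \<subseteq> E"
    have "sum x A < q A" if "j \<in> A" "i \<notin> A"
      using U(4)[OF A that(2)] that j(2) base_points_leD[OF x A] by force
    then show "sum (lower x i j) A \<le> q A"
      using base_points_leD[OF x A] finite_subset[OF A fin] by (auto simp: sum_exchange)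
  qed
  moreover have "raise y i j \<in> base_points E p"
    unfolding base_points_def
  proof (intro CollectI conjI allI impI)
    show "raise y i j \<in> vecs E"
      using xyE iE jE by (auto simp: vecs_def unit_vec_apply)
    show "sum (raise y i j) E = p E"
      using y iE jE fin by (simp add: sum_exchange base_points_def)
    fix A assume A: "A \<subseteq> E"
    have "sum y A < p A" if "i \<in> A" "j \<notin> A"
      using T(4)[OF A that(1)] that j(1) base_points_leD[OF y A] by force
    then show "sum (raise y i j) A \<le> p A"
      using base_points_leD[OF y A] finite_subset[OF A fin] by (auto simp: sum_exchange)
  qed
  ultimately show "\<exists>j. x j < y j \<and> lower x i j \<in> base_points E q \<and>
      y + unit_vec i - unit_vec j \<in> base_points E p"
    using j by blast
qed

lemma finite_bounded_vecs:
  fixes m :: "'a \<Rightarrow> int"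
  assumes "finite E"
  shows "finite {x \<in> vecs E. \<forall>i\<in>E. \<bar>x i\<bar> \<le> m i}"
proof (rule finite_subset)
  define M where "M = (\<Sum>i\<in>E. \<bar>m i\<bar>)"
  have "\<bar>m i\<bar> \<le> M" if "i \<in> E" for i
    unfolding M_def using that assms by (intro member_le_sum) auto
  then show "{x \<in> vecs E. \<forall>i\<in>E. \<bar>x i\<bar> \<le> m i} \<subseteq>
      {f. \<forall>i. (i \<in> E \<longrightarrow> f i \<in> {-M..M}) \<and> (i \<notin> E \<longrightarrow> f i = 0)}"
    by (fastforce simp: vecs_def)
  show "finite {f. \<forall>i. (i \<in> E \<longrightarrow> f i \<in> {-M..M}) \<and> (i \<notin> E \<longrightarrow> f i = 0)}"
    using assms by (intro finite_set_of_finite_funs) auto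
qed

text \<open>The bounds on the singleton of i and on its complement, together with the fixed total,
  confine every coordinate.\<close>

lemma finite_base_points:
  assumes fin: "finite E"
  shows "finite (base_points E r)"
proof (rule finite_subset[OF _ finite_bounded_vecs[OF fin]], intro subsetI CollectI conjI ballI)
  fix x i assume x: "x \<in> base_points E r" and i: "i \<in> E"
  have "x i \<le> r {i}" "sum x (E - {i}) \<le> r (E - {i})"
    using i base_points_leD[OF x, of "{i}"] base_points_leD[OF x, of "E - {i}"] by auto
  moreover have "sum x E = x i + sum x (E - {i})"
    using i fin by (simp add: sum.remove)
  moreover have "sum x E = r E" using x by (simp add: base_points_def)
  ultimately show "\<bar>x i\<bar> \<le> \<bar>r {i}\<bar> + \<bar>r E - r (E - {i})\<bar>" by auto
qed (simp add: base_points_def)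

lemma m_convex_base_points:
  assumes fin: "finite E" and r: "submodular_on E r" and "base_points E r \<noteq> {}"
  shows "m_convex E (base_points E r)"
  unfolding m_convex_iff
  using assms finite_base_points[OF fin] compliant_imp_exch_base_points[OF fin r r]
  by (auto simp: base_points_def compliant_def)

lemma compliant_imp_exch:
  assumes fin: "finite E" and P: "m_convex E P" and Q: "m_convex E Q"
    and compl: "compliant E (submod Q) (submod P)"
  shows "exch Q P"
  using compliant_imp_exch_base_points[OF fin submodular_on_submod[OF fin P] submodular_on_submod[OF fin Q] compl]
  by (simp flip: m_convex_eq_base_points[OF fin P] m_convex_eq_base_points[OF fin Q])

text \<open>Choose x in Q and y in P, each maximal on X and on Y. If x exceeds y on Y - X, exchange
  there: the partner avoids X, or else x(X) would grow, and lies in Y, or else y(Y) would grow. So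
  the new x is again maximal on both sets, has the same sum on Y - X and is closer to y.\<close>

lemma exch_imp_compliant:
  assumes fin: "finite E" and P: "m_convex E P" and Q: "m_convex E Q" and ex: "exch Q P"
  shows "compliant E (submod Q) (submod P)"
  unfolding compliant_def
proof (intro allI impI)
  fix X Y assume XY: "X \<subseteq> Y" "Y \<subseteq> E"
  have P': "finite P" "P \<subseteq> vecs E" and Q': "finite Q" "Q \<subseteq> vecs E"
    using P Q by (auto simp: m_convex_iff)
  have finX: "finite X" "finite Y" using XY fin by (auto intro: finite_subset)
  obtain y where y: "y \<in> P" "sum y X = submod P X" "sum y Y = submod P Y"
    using m_convex_chain[OF fin P XY] by blast
  obtain x where x: "x \<in> Q" "sum x X = submod Q X" "sum x Y = submod Q Y"
    using m_convex_chain[OF fin Q XY] by blast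
  have diff: "sum u Y = sum u (Y - X) + sum u X" for u :: "'a \<Rightarrow> int"
    by (rule sum.subset_diff[OF XY(1) finX(2)])
  have "sum x (Y - X) \<le> sum y (Y - X)"
    using x
  proof (induction "l1_dist E x y" arbitrary: x rule: less_induct)
    case less
    show ?case
    proof (rule ccontr)
      assume neg: "\<not> ?thesis"
      then have "sum y (Y - X) < sum x (Y - X)" by simp
      then obtain i where i: "i \<in> Y - X" "y i < x i"
        by (rule sum_less_imp_ex)
      then have iE: "i \<in> E" using XY by auto
      obtain j where j: "x j < y j" "lower x i j \<in> Q" "raise y i j \<in> P"
        using exchE[OF ex less.prems(1) y(1) i(2)] by blast
      have "j \<notin> X"
        using submod_ge[OF Q'(1) j(2), of X] less.prems(2) i finX by (auto simp: sum_exchange)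
      have "j \<in> Y"
        using submod_ge[OF P'(1) j(3), of Y] y(3) i finX by (auto simp: sum_exchange)
      have "l1_dist E (lower x i j) y < l1_dist E x y"
        by (rule l1_dist_exchange_less[where x = x, OF fin iE i(2) j(1)])
      then have "sum (lower x i j) (Y - X) \<le> sum y (Y - X)"
        by (rule less.hyps)
          (use j i \<open>j \<notin> X\<close> \<open>j \<in> Y\<close> finX less.prems in \<open>auto simp: sum_exchange\<close>)
      then show False
        using neg i \<open>j \<notin> X\<close> \<open>j \<in> Y\<close> finX by (simp add: sum_exchange)
    qed
  qed
  then show "submod Q Y - submod Q X \<le> submod P Y - submod P X"
    using diff[of x] diff[of y] x y by simp
qed

lemma m_convex_exch_iff_compliant:
  assumes "finite E" "m_convex E P" "m_convex E Q"
  shows "exch Q P \<longleftrightarrow> compliant E (submod Q) (submod P)"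
  using assms compliant_imp_exch exch_imp_compliant by blast

section \<open>Submodular polyhedra and vertices\<close>

text \<open>Larger bounds make a larger polyhedron. Conversely, a point of Q maximal on X and Y,
  restricted to E - X, lies in the contracted polyhedron of q; its bound at Y - X in that of p is
  compliance for X and Y.\<close>

lemma compliant_iff_submod_polyhedron:
  assumes fin: "finite E" and P: "m_convex E P" and Q: "m_convex E Q"
  shows "compliant E (submod Q) (submod P) \<longleftrightarrow>
    (\<forall>X\<subseteq>E. submod_polyhedron (E - X) (contract (submod Q) X)
           \<subseteq> submod_polyhedron (E - X) (contract (submod P) X))" (is "?L \<longleftrightarrow> ?R")
proof
  assume L: ?L
  show ?R
  proof (intro allI impI subsetI)
    fix X x assume X: "X \<subseteq> E" and x: "x \<in> submod_polyhedron (E - X) (contract (submod Q) X)"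
    have "sum x A \<le> real_of_int (contract (submod P) X A)" if A: "A \<subseteq> E - X" for A
    proof -
      have "sum x A \<le> real_of_int (contract (submod Q) X A)"
        using x A by (simp add: submod_polyhedron_def)
      moreover have "contract (submod Q) X A \<le> contract (submod P) X A"
        using compliantD[OF L, of X "A \<union> X"] A X by (auto simp: contract_def)
      ultimately show ?thesis by linarith
    qed
    then show "x \<in> submod_polyhedron (E - X) (contract (submod P) X)"
      using x by (simp add: submod_polyhedron_def)
  qed
next
  assume R: ?R
  show ?L
    unfolding compliant_def
  proof (intro allI impI)
    fix X Y assume XY: "X \<subseteq> Y" "Y \<subseteq> E"
    obtain y where y: "y \<in> Q" "sum y X = submod Q X" "sum y Y = submod Q Y"
      using m_convex_chain[OF fin Q XY] by blast
    have finQ: "finite Q" using Q by (auto simp: m_convex_iff)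
    define z where "z = (\<lambda>i. if i \<in> E - X then real_of_int (y i) else 0)"
    have sum_z: "sum z A = real_of_int (sum y A)" if "A \<subseteq> E - X" for A
      unfolding of_int_sum using that by (intro sum.cong) (auto simp: z_def)
    have "z \<in> submod_polyhedron (E - X) (contract (submod Q) X)"
      unfolding submod_polyhedron_def
    proof (intro CollectI conjI allI impI)
      show "z \<in> vecs (E - X)" by (simp add: vecs_def z_def)
      fix A assume A: "A \<subseteq> E - X"
      have "sum y (A \<union> X) = sum y A + sum y X"
        using A XY fin by (intro sum.union_disjoint) (auto intro: finite_subset)
      then have "sum y A \<le> contract (submod Q) X A"
        using submod_ge[OF finQ y(1), of "A \<union> X"] y(2) by (simp add: contract_def)
      then show "sum z A \<le> real_of_int (contract (submod Q) X A)"
        by (simp only: sum_z[OF A] of_int_le_iff)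
    qed
    then have "z \<in> submod_polyhedron (E - X) (contract (submod P) X)"
      using R XY by blast
    then have "sum z (Y - X) \<le> real_of_int (contract (submod P) X (Y - X))"
      using XY unfolding submod_polyhedron_def by blast
    moreover have sub: "Y - X \<subseteq> E - X" and "Y - X \<union> X = Y" using XY by auto
    ultimately have "sum y (Y - X) \<le> submod P Y - submod P X"
      by (simp only: sum_z[OF sub] of_int_le_iff contract_def)
    moreover have "sum y Y = sum y (Y - X) + sum y X"
      using XY fin by (intro sum.subset_diff) (auto intro: finite_subset)
    ultimately show "submod Q Y - submod Q X \<le> submod P Y - submod P X"
      using y by simp
  qed
qed

text \<open>Increments telescope along a chain from X to Y; the one-element increments are what
  vertices record as coordinates.\<close>

lemma compliant_iff_insert:
  assumes fin: "finite E"
  shows "compliant E q p \<longleftrightarrow>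
    (\<forall>A i. A \<subseteq> E \<longrightarrow> i \<in> E - A \<longrightarrow> q (insert i A) - q A \<le> p (insert i A) - p A)" (is "_ \<longleftrightarrow> ?R")
proof
  assume "compliant E q p"
  then show ?R by (auto intro: compliantD)
next
  assume R: ?R
  have "q (X \<union> Z) - q X \<le> p (X \<union> Z) - p X" if "finite Z" "X \<subseteq> E" "Z \<subseteq> E - X" for X Z
    using that
  proof (induction Z rule: finite_induct)
    case (insert i Z)
    have "q (insert i (X \<union> Z)) - q (X \<union> Z) \<le> p (insert i (X \<union> Z)) - p (X \<union> Z)"
      using R[rule_format, of "X \<union> Z" i] insert.prems insert.hyps by auto
    then show ?case using insert by simp
  qed simp
  note * = this
  show "compliant E q p"
    unfolding compliant_def
  proof (intro allI impI)
    fix X Y assume XY: "X \<subseteq> Y" "Y \<subseteq> E"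
    have "finite (Y - X)" "X \<union> (Y - X) = Y" using XY fin by (auto intro: finite_subset)
    then show "q Y - q X \<le> p Y - p X"
      using *[of "Y - X" X] XY by auto
  qed
qed

section \<open>Vertices and prefix sums\<close>

lemma sum_image_atLeastAtMost_Suc:
  fixes x :: "'a \<Rightarrow> int"
  assumes "bij_betw \<sigma> {1..n} E" "Suc k \<le> n"
  shows "sum x (\<sigma> ` {1..Suc k}) = x (\<sigma> (Suc k)) + sum x (\<sigma> ` {1..k})"
proof -
  have "\<sigma> (Suc k) \<notin> \<sigma> ` {1..k}"
  proof
    assume "\<sigma> (Suc k) \<in> \<sigma> ` {1..k}"
    then obtain l where "l \<in> {1..k}" "\<sigma> (Suc k) = \<sigma> l" by auto
    then show False
      using inj_onD[OF bij_betw_imp_inj_on[OF assms(1)], of "Suc k" l] assms(2) by auto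
  qed
  moreover have "\<sigma> ` {1..Suc k} = insert (\<sigma> (Suc k)) (\<sigma> ` {1..k})"
    by (simp add: atLeastAtMostSuc_conv)
  ultimately show ?thesis by simp
qed

text \<open>\<open>vertex\<close> asks for one point that is the strict maximiser of every
  functional decreasing along \<sigma>. Any maximiser of such a functional attains the maximal sum
  on each prefix of \<sigma>, and the prefix sums determine a point; so the maximisers of all these
  functionals coincide and are unique.\<close>

lemma vertex_tight:
  assumes fin: "finite E" and P: "m_convex E P" and \<sigma>: "bij_betw \<sigma> {1..card E} E"
  shows "vertex E P \<sigma> \<in> P"
    and "k \<le> card E \<Longrightarrow> sum (vertex E P \<sigma>) (\<sigma> ` {1..k}) = submod P (\<sigma> ` {1..k})"
proof -
  let ?n = "card E"
  note P' = m_convexD[OF P]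
  have inj: "inj_on \<sigma> {1..?n}" and img: "\<sigma> ` {1..?n} = E"
    using \<sigma> by (auto simp: bij_betw_def)
  define decr where "decr c \<longleftrightarrow> (\<forall>i\<in>{1..?n}. \<forall>j\<in>{1..?n}. i < j \<longrightarrow> c (\<sigma> i) > c (\<sigma> j))"
    for c :: "'a \<Rightarrow> real"
  define tight where "tight x \<longleftrightarrow> (\<forall>k\<le>?n. sum x (\<sigma> ` {1..k}) = submod P (\<sigma> ` {1..k}))" for x
  have max_tight: "tight x" if c: "decr c" and x: "x \<in> P" "\<And>z. z \<in> P \<Longrightarrow> weight E c z \<le> weight E c x" for c x
    unfolding tight_def
  proof (intro allI impI)
    fix k assume k: "k \<le> ?n"
    have "sum y (\<sigma> ` {1..k}) \<le> sum x (\<sigma> ` {1..k})" if "y \<in> P" for y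
    proof (rule exch_weight_max_imp_sum_max[OF fin P'(3,4) x _ _ that])
      show "\<sigma> ` {1..k} \<subseteq> E" using k img by auto
      fix i j assume j: "j \<in> \<sigma> ` {1..k}" and i: "i \<in> E - \<sigma> ` {1..k}"
      obtain l where l: "l \<in> {1..k}" "j = \<sigma> l" using j by auto
      have "i \<in> \<sigma> ` {1..?n}" using i img by simp
      then obtain m where m: "m \<in> {1..?n}" "i = \<sigma> m" by blast
      have "m \<notin> {1..k}" using i m by auto
      then have "l < m" using l m by auto
      then show "c i < c j"
        using c l m k unfolding decr_def by auto
    qed
    then show "sum x (\<sigma> ` {1..k}) = submod P (\<sigma> ` {1..k})"
      using submod_eqI[OF P'(2) x(1), of "\<sigma> ` {1..k}"] by simp
  qed
  have unique: "x = y" if "x \<in> P" "y \<in> P" "tight x" "tight y" for x y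
  proof
    fix i
    show "x i = y i"
    proof (cases "i \<in> E")
      case True
      then obtain m where m: "m \<in> {1..?n}" "i = \<sigma> m" using img by blast
      then obtain k where k: "m = Suc k" "Suc k \<le> ?n" by (cases m) auto
      have "sum x (\<sigma> ` {1..Suc k}) = sum y (\<sigma> ` {1..Suc k})"
        using that(3,4) k(2) unfolding tight_def by simp
      moreover have "sum x (\<sigma> ` {1..k}) = sum y (\<sigma> ` {1..k})"
        using that(3,4) k(2) unfolding tight_def by simp
      ultimately show ?thesis
        using sum_image_atLeastAtMost_Suc[OF \<sigma> k(2), of x] sum_image_atLeastAtMost_Suc[OF \<sigma> k(2), of y]
        unfolding m(2) k(1) by linarith
    next
      case False
      have "x \<in> vecs E" "y \<in> vecs E" using that P'(3) by auto
      then show ?thesis using False by (simp add: vecs_def)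
    qed
  qed
  \<comment> \<open>A concrete functional that decreases along \<sigma>: it provides a point tight
    on all prefixes and shows that the description in \<open>vertex\<close> determines it.\<close>
  define c0 where "c0 i = - real (inv_into {1..?n} \<sigma> i)" for i
  have c0: "decr c0"
    unfolding decr_def c0_def using inj by (auto simp: inv_into_f_f)
  obtain x0 where x0: "x0 \<in> P" "\<And>z. z \<in> P \<Longrightarrow> weight E c0 z \<le> weight E c0 x0"
    using finite_has_maximizer[OF P'(2,1), of "weight E c0"] by blast
  have t0: "tight x0" by (rule max_tight[OF c0 x0])
  have strict: "weight E c z < weight E c x0" if c: "decr c" and z: "z \<in> P" "z \<noteq> x0" for c z
  proof -
    obtain x1 where x1: "x1 \<in> P" "\<And>z. z \<in> P \<Longrightarrow> weight E c z \<le> weight E c x1"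
      using finite_has_maximizer[OF P'(2,1), of "weight E c"] by blast
    have "x1 = x0" by (rule unique[OF x1(1) x0(1) max_tight[OF c x1] t0])
    have "weight E c z \<noteq> weight E c x0"
    proof
      assume eq: "weight E c z = weight E c x0"
      have "tight z"
        by (rule max_tight[OF c z(1)]) (use x1(2) eq \<open>x1 = x0\<close> in simp)
      then have "z = x0" by (rule unique[OF z(1) x0(1) _ t0])
      then show False using z(2) by simp
    qed
    then show ?thesis using x1(2)[OF z(1)] \<open>x1 = x0\<close> by simp
  qed
  have "vertex E P \<sigma> = (THE x. x \<in> P \<and> (\<forall>c. decr c \<longrightarrow> (\<forall>z\<in>P. z \<noteq> x \<longrightarrow> weight E c z < weight E c x)))"
    unfolding vertex_def decr_def weight_def ..
  also have "\<dots> = x0"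
  proof (rule the_equality)
    show "x0 \<in> P \<and> (\<forall>c. decr c \<longrightarrow> (\<forall>z\<in>P. z \<noteq> x0 \<longrightarrow> weight E c z < weight E c x0))"
      using x0(1) strict by blast
    fix x assume "x \<in> P \<and> (\<forall>c. decr c \<longrightarrow> (\<forall>z\<in>P. z \<noteq> x \<longrightarrow> weight E c z < weight E c x))"
    then show "x = x0"
      using x0(1) x0(2)[of x] c0 by fastforce
  qed
  finally have "vertex E P \<sigma> = x0" .
  then show "vertex E P \<sigma> \<in> P" and "k \<le> card E \<Longrightarrow> sum (vertex E P \<sigma>) (\<sigma> ` {1..k}) = submod P (\<sigma> ` {1..k})"
    using x0(1) t0 unfolding tight_def by simp_all
qed

lemma vertex_Suc:
  assumes fin: "finite E" and P: "m_convex E P" and \<sigma>: "bij_betw \<sigma> {1..card E} E" and k: "Suc k \<le> card E"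
  shows "vertex E P \<sigma> (\<sigma> (Suc k)) = submod P (\<sigma> ` {1..Suc k}) - submod P (\<sigma> ` {1..k})"
  using sum_image_atLeastAtMost_Suc[OF \<sigma> k, of "vertex E P \<sigma>"]
    vertex_tight(2)[OF fin P \<sigma> k] vertex_tight(2)[OF fin P \<sigma>, of k] k by simp

text \<open>List A, then i, then the rest: in this order the vertex coordinate at i is the increment
  from A to A with i added.\<close>

lemma ex_bij_betw_prefix:
  assumes fin: "finite E" and A: "A \<subseteq> E" and i: "i \<in> E - A"
  obtains \<sigma> where "bij_betw \<sigma> {1..card E} E" "\<sigma> ` {1..card A} = A" "\<sigma> (Suc (card A)) = i"
proof -
  obtain xs where xs: "set xs = A" "distinct xs"
    using finite_distinct_list[of A] finite_subset[OF A fin] by blast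
  obtain ys where ys: "set ys = E - insert i A" "distinct ys"
    using finite_distinct_list[of "E - insert i A"] fin by blast
  define l where "l = xs @ i # ys"
  \<comment> \<open>Lists are indexed from 0 but \<sigma> from 1.\<close>
  define \<sigma> where "\<sigma> = (!) l \<circ> (\<lambda>k. k - 1)"
  have l: "distinct l" "set l = E"
    using xs ys A i by (auto simp: l_def)
  then have len: "length l = card E" using distinct_card by metis
  have lenx: "length xs = card A" using xs distinct_card by metis
  have pred: "bij_betw (\<lambda>k. k - 1 :: nat) {1..n} {..<n}" for n
    by (rule bij_betw_byWitness[where f' = Suc]) auto
  have "bij_betw \<sigma> {1..card E} E"
    unfolding \<sigma>_def using pred bij_betw_nth[OF l(1) _ l(2)[symmetric]] len
    by (intro bij_betw_trans[where B = "{..<card E}"]) auto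
  moreover have "\<sigma> ` {1..card A} = A"
  proof -
    have "bij_betw ((!) xs \<circ> (\<lambda>k. k - 1)) {1..card A} A"
      using pred bij_betw_nth[OF xs(2) _ xs(1)[symmetric]] lenx
      by (intro bij_betw_trans[where B = "{..<card A}"]) auto
    then have "((!) xs \<circ> (\<lambda>k. k - 1)) ` {1..card A} = A"
      by (rule bij_betw_imp_surj_on)
    moreover have "\<sigma> ` {1..card A} = ((!) xs \<circ> (\<lambda>k. k - 1)) ` {1..card A}"
      by (intro image_cong) (auto simp: \<sigma>_def l_def nth_append lenx)
    ultimately show ?thesis by simp
  qed
  moreover have "\<sigma> (Suc (card A)) = i"
    by (simp add: \<sigma>_def l_def flip: lenx)
  ultimately show ?thesis using that by blast
qed

lemma compliant_iff_vertex:
  assumes fin: "finite E" and P: "m_convex E P" and Q: "m_convex E Q"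
  shows "compliant E (submod Q) (submod P) \<longleftrightarrow>
    (\<forall>\<sigma>. bij_betw \<sigma> {1..card E} E \<longrightarrow> (\<forall>i\<in>E. vertex E P \<sigma> i \<ge> vertex E Q \<sigma> i))" (is "?L \<longleftrightarrow> ?R")
proof
  assume L: ?L
  show ?R
  proof (intro allI impI ballI)
    fix \<sigma> i assume \<sigma>: "bij_betw \<sigma> {1..card E} E" and "i \<in> E"
    then obtain m where m: "m \<in> {1..card E}" "i = \<sigma> m"
      using bij_betw_imp_surj_on[OF \<sigma>] by blast
    then obtain k where k: "m = Suc k" "Suc k \<le> card E" by (cases m) auto
    have "\<sigma> ` {1..k} \<subseteq> \<sigma> ` {1..Suc k}" by auto
    moreover have "\<sigma> ` {1..Suc k} \<subseteq> E" using bij_betw_imp_surj_on[OF \<sigma>] k(2) by auto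
    ultimately show "vertex E Q \<sigma> i \<le> vertex E P \<sigma> i"
      unfolding m(2) k(1) vertex_Suc[OF fin P \<sigma> k(2)] vertex_Suc[OF fin Q \<sigma> k(2)]
      by (rule compliantD[OF L])
  qed
next
  assume R: ?R
  show ?L
    unfolding compliant_iff_insert[OF fin]
  proof (intro allI impI)
    fix A i assume A: "A \<subseteq> E" and i: "i \<in> E - A"
    obtain \<sigma> where \<sigma>: "bij_betw \<sigma> {1..card E} E" "\<sigma> ` {1..card A} = A" "\<sigma> (Suc (card A)) = i"
      using ex_bij_betw_prefix[OF fin A i] by blast
    have "A \<subset> E" using A i by auto
    then have k: "Suc (card A) \<le> card E" using psubset_card_mono[OF fin, of A] by simp
    have "\<sigma> ` {1..Suc (card A)} = insert i A"
      using \<sigma> by (simp add: atLeastAtMostSuc_conv)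
    moreover have "vertex E Q \<sigma> i \<le> vertex E P \<sigma> i" using R \<sigma>(1) i by blast
    ultimately show "submod Q (insert i A) - submod Q A \<le> submod P (insert i A) - submod P A"
      using vertex_Suc[OF fin P \<sigma>(1) k] vertex_Suc[OF fin Q \<sigma>(1) k] unfolding \<sigma>(2,3) by simp
  qed
qed

section \<open>Layers\<close>

lemma in_supp_vecs:
  fixes x y :: "'a \<Rightarrow> int"
  assumes "x \<in> vecs E" "y \<in> vecs E" "y i < x i"
  shows "i \<in> E"
  by (rule vecs_neq_in[OF assms(1,2)]) (use assms(3) in simp)

lemma sum_unit_step:
  fixes x :: "'a \<Rightarrow> int"
  assumes "finite A"
  shows "sum (x - unit_vec i) A = sum x A - of_bool (i \<in> A)"
    and "sum (x + unit_vec i) A = sum x A + of_bool (i \<in> A)"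
  using assms by (simp_all only: sum_fun_add sum_fun_diff sum_unit_vec)

lemma compliant_trans:
  assumes "compliant E r q" "compliant E q p"
  shows "compliant E r p"
  unfolding compliant_def
proof (intro allI impI)
  fix X Y assume "X \<subseteq> Y" "Y \<subseteq> E"
  then show "r Y - r X \<le> p Y - p X"
    using compliantD[OF assms(1), of X Y] compliantD[OF assms(2), of X Y] by linarith
qed

section \<open>Layers of M-natural-convex sets\<close>

definition layer :: "'a set \<Rightarrow> ('a \<Rightarrow> int) set \<Rightarrow> int \<Rightarrow> ('a \<Rightarrow> int) set"
  where "layer E R k = {x \<in> R. sum x E = k}"

lemma mnat_convexE:
  assumes "mnat_convex E R" "x \<in> R" "y \<in> R" "sum y E < sum x E"
  obtains i where "y i < x i" "x - unit_vec i \<in> R" "y + unit_vec i \<in> R"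
proof -
  have "\<exists>i\<in>supp_pos (x - y). x - unit_vec i \<in> R \<and> y + unit_vec i \<in> R"
    using assms unfolding mnat_convex_def by blast
  then show ?thesis using that by auto
qed

lemma mnat_layer_step:
  assumes fin: "finite E" and R: "mnat_convex E R" and x: "x \<in> layer E R m" and y: "y \<in> layer E R k"
    and "k < m"
  obtains i where "i \<in> E" "y i < x i" "x - unit_vec i \<in> layer E R (m - 1)" "y + unit_vec i \<in> layer E R (k + 1)"
proof -
  have xy: "x \<in> R" "y \<in> R" "sum x E = m" "sum y E = k"
    using x y by (auto simp: layer_def)
  obtain i where i: "y i < x i" "x - unit_vec i \<in> R" "y + unit_vec i \<in> R"
    using mnat_convexE[OF R xy(1,2)] xy(3,4) \<open>k < m\<close> by blast
  have "x \<in> vecs E" "y \<in> vecs E" using xy R unfolding mnat_convex_def by auto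
  then have "i \<in> E" using i(1) by (rule in_supp_vecs)
  moreover have "sum (x - unit_vec i) E = m - 1" "sum (y + unit_vec i) E = k + 1"
    using \<open>i \<in> E\<close> xy(3,4) unfolding sum_unit_step[OF fin] by simp_all
  ultimately show ?thesis
    using that i xy unfolding layer_def by blast
qed

lemma finite_layer: "mnat_convex E R \<Longrightarrow> finite (layer E R k)"
  by (simp add: layer_def mnat_convex_def)

lemma m_convex_layer:
  assumes fin: "finite E" and R: "mnat_convex E R" and "layer E R k \<noteq> {}"
  shows "m_convex E (layer E R k)"
  unfolding m_convex_iff
proof (intro conjI assms(3) finite_layer[OF R])
  have RE: "R \<subseteq> vecs E" using R by (simp add: mnat_convex_def)
  then show "layer E R k \<subseteq> vecs E" by (auto simp: layer_def)
  show "exch (layer E R k) (layer E R k)"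
  proof (rule exchI)
    fix x y i assume x: "x \<in> layer E R k" and y: "y \<in> layer E R k" and i: "y i < x i"
    have xy: "x \<in> R" "y \<in> R" "sum x E = k" "sum y E = k"
      using x y by (auto simp: layer_def)
    have "i \<in> supp_pos (x - y)" using i by simp
    moreover have "\<forall>i\<in>supp_pos (x - y). \<exists>j\<in>supp_neg (x - y).
             x - unit_vec i + unit_vec j \<in> R \<and> raise y i j \<in> R"
      using R xy unfolding mnat_convex_def by metis
    ultimately obtain j where j': "j \<in> supp_neg (x - y)"
      and j: "lower x i j \<in> R" "raise y i j \<in> R"
      by blast
    have j: "x j < y j" "lower x i j \<in> R" "raise y i j \<in> R"
      using j' j by simp_all
    have vE: "x \<in> vecs E" "y \<in> vecs E" using xy RE by auto
    have "i \<in> E" "j \<in> E"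
      using in_supp_vecs[OF vE i] in_supp_vecs[OF vE(2,1) j(1)] by auto
    then have "sum (lower x i j) E = k" "sum (raise y i j) E = k"
      using xy(3,4) unfolding sum_exchange(1,2)[OF fin] by simp_all
    then show "\<exists>j. x j < y j \<and> lower x i j \<in> layer E R k \<and>
        y + unit_vec i - unit_vec j \<in> layer E R k"
      using j unfolding layer_def by blast
  qed
qed

lemma layer_Suc_nonempty:
  assumes "finite E" "mnat_convex E R" "layer E R k \<noteq> {}" "layer E R m \<noteq> {}" "k < m"
  shows "layer E R (k + 1) \<noteq> {}"
  using assms mnat_layer_step[OF assms(1,2)] by blast

text \<open>A step between maximisers of adjacent layers moves one unit vector across, which changes
  the sum on A by 0 or 1.\<close>

lemma submod_layer_Suc:
  assumes fin: "finite E" and R: "mnat_convex E R"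
    and k: "layer E R k \<noteq> {}" "layer E R (k + 1) \<noteq> {}" and A: "A \<subseteq> E"
  shows "submod (layer E R k) A \<le> submod (layer E R (k + 1)) A"
    and "submod (layer E R (k + 1)) A \<le> submod (layer E R k) A + 1"
proof -
  have finA: "finite A" using A fin by (rule finite_subset)
  obtain y where y: "y \<in> layer E R k" "sum y A = submod (layer E R k) A"
    using submod_attained[OF finite_layer[OF R] k(1)] by blast
  obtain x where x: "x \<in> layer E R (k + 1)" "sum x A = submod (layer E R (k + 1)) A"
    using submod_attained[OF finite_layer[OF R] k(2)] by blast
  obtain i where i: "x - unit_vec i \<in> layer E R k" "y + unit_vec i \<in> layer E R (k + 1)"
    using mnat_layer_step[OF fin R x(1) y(1)] by auto
  show "submod (layer E R k) A \<le> submod (layer E R (k + 1)) A"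
    using submod_ge[OF finite_layer[OF R] i(2), of A] y(2) unfolding sum_unit_step[OF finA]
    by (simp split: if_splits add: of_bool_def)
  show "submod (layer E R (k + 1)) A \<le> submod (layer E R k) A + 1"
    using submod_ge[OF finite_layer[OF R] i(1), of A] x(2) unfolding sum_unit_step[OF finA]
    by (simp split: if_splits add: of_bool_def)
qed

text \<open>Step down from x against a y maximal on A in layer k. The coordinate raised in y must
  avoid A, as layer k + 1 offers no larger sum on A. So x(A) survives the descent, and n such steps
  reach layer k + 1.\<close>

lemma submod_layer_plateau:
  assumes fin: "finite E" and R: "mnat_convex E R"
    and k: "layer E R k \<noteq> {}" and A: "A \<subseteq> E"
    and eq: "submod (layer E R (k + 1)) A = submod (layer E R k) A"
    and x: "x \<in> layer E R (k + 1 + int n)"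
  shows "sum x A \<le> submod (layer E R k) A"
  using x
proof (induction n arbitrary: x)
  case 0
  then show ?case using submod_ge[OF finite_layer[OF R], of x "k + 1" A] eq by simp
next
  case (Suc n)
  have finA: "finite A" using A fin by (rule finite_subset)
  obtain y where y: "y \<in> layer E R k" "sum y A = submod (layer E R k) A"
    using submod_attained[OF finite_layer[OF R] k(1)] by blast
  obtain i where i: "x - unit_vec i \<in> layer E R (k + 1 + int (Suc n) - 1)" "y + unit_vec i \<in> layer E R (k + 1)"
    using mnat_layer_step[OF fin R Suc.prems y(1)] by auto
  have "i \<notin> A"
    using submod_ge[OF finite_layer[OF R] i(2), of A] y(2) eq unfolding sum_unit_step[OF finA]
    by (auto simp: of_bool_def)
  then have "sum (x - unit_vec i) A = sum x A"
    unfolding sum_unit_step[OF finA] by simp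
  moreover have "k + 1 + int (Suc n) - 1 = k + 1 + int n" by simp
  then have "sum (x - unit_vec i) A \<le> submod (layer E R k) A"
    by (intro Suc.IH) (use i(1) in \<open>simp only:\<close>)
  ultimately show ?case by simp
qed

text \<open>Maxima grow by 0 or 1, so a violation means that the maximum on Y stays and that on X
  grows. Let y be maximal on Y in layer k and x maximal on X in layer k + 1. The step between them
  uses a coordinate outside Y, hence outside X, so lowering x keeps x(X), which is too large for
  layer k.\<close>

lemma compliant_layer_Suc:
  assumes fin: "finite E" and R: "mnat_convex E R"
    and k: "layer E R k \<noteq> {}" "layer E R (k + 1) \<noteq> {}"
  shows "compliant E (submod (layer E R k)) (submod (layer E R (k + 1)))"
  unfolding compliant_def
proof (intro allI impI)
  fix X Y assume XY: "X \<subseteq> Y" "Y \<subseteq> E"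
  let ?r = "submod (layer E R k)" and ?s = "submod (layer E R (k + 1))"
  have finX: "finite X" "finite Y" using XY fin by (auto intro: finite_subset)
  show "?r Y - ?r X \<le> ?s Y - ?s X"
  proof (rule ccontr)
    assume "\<not> ?thesis"
    moreover have "?r Y \<le> ?s Y" "?s X \<le> ?r X + 1"
      using submod_layer_Suc[OF fin R k, of Y] submod_layer_Suc[OF fin R k, of X] XY by auto
    ultimately have eq: "?s Y = ?r Y" "?s X = ?r X + 1" by linarith+
    obtain y where y: "y \<in> layer E R k" "sum y X = ?r X" "sum y Y = ?r Y"
      using m_convex_chain[OF fin m_convex_layer[OF fin R k(1)] XY] by blast
    obtain x where x: "x \<in> layer E R (k + 1)" "sum x X = ?s X"
      using submod_attained[OF finite_layer[OF R] k(2)] by blast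
    obtain i where i: "x - unit_vec i \<in> layer E R k" "y + unit_vec i \<in> layer E R (k + 1)"
      using mnat_layer_step[OF fin R x(1) y(1)] by auto
    have "i \<notin> Y"
      using submod_ge[OF finite_layer[OF R] i(2), of Y] y(3) eq unfolding sum_unit_step[OF finX(2)]
      by (auto simp: of_bool_def)
    then have "i \<notin> X" using XY by blast
    then show False
      using submod_ge[OF finite_layer[OF R] i(1), of X] x(2) eq(2) unfolding sum_unit_step[OF finX(1)]
      by simp
  qed
qed

lemma real_vec_in_vecs_iff [simp]: "real_vec x \<in> vecs E \<longleftrightarrow> x \<in> vecs E"
  by (simp add: real_vec_def vecs_def)

lemma sum_real_vec: "sum (real_vec x) A = real_of_int (sum x A)"
  by (simp add: real_vec_def)

lemma int_points_g_polymatroid_iff: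
  "x \<in> int_points (g_polymatroid E p r) \<longleftrightarrow> x \<in> vecs E \<and> (\<forall>A\<subseteq>E. r A \<le> sum x A \<and> sum x A \<le> p A)"
  by (simp only: int_points_def g_polymatroid_def mem_Collect_eq sum_real_vec of_int_le_iff
      real_vec_in_vecs_iff)

text \<open>For \<open>r m\<close>, the function of the layer at height m above the bottom, the
  proof arrives at \<open>r m A\<close> = min(q(A) + m, p(A)). On the points of the
  \<open>g_polymatroid\<close> with sum k + m, the lower bound at E - A amounts to x(A) <= q(A) + m,
  so both sets have the same bounds at every height.\<close>

lemma mnat_convex_layers:
  assumes fin: "finite E" and R: "mnat_convex E R"
    and bot: "layer E R k \<noteq> {}" and top: "layer E R (k + int n) \<noteq> {}"
    and bounds: "\<And>x. x \<in> R \<Longrightarrow> k \<le> sum x E \<and> sum x E \<le> k + int n"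
  shows "compliant E (submod (layer E R k)) (submod (layer E R (k + int n)))"
    and "R = int_points (g_polymatroid E (submod (layer E R (k + int n))) (dual E (submod (layer E R k))))"
proof -
  define r where "r m = submod (layer E R (k + int m))" for m
  let ?p = "r n" and ?q = "r 0"
  have ne: "layer E R (k + int m) \<noteq> {}" if "m \<le> n" for m
    using that
  proof (induction m)
    case 0 then show ?case using bot by simp
  next
    case (Suc m)
    then have "layer E R (k + int m + 1) \<noteq> {}"
      by (intro layer_Suc_nonempty[OF fin R _ top]) auto
    then show ?case by (simp add: algebra_simps)
  qed
  have Suc_eq: "k + int (Suc m) = k + int m + 1" for m by simp
  have ne2: "layer E R (k + int m) \<noteq> {}" "layer E R (k + int m + 1) \<noteq> {}" if "m < n" for m
    using ne[of m] ne[of "Suc m"] that unfolding Suc_eq by auto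
  have step: "r m A \<le> r (Suc m) A" "r (Suc m) A \<le> r m A + 1" if "m < n" "A \<subseteq> E" for m A
    unfolding r_def Suc_eq using submod_layer_Suc[OF fin R ne2[OF that(1)] that(2)] by auto
  have mono: "r m A \<le> r n A" if "m \<le> n" "A \<subseteq> E" for m A
    using that(1)
  proof (induction m rule: inc_induct)
    case (step m) then show ?case using \<open>A \<subseteq> E\<close> \<open>\<And>m A. m < n \<Longrightarrow> A \<subseteq> E \<Longrightarrow> r m A \<le> r (Suc m) A\<close> order_trans by blast
  qed simp
  \<comment> \<open>Once a layer gains nothing on A no later layer does, so the growth can stop only
    at p(A).\<close>
  have growth: "r m A = r 0 A + int m \<or> r m A = r n A" if "m \<le> n" "A \<subseteq> E" for m A
    using that(1)
  proof (induction m)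
    case (Suc m)
    then have m: "m < n" by simp
    have 1: "r (Suc m) A \<le> r n A" using mono Suc.prems that(2) by blast
    note 2 = step[OF m that(2)]
    show ?case
    proof (cases "r (Suc m) A = r m A")
      case True
      have "r n A \<le> r m A"
      proof -
        obtain l where l: "n = Suc m + l" using less_imp_Suc_add[OF m] by auto
        obtain x where x: "x \<in> layer E R (k + int n)" "sum x A = r n A"
          using submod_attained[OF finite_layer[OF R] ne[OF order_refl]] unfolding r_def by blast
        have xl: "x \<in> layer E R (k + int m + 1 + int l)" using x(1) l by (simp add: algebra_simps)
        have "sum x A \<le> submod (layer E R (k + int m)) A"
          by (rule submod_layer_plateau[OF fin R ne2(1)[OF m] that(2) _ xl])
            (use True in \<open>simp only: r_def Suc_eq\<close>)
        then show ?thesis using x(2) by (simp add: r_def)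
      qed
      then show ?thesis using 1 True by simp
    next
      case False
      then have "r (Suc m) A = r m A + 1" using 2 by linarith
      then show ?thesis using Suc.IH m 1 by auto
    qed
  qed simp
  have le: "r m A \<le> r 0 A + int m" if "m \<le> n" "A \<subseteq> E" for m A
    using that(1)
  proof (induction m)
    case (Suc m)
    then show ?case using step(2)[of m A] that(2) by simp
  qed simp
  have compl: "compliant E (r 0) (r m)" if "m \<le> n" for m
    using that
  proof (induction m)
    case (Suc m)
    then have "compliant E (r m) (r (Suc m))"
      unfolding r_def Suc_eq by (intro compliant_layer_Suc[OF fin R] ne2) auto
    moreover have "compliant E (r 0) (r m)" by (rule Suc.IH) (use Suc.prems in simp)
    ultimately show ?case by (rule compliant_trans[rotated])
  qed (simp add: compliant_def)
  show "compliant E (submod (layer E R k)) (submod (layer E R (k + int n)))"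
    using compl[of n] by (simp add: r_def)
  have mc: "m_convex E (layer E R (k + int m))" if "m \<le> n" for m
    by (rule m_convex_layer[OF fin R ne[OF that]])
  have rE: "r m E = k + int m" if mn: "m \<le> n" for m
  proof -
    obtain x where "x \<in> layer E R (k + int m)" "sum x E = r m E"
      using submod_attained[OF finite_layer[OF R] ne[OF mn]] unfolding r_def by blast
    then show ?thesis by (simp add: layer_def)
  qed
  have R_eq: "R = {x \<in> vecs E. \<forall>A\<subseteq>E. dual E (r 0) A \<le> sum x A \<and> sum x A \<le> r n A}" (is "R = ?G")
  proof (intro equalityI subsetI)
    fix x assume x: "x \<in> R"
    define m where "m = nat (sum x E - k)"
    have m: "sum x E = k + int m" "m \<le> n" using bounds[OF x] by (auto simp: m_def)
    have xm: "x \<in> layer E R (k + int m)" using x m(1) by (simp add: layer_def)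
    have ub: "sum x A \<le> r m A" for A
      unfolding r_def by (rule submod_ge[OF finite_layer[OF R] xm])
    have "dual E (r 0) A \<le> sum x A" if A: "A \<subseteq> E" for A
    proof -
      have "sum x E = sum x (E - A) + sum x A" by (rule sum.subset_diff[OF A fin])
      moreover have "sum x (E - A) \<le> r 0 (E - A) + int m"
        using ub[of "E - A"] le[OF m(2), of "E - A"] by auto
      ultimately show ?thesis using m(1) rE[of 0] by (simp add: dual_def)
    qed
    moreover have "sum x A \<le> r n A" if "A \<subseteq> E" for A
      using ub[of A] mono[OF m(2) that] by simp
    moreover have "x \<in> vecs E" using R x unfolding mnat_convex_def by auto
    ultimately show "x \<in> ?G" by simp
  next
    fix x assume x: "x \<in> ?G"
    then have xE: "x \<in> vecs E" and lb: "\<And>A. A \<subseteq> E \<Longrightarrow> dual E (r 0) A \<le> sum x A"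
      and ub: "\<And>A. A \<subseteq> E \<Longrightarrow> sum x A \<le> r n A" by auto
    define m where "m = nat (sum x E - k)"
    have "r 0 {} = 0" unfolding r_def by (rule submod_empty[OF finite_layer[OF R] ne[OF le0]])
    then have m: "sum x E = k + int m" "m \<le> n"
      using lb[OF order_refl] ub[OF order_refl] rE[of 0] rE[of n] by (auto simp: m_def dual_def)
    have "sum x A \<le> r m A" if A: "A \<subseteq> E" for A
    proof -
      have "sum x E = sum x (E - A) + sum x A" by (rule sum.subset_diff[OF A fin])
      moreover have "dual E (r 0) (E - A) \<le> sum x (E - A)" by (rule lb) auto
      moreover have "E - (E - A) = A" using A by auto
      ultimately have "sum x A \<le> r 0 A + int m"
        using m(1) rE[of 0] by (simp add: dual_def)
      then show ?thesis using growth[OF m(2) A] ub[OF A] by auto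
    qed
    then have "x \<in> base_points E (r m)"
      using xE m rE[OF m(2)] by (simp add: base_points_def)
    then have "x \<in> layer E R (k + int m)"
      using m_convex_eq_base_points[OF fin mc[OF m(2)]] unfolding r_def by simp
    then show "x \<in> R" by (simp add: layer_def)
  qed
  show "R = int_points (g_polymatroid E (submod (layer E R (k + int n))) (dual E (submod (layer E R k))))"
  proof (rule set_eqI)
    fix x
    show "x \<in> R \<longleftrightarrow> x \<in> int_points (g_polymatroid E (submod (layer E R (k + int n))) (dual E (submod (layer E R k))))"
      unfolding int_points_g_polymatroid_iff using R_eq by (auto simp: r_def)
  qed
qed

lemma mnat_convex_top_bottom:
  assumes fin: "finite E" and R: "mnat_convex E R"
    and P: "m_convex E (top_layer E R)" and Q: "m_convex E (bottom_layer E R)"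
  shows "compliant E (submod (bottom_layer E R)) (submod (top_layer E R))"
    and "R = int_points (g_polymatroid E (submod (top_layer E R)) (dual E (submod (bottom_layer E R))))"
proof -
  obtain x y where x: "x \<in> top_layer E R" and y: "y \<in> bottom_layer E R"
    using P Q by (auto simp: m_convex_iff)
  define k where "k = sum y E"
  define n where "n = nat (sum x E - k)"
  have le: "k \<le> sum x E" using x y by (auto simp: top_layer_def bottom_layer_def k_def)
  then have n: "sum x E = k + int n" by (simp add: n_def)
  have bounds: "k \<le> sum z E \<and> sum z E \<le> k + int n" if "z \<in> R" for z
    using that x y n by (auto simp: top_layer_def bottom_layer_def k_def)
  have top: "top_layer E R = layer E R (k + int n)"
    using x bounds unfolding top_layer_def layer_def n[symmetric] by (auto intro: antisym)
  have bot: "bottom_layer E R = layer E R k"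
    using y bounds unfolding bottom_layer_def layer_def k_def by (auto intro: antisym)
  have ne: "layer E R k \<noteq> {}" "layer E R (k + int n) \<noteq> {}"
    using x y top bot by auto
  show "compliant E (submod (bottom_layer E R)) (submod (top_layer E R))"
    unfolding top bot by (rule mnat_convex_layers[OF fin R ne bounds])
  show "R = int_points (g_polymatroid E (submod (top_layer E R)) (dual E (submod (bottom_layer E R))))"
    unfolding top bot by (rule mnat_convex_layers[OF fin R ne bounds])
qed

section \<open>Top layers of projections\<close>

lemma case_sum_diff_Inl: "case_sum x y - unit_vec (Inl i) = case_sum (x - unit_vec i) y"
  and case_sum_add_Inl: "case_sum x y + unit_vec (Inl i) = case_sum (x + unit_vec i) y"
  and case_sum_diff_Inr: "case_sum x y - unit_vec (Inr k) = case_sum x (y - unit_vec k)"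
  and case_sum_add_Inr: "case_sum x y + unit_vec (Inr k) = case_sum x (y + unit_vec k)"
  for x :: "'a \<Rightarrow> int" and y :: "'b \<Rightarrow> int"
  by (auto simp: fun_eq_iff unit_vec_apply split: sum.splits)

lemma case_sum_in_vecs_iff: "case_sum x y \<in> vecs (E <+> X) \<longleftrightarrow> x \<in> vecs E \<and> y \<in> vecs X"
  by (force simp: vecs_def split: sum.splits)

text \<open>
  A step into the second factor would lift a point of the top layer above it, so the exchange
  takes place in the first factor and leaves the companion \<open>a\<close> of \<open>x\<close> fixed.
\<close>

lemma exch_top_layer:
  assumes fin: "finite E" and \<Gamma>: "m_convex_unbounded (E <+> X) \<Gamma>"
    and Q: "\<And>x. x \<in> Q \<Longrightarrow> \<exists>a. case_sum x a \<in> \<Gamma> \<and>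
        (\<forall>x'. case_sum x' a \<in> \<Gamma> \<longrightarrow> sum x' E = sum x E \<longrightarrow> x' \<in> Q)"
  shows "exch Q (top_layer E (proj_left \<Gamma>))"
proof (rule exchI)
  fix x y i assume x: "x \<in> Q" and y: "y \<in> top_layer E (proj_left \<Gamma>)" and i: "y i < x i"
  obtain a where a: "case_sum x a \<in> \<Gamma>"
    "\<And>x'. case_sum x' a \<in> \<Gamma> \<Longrightarrow> sum x' E = sum x E \<Longrightarrow> x' \<in> Q"
    using Q[OF x] by blast
  obtain b where b: "case_sum y b \<in> \<Gamma>"
    using y by (auto simp: top_layer_def proj_left_def)
  have y_max: "sum z E \<le> sum y E" if "case_sum z c \<in> \<Gamma>" for z c
    using y that unfolding top_layer_def proj_left_def by blast
  have \<Gamma>': "\<Gamma> \<subseteq> vecs (E <+> X)" "exch \<Gamma> \<Gamma>" using \<Gamma> by (auto simp: m_convex_unbounded_iff)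
  have xy: "x \<in> vecs E" "y \<in> vecs E"
    using subsetD[OF \<Gamma>'(1) a(1)] subsetD[OF \<Gamma>'(1) b] by (simp_all add: case_sum_in_vecs_iff)
  have iE: "i \<in> E" by (rule in_supp_vecs[OF xy i])
  have "case_sum y b (Inl i) < case_sum x a (Inl i)" using i by simp
  then obtain j where j: "case_sum x a j < case_sum y b j"
    "lower (case_sum x a) (Inl i) j \<in> \<Gamma>" "raise (case_sum y b) (Inl i) j \<in> \<Gamma>"
    using exchE[OF \<Gamma>'(2) a(1) b] by blast
  show "\<exists>j. x j < y j \<and> lower x i j \<in> Q \<and>
      y + unit_vec i - unit_vec j \<in> top_layer E (proj_left \<Gamma>)"
  proof (cases j)
    case (Inl l)
    have l: "x l < y l" using j(1) Inl by simp
    have lE: "l \<in> E" by (rule in_supp_vecs[OF xy(2,1) l])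
    have "case_sum (lower x i l) a \<in> \<Gamma>"
      using j(2) unfolding Inl by (simp only: case_sum_diff_Inl case_sum_add_Inl)
    moreover have "sum (lower x i l) E = sum x E"
      using iE lE unfolding sum_exchange(1)[OF fin] by simp
    ultimately have 1: "lower x i l \<in> Q" by (rule a(2))
    have "case_sum (raise y i l) b \<in> \<Gamma>"
      using j(3) unfolding Inl by (simp only: case_sum_diff_Inl case_sum_add_Inl)
    moreover have "sum (raise y i l) E = sum y E"
      using iE lE unfolding sum_exchange(2)[OF fin] by simp
    ultimately have "raise y i l \<in> top_layer E (proj_left \<Gamma>)"
      using y_max unfolding top_layer_def proj_left_def by fastforce
    then show ?thesis using l 1 by blast
  next
    case (Inr l)
    have "case_sum (y + unit_vec i) (b - unit_vec l) \<in> \<Gamma>"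
      using j(3) unfolding Inr by (simp only: case_sum_add_Inl case_sum_diff_Inr)
    then have "sum (y + unit_vec i) E \<le> sum y E" by (rule y_max)
    then show ?thesis using iE unfolding sum_unit_step[OF fin] by simp
  qed
qed

text \<open>Within the projection, membership in the bottom layer depends only on the sum, so every
  companion in R of a bottom point meets the hypothesis of \<open>exch_top_layer\<close>.\<close>

lemma exch_deletion_contraction:
  assumes fin: "finite E" and R: "m_convex (E <+> X) R"
  shows "exch (contraction E R) (deletion E R)"
  unfolding deletion_def
proof (rule exch_top_layer[OF fin])
  show "m_convex_unbounded (E <+> X) R" using R by (simp add: m_convex_def)
  fix x assume x: "x \<in> contraction E R"
  then obtain a where "case_sum x a \<in> R"
    by (auto simp: contraction_def bottom_layer_def proj_left_def)
  moreover have "x' \<in> contraction E R" if "case_sum x' a \<in> R" "sum x' E = sum x E" for x'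
    using x that unfolding contraction_def bottom_layer_def proj_left_def by auto
  ultimately show "\<exists>a. case_sum x a \<in> R \<and>
      (\<forall>x'. case_sum x' a \<in> R \<longrightarrow> sum x' E = sum x E \<longrightarrow> x' \<in> contraction E R)"
    by blast
qed

lemma exch_ind:
  assumes fin: "finite E" and \<Gamma>: "m_convex (E <+> X) \<Gamma>"
  shows "exch (ind \<Gamma> W) (top_layer E (proj_left \<Gamma>))"
proof (rule exch_top_layer[OF fin])
  show "m_convex_unbounded (E <+> X) \<Gamma>" using \<Gamma> by (simp add: m_convex_def)
  fix x assume "x \<in> ind \<Gamma> W"
  then show "\<exists>a. case_sum x a \<in> \<Gamma> \<and>
      (\<forall>x'. case_sum x' a \<in> \<Gamma> \<longrightarrow> sum x' E = sum x E \<longrightarrow> x' \<in> ind \<Gamma> W)"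
    unfolding ind_def by blast
qed

text \<open>The companion of x in \<Gamma> is the middle vector of the product. A point x' with the
  same companion can be continued by the same element of X, so it stays in the left set of
  \<Delta>.\<close>

lemma exch_green_R:
  assumes fin: "finite E" and \<Gamma>: "linking_set E \<Gamma>" and green: "green_R E \<Gamma> \<Delta>"
  shows "exch (top_layer E (proj_left \<Delta>)) (top_layer E (proj_left \<Gamma>))"
proof (rule exch_top_layer[OF fin])
  show "m_convex_unbounded (E <+> E) \<Gamma>" using \<Gamma> by (simp add: linking_set_def)
  obtain X where X: "\<Delta> = link_prod \<Gamma> X" using green by (auto simp: green_R_def)
  fix x assume x: "x \<in> top_layer E (proj_left \<Delta>)"
  then obtain w where "case_sum x w \<in> \<Delta>" by (auto simp: top_layer_def proj_left_def)
  then obtain x' y z where eq: "case_sum x w = case_sum x' (- z)"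
    and "case_sum x' (- y) \<in> \<Gamma>" "case_sum y (- z) \<in> X"
    unfolding X link_prod_def by blast
  moreover have "x = x'" using eq by (rule case_sum_inject)
  ultimately have y: "case_sum x (- y) \<in> \<Gamma>" "case_sum y (- z) \<in> X" by simp_all
  have "x' \<in> top_layer E (proj_left \<Delta>)" if "case_sum x' (- y) \<in> \<Gamma>" "sum x' E = sum x E" for x'
  proof -
    have "case_sum x' (- z) \<in> \<Delta>" using that(1) y(2) unfolding X link_prod_def by blast
    then have "x' \<in> proj_left \<Delta>" by (auto simp: proj_left_def)
    then show ?thesis using x that(2) by (simp add: top_layer_def)
  qed
  then show "\<exists>a. case_sum x a \<in> \<Gamma> \<and>
      (\<forall>x'. case_sum x' a \<in> \<Gamma> \<longrightarrow> sum x' E = sum x E \<longrightarrow> x' \<in> top_layer E (proj_left \<Delta>))"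
    using y(1) by blast
qed

section \<open>Gluing two submodular functions\<close>

definition ext_fun :: "('a set \<Rightarrow> int) \<Rightarrow> ('a set \<Rightarrow> int) \<Rightarrow> 'b \<Rightarrow> ('a + 'b) set \<Rightarrow> int"
  where "ext_fun p q b S = (if Inr b \<in> S then q (Inl -` S) else p (Inl -` S))"

lemma submodular_on_ext_fun:
  assumes p: "submodular_on E p" and q: "submodular_on E q" and compl: "compliant E q p"
  shows "submodular_on (E <+> {b}) (ext_fun p q b)"
  unfolding submodular_on_def
proof (intro conjI allI impI)
  show "ext_fun p q b {} = 0" using p by (simp add: ext_fun_def submodular_on_def)
  fix S T :: "('a + 'b) set"
  assume "S \<subseteq> E <+> {b}" "T \<subseteq> E <+> {b}"
  then have sub: "Inl -` S \<subseteq> E" "Inl -` T \<subseteq> E" by auto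
  \<comment> \<open>Pairs with the extra element in one set only: submodularity of q, with its
    increment from A \<inter> B to A replaced by that of p.\<close>
  have mixed: "q (A \<union> B) + p (A \<inter> B) \<le> p A + q B" if "A \<subseteq> E" "B \<subseteq> E" for A B
    using submodular_onD[OF q that] compliantD[OF compl, of "A \<inter> B" A] that by auto
  show "ext_fun p q b (S \<union> T) + ext_fun p q b (S \<inter> T) \<le> ext_fun p q b S + ext_fun p q b T"
    using submodular_onD[OF p sub] submodular_onD[OF q sub] mixed[OF sub] mixed[OF sub(2,1)]
    by (auto simp: ext_fun_def Un_commute Int_commute)
qed

lemma sum_Plus_singleton:
  fixes z :: "'a + 'b \<Rightarrow> int"
  assumes fin: "finite E" and S: "S \<subseteq> E <+> {b}"
  shows "sum z S = (\<Sum>i\<in>Inl -` S. z (Inl i)) + (if Inr b \<in> S then z (Inr b) else 0)"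
proof -
  have "S = (Inl -` S) <+> (if Inr b \<in> S then {b} else {})"
    using S by auto
  moreover have "finite (Inl -` S)" using S fin by (auto intro: finite_subset)
  ultimately have "sum z S = sum (z \<circ> Inl) (Inl -` S) + sum (z \<circ> Inr) (if Inr b \<in> S then {b} else {})"
    using sum.Plus[of "Inl -` S" "if Inr b \<in> S then {b} else {}" z] by simp
  then show ?thesis by simp
qed

lemma case_sum_in_base_points_ext_fun_iff:
  assumes fin: "finite E"
  shows "case_sum x y \<in> base_points (E <+> {b}) (ext_fun p q b) \<longleftrightarrow>
    x \<in> vecs E \<and> y \<in> vecs {b} \<and> (\<forall>A\<subseteq>E. sum x A \<le> p A \<and> sum x A + y b \<le> q A) \<and> sum x E + y b = q E"
    (is "?L \<longleftrightarrow> ?R")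
proof -
  have sum1: "sum (case_sum x y) (Inl ` A) = sum x A" if "A \<subseteq> E" for A
    by (simp add: sum.reindex comp_def)
  have sum2: "sum (case_sum x y) (A <+> {b}) = sum x A + y b" if "A \<subseteq> E" for A
    using sum.Plus[of A "{b}" "case_sum x y"] finite_subset[OF that fin] by (simp add: comp_def)
  have ext1: "ext_fun p q b (Inl ` A) = p A" for A :: "'a set"
    by (auto simp: ext_fun_def vimage_def intro!: arg_cong[where f = p])
  have ext2: "ext_fun p q b (A <+> {b}) = q A" for A :: "'a set"
    by (auto simp: ext_fun_def vimage_def intro!: arg_cong[where f = q])
  have full: "sum (case_sum x y) (E <+> {b}) = sum x E + y b" "ext_fun p q b (E <+> {b}) = q E"
    using sum2 ext2 by auto
  show ?thesis
  proof
    assume L: ?L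
    have le: "sum (case_sum x y) S \<le> ext_fun p q b S" if "S \<subseteq> E <+> {b}" for S
      by (rule base_points_leD[OF L that])
    have "sum x A \<le> p A \<and> sum x A + y b \<le> q A" if A: "A \<subseteq> E" for A
      using le[of "Inl ` A"] le[of "A <+> {b}"] A unfolding sum1[OF A] sum2[OF A] ext1 ext2 by auto
    moreover have "case_sum x y \<in> vecs (E <+> {b})" "sum x E + y b = q E"
      using L full by (simp_all add: base_points_def)
    ultimately show ?R by (simp add: case_sum_in_vecs_iff)
  next
    assume R: ?R
    show ?L
      unfolding base_points_def
    proof (intro CollectI conjI allI impI)
      show "case_sum x y \<in> vecs (E <+> {b})" using R by (simp add: case_sum_in_vecs_iff)
      show "sum (case_sum x y) (E <+> {b}) = ext_fun p q b (E <+> {b})" using R full by simp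
      fix S assume S: "S \<subseteq> E <+> {b}"
      then have "Inl -` S \<subseteq> E" by auto
      then show "sum (case_sum x y) S \<le> ext_fun p q b S"
        using R unfolding sum_Plus_singleton[OF fin S] by (simp add: ext_fun_def)
    qed
  qed
qed

text \<open>
  Gluing \<open>p\<close> and \<open>q\<close> along an extra element \<open>b\<close>: its coordinate is \<open>q(E) - x(E)\<close>, which
  vanishes exactly on \<open>Q\<close>.
\<close>

lemma quotient_extension:
  fixes b :: 'b
  assumes fin: "finite E" and P: "m_convex E P" and Q: "m_convex E Q"
    and compl: "compliant E (submod Q) (submod P)"
  obtains R :: "('a + 'b \<Rightarrow> int) set" where "m_convex (E <+> {b}) R"
    "P = deletion E R" "Q = contraction E R" "Q = {x. case_sum x 0 \<in> R}"
proof -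
  define p q where "p = submod P" and "q = submod Q"
  have sub: "submodular_on E p" "submodular_on E q"
    using submodular_on_submod[OF fin] P Q by (auto simp: p_def q_def)
  then have zero: "p {} = 0" "q {} = 0" by (auto simp: submodular_on_def)
  note compl = compl[folded p_def q_def]
  have P_eq: "P = base_points E p" and Q_eq: "Q = base_points E q"
    using m_convex_eq_base_points[OF fin] P Q by (auto simp: p_def q_def)
  have ne: "P \<noteq> {}" "Q \<noteq> {}" using P Q by (auto simp: m_convex_iff)
  define R where "R = base_points (E <+> {b}) (ext_fun p q b)"
  note R_iff = case_sum_in_base_points_ext_fun_iff[OF fin, of _ _ b p q, folded R_def]
  have q_le_p: "q A \<le> p A" if "A \<subseteq> E" for A
    using compliantD[OF compl, of "{}" A] zero that by simp
  have proj: "x \<in> proj_left R \<longleftrightarrow>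
      x \<in> vecs E \<and> (\<forall>A\<subseteq>E. sum x A \<le> p A \<and> sum x A + (q E - sum x E) \<le> q A)" for x
  proof
    assume "x \<in> proj_left R"
    then obtain y where "case_sum x y \<in> R" by (auto simp: proj_left_def)
    then have y: "x \<in> vecs E" "\<forall>A\<subseteq>E. sum x A \<le> p A \<and> sum x A + y b \<le> q A" "y b = q E - sum x E"
      by (simp_all add: R_iff)
    then show "x \<in> vecs E \<and> (\<forall>A\<subseteq>E. sum x A \<le> p A \<and> sum x A + (q E - sum x E) \<le> q A)"
      by simp
  next
    assume *: "x \<in> vecs E \<and> (\<forall>A\<subseteq>E. sum x A \<le> p A \<and> sum x A + (q E - sum x E) \<le> q A)"
    have "case_sum x ((\<lambda>_. 0)(b := q E - sum x E)) \<in> R"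
      unfolding R_iff using * by (simp add: vecs_def)
    then show "x \<in> proj_left R" by (auto simp: proj_left_def)
  qed
  \<comment> \<open>At height p(E) the second family of bounds follows from the first by compliance
    from A to E.\<close>
  have P_proj: "x \<in> proj_left R \<and> sum x E = p E" if "x \<in> P" for x
  proof -
    have x: "x \<in> vecs E" "sum x E = p E" "\<And>A. A \<subseteq> E \<Longrightarrow> sum x A \<le> p A"
      using that by (simp_all add: P_eq base_points_def)
    have "sum x A + (q E - sum x E) \<le> q A" if "A \<subseteq> E" for A
      using compliantD[OF compl, of A E] x(2) x(3)[OF that] that by simp
    then show ?thesis using x by (simp add: proj)
  qed
  \<comment> \<open>At height q(E) the first family follows from the second, because q <= p.\<close>
  have Q_proj: "x \<in> proj_left R \<and> sum x E = q E" if "x \<in> Q" for x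
  proof -
    have x: "x \<in> vecs E" "sum x E = q E" "\<And>A. A \<subseteq> E \<Longrightarrow> sum x A \<le> q A"
      using that by (simp_all add: Q_eq base_points_def)
    have "sum x A \<le> p A" if "A \<subseteq> E" for A
      using x(3)[OF that] q_le_p[OF that] by simp
    then show ?thesis using x by (simp add: proj)
  qed
  \<comment> \<open>The bounds at A = E and at the empty set confine the height to the interval from
    q(E) to p(E).\<close>
  have le_p: "sum x E \<le> p E" and ge_q: "q E \<le> sum x E" if "x \<in> proj_left R" for x
    using that zero unfolding proj by force+
  have "P = deletion E R"
    unfolding deletion_def
  proof (intro equalityI subsetI)
    fix x assume "x \<in> P"
    then show "x \<in> top_layer E (proj_left R)"
      using P_proj le_p unfolding top_layer_def by simp
  next
    fix x assume x: "x \<in> top_layer E (proj_left R)"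
    obtain u where "u \<in> P" using ne by blast
    then have "sum x E = p E"
      using x P_proj[of u] le_p[of x] unfolding top_layer_def by force
    then show "x \<in> P"
      using x unfolding top_layer_def P_eq base_points_def by (simp add: proj)
  qed
  moreover have "Q = contraction E R"
    unfolding contraction_def
  proof (intro equalityI subsetI)
    fix x assume "x \<in> Q"
    then show "x \<in> bottom_layer E (proj_left R)"
      using Q_proj ge_q unfolding bottom_layer_def by simp
  next
    fix x assume x: "x \<in> bottom_layer E (proj_left R)"
    obtain u where "u \<in> Q" using ne by blast
    then have "sum x E = q E"
      using x Q_proj[of u] ge_q[of x] unfolding bottom_layer_def by force
    then show "x \<in> Q"
      using x unfolding bottom_layer_def Q_eq base_points_def by (simp add: proj)
  qed
  \<comment> \<open>This fibre description is what induction and linking sets use: pairing with the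
    zero vector selects Q.\<close>
  moreover have Q_zero: "Q = {x. case_sum x 0 \<in> R}"
  proof (intro equalityI subsetI)
    fix x assume "x \<in> Q"
    then have x: "x \<in> proj_left R" "sum x E = q E" using Q_proj by auto
    from x(1) have "x \<in> vecs E \<and> (\<forall>A\<subseteq>E. sum x A \<le> p A \<and> sum x A + 0 \<le> q A)"
      unfolding proj x(2) by simp
    then show "x \<in> {x. case_sum x 0 \<in> R}" using x(2) by (simp add: R_iff vecs_def)
  next
    fix x assume "x \<in> {x. case_sum x 0 \<in> R}"
    then show "x \<in> Q" unfolding Q_eq base_points_def by (simp add: R_iff)
  qed
  moreover have "m_convex (E <+> {b}) R"
    unfolding R_def
  proof (rule m_convex_base_points)
    show "finite (E <+> {b})" using fin by simp
    show "submodular_on (E <+> {b}) (ext_fun p q b)"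
      by (rule submodular_on_ext_fun[OF sub compl])
    show "base_points (E <+> {b}) (ext_fun p q b) \<noteq> {}"
      using ne(2) unfolding Q_zero R_def by blast
  qed
  ultimately show ?thesis using that by blast
qed

text \<open>The total over \<open>E <+> {b}\<close> is constant, so the coordinate at b measures the
  depth below a fixed height. Points of different height differ there, and an exchange at b is a
  unit step in the projection; points of equal height agree at b, so their exchanges avoid
  it.\<close>

lemma mnat_convex_proj_left:
  assumes fin: "finite E" and R: "m_convex (E <+> {b}) R"
  shows "mnat_convex E (proj_left R)"
proof -
  note R' = m_convexD[OF R]
  have split: "z = case_sum (z \<circ> Inl) (z \<circ> Inr)" for z :: "'a + 'b \<Rightarrow> int"
    by (simp add: fun_eq_iff split: sum.split)
  have proj: "proj_left R = (\<lambda>z. z \<circ> Inl) ` R"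
  proof (intro equalityI subsetI)
    fix x assume "x \<in> proj_left R"
    then obtain y where "case_sum x y \<in> R" by (auto simp: proj_left_def)
    moreover have "x = case_sum x y \<circ> Inl" by (simp add: fun_eq_iff)
    ultimately show "x \<in> (\<lambda>z. z \<circ> Inl) ` R" by blast
  next
    fix x assume "x \<in> (\<lambda>z. z \<circ> Inl) ` R"
    then obtain z where "z \<in> R" "x = z \<circ> Inl" by blast
    then have "case_sum x (z \<circ> Inr) \<in> R" using split[of z] by simp
    then show "x \<in> proj_left R" by (auto simp: proj_left_def)
  qed
  have total: "sum x E + y b = submod R (E <+> {b})" if "case_sum x y \<in> R" for x y
    using m_convex_sum_eq[OF _ R that] fin sum.Plus[of E "{b}" "case_sum x y"] by (simp add: comp_def)
  have vecs: "x \<in> vecs E" if "case_sum x y \<in> R" for x y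
    using subsetD[OF R'(3) that] by (simp add: case_sum_in_vecs_iff)
  have vecs': "y \<in> vecs {b}" if "case_sum x y \<in> R" for x y
    using subsetD[OF R'(3) that] by (simp add: case_sum_in_vecs_iff)
  show ?thesis
    unfolding mnat_convex_def
  proof (intro conjI ballI impI)
    show "proj_left R \<noteq> {}" "finite (proj_left R)"
      using R' unfolding proj by auto
    show "proj_left R \<subseteq> vecs E" using vecs by (auto simp: proj_left_def)
    fix x y assume "x \<in> proj_left R" "y \<in> proj_left R"
    then obtain s t where s: "case_sum x s \<in> R" and t: "case_sum y t \<in> R"
      by (auto simp: proj_left_def)
    {
      assume "sum y E < sum x E"
      then have "s b < t b" using total[OF s] total[OF t] by simp
      \<comment> \<open>The lower point has the larger coordinate at b, so the exchange starts from
        y.\<close>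
      then have "case_sum x s (Inr b) < case_sum y t (Inr b)" by simp
      then obtain j where j: "case_sum y t j < case_sum x s j"
        "lower (case_sum y t) (Inr b) j \<in> R" "raise (case_sum x s) (Inr b) j \<in> R"
        using exchE[OF R'(4) t s] by blast
      have "j \<in> E <+> {b}"
        by (rule in_supp_vecs[OF subsetD[OF R'(3) s] subsetD[OF R'(3) t] j(1)])
      moreover have "j \<noteq> Inr b" using j(1) \<open>s b < t b\<close> by auto
      ultimately obtain i where i: "j = Inl i" by auto
      have "case_sum (y + unit_vec i) (t - unit_vec b) \<in> R" "case_sum (x - unit_vec i) (s + unit_vec b) \<in> R"
        using j(2,3) unfolding i
        by (simp_all only: case_sum_diff_Inl case_sum_add_Inl case_sum_diff_Inr case_sum_add_Inr)
      then have "x - unit_vec i \<in> proj_left R" "y + unit_vec i \<in> proj_left R"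
        unfolding proj_left_def by blast+
      moreover have "i \<in> supp_pos (x - y)" using j(1) i by simp
      ultimately show "\<exists>i\<in>supp_pos (x - y). x - unit_vec i \<in> proj_left R \<and> y + unit_vec i \<in> proj_left R"
        by blast
    next
      fix i assume eq: "sum x E = sum y E" and i: "i \<in> supp_pos (x - y)"
      have "s b = t b" using total[OF s] total[OF t] eq by simp
      have "case_sum y t (Inl i) < case_sum x s (Inl i)" using i by simp
      then obtain j where j: "case_sum x s j < case_sum y t j"
        "lower (case_sum x s) (Inl i) j \<in> R" "raise (case_sum y t) (Inl i) j \<in> R"
        using exchE[OF R'(4) s t] by blast
      have "j \<in> E <+> {b}"
        by (rule in_supp_vecs[OF subsetD[OF R'(3) t] subsetD[OF R'(3) s] j(1)])
      moreover have "j \<noteq> Inr b" using j(1) \<open>s b = t b\<close> by auto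
      ultimately obtain l where l: "j = Inl l" by auto
      have "case_sum (lower x i l) s \<in> R" "case_sum (raise y i l) t \<in> R"
        using j(2,3) unfolding l by (simp_all only: case_sum_diff_Inl case_sum_add_Inl)
      then have "lower x i l \<in> proj_left R" "raise y i l \<in> proj_left R"
        unfolding proj_left_def by blast+
      moreover have "l \<in> supp_neg (x - y)" using j(1) l by simp
      ultimately show "\<exists>j\<in>supp_neg (x - y).
          x - unit_vec i + unit_vec j \<in> proj_left R \<and> raise y i j \<in> proj_left R"
        by blast
    }
  qed
qed

section \<open>Linking sets and induction\<close>

lemma case_sum_zero: "case_sum 0 0 = 0"
  by (simp add: fun_eq_iff split: sum.split)

lemma case_sum_eq_zero_iff: "case_sum x y = 0 \<longleftrightarrow> x = 0 \<and> y = 0"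
  by (metis case_sum_inject case_sum_zero)

lemma top_layer_singleton: "top_layer E {x} = {x}"
  unfolding top_layer_def by blast

lemma vecs_mono: "A \<subseteq> B \<Longrightarrow> vecs A \<subseteq> vecs B"
  unfolding vecs_def by blast

lemma zero_subset_vecs: "{0} \<subseteq> vecs E"
  by (simp add: vecs_def)

lemma exch_zero: "exch {0} {0}"
  by (simp add: exch_def supp_pos_def)

text \<open>The gluing needs one element of the second copy of E to carry the extra coordinate.
  Multiplying by the linking set \<open>{0}\<close> keeps the elements whose second half is zero,
  and these are the points of Q.\<close>

lemma compliant_imp_green_R:
  assumes fin: "finite E" and P: "m_convex E P" and Q: "m_convex E Q"
    and compl: "compliant E (submod Q) (submod P)"
  shows "\<exists>\<Gamma> \<Delta>. linking_set E \<Gamma> \<and> linking_set E \<Delta> \<and>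
    P = top_layer E (proj_left \<Gamma>) \<and> Q = top_layer E (proj_left \<Delta>) \<and> green_R E \<Gamma> \<Delta>"
proof -
  have "\<exists>\<Gamma>. linking_set E \<Gamma> \<and> P = top_layer E (proj_left \<Gamma>) \<and> Q = {x. case_sum x 0 \<in> \<Gamma>}"
  \<comment> \<open>Without an element of E the extra coordinate has no place, but then both sets
    consist of the zero vector.\<close>
  proof (cases "E = {}")
    case True
    have zero: "S = {0}" if "m_convex E S" for S :: "('a \<Rightarrow> int) set"
    proof -
      have "S \<subseteq> {0}" using that True by (auto simp: m_convex_iff vecs_def fun_eq_iff)
      then show ?thesis using that by (auto simp: m_convex_iff)
    qed
    have "proj_left {0 :: 'a + 'a \<Rightarrow> int} = {0}"
      by (auto simp: proj_left_def case_sum_eq_zero_iff)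
    then have "P = top_layer E (proj_left {0 :: 'a + 'a \<Rightarrow> int})"
      by (simp only: zero[OF P] top_layer_singleton)
    moreover have "Q = {x. case_sum x 0 \<in> {0 :: 'a + 'a \<Rightarrow> int}}"
      unfolding zero[OF Q] by (simp add: case_sum_eq_zero_iff)
    moreover have "linking_set E {0}"
      using zero_subset_vecs exch_zero unfolding linking_set_def m_convex_unbounded_iff by blast
    ultimately show ?thesis by blast
  next
    case False
    then obtain e where e: "e \<in> E" by blast
    obtain R :: "('a + 'a \<Rightarrow> int) set" where R: "m_convex (E <+> {e}) R"
      "P = deletion E R" "Q = {x. case_sum x 0 \<in> R}"
      using quotient_extension[OF fin P Q compl, of e] by blast
    have "vecs (E <+> {e}) \<subseteq> (vecs (E <+> E) :: ('a + 'a \<Rightarrow> int) set)"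
      using e by (intro vecs_mono) auto
    then have "linking_set E R"
      using R(1) unfolding linking_set_def m_convex_unbounded_iff m_convex_iff by blast
    then show ?thesis using R unfolding deletion_def by blast
  qed
  then obtain \<Gamma> where \<Gamma>: "linking_set E \<Gamma>" "P = top_layer E (proj_left \<Gamma>)" "Q = {x. case_sum x 0 \<in> \<Gamma>}"
    by blast
  have Q': "Q \<subseteq> vecs E" "exch Q Q" using Q by (auto simp: m_convex_iff)
  define \<Delta> where "\<Delta> = link_prod \<Gamma> {0}"
  have \<Delta>_eq: "\<Delta> = (\<lambda>x. case_sum x 0) ` Q"
    unfolding \<Delta>_def link_prod_def \<Gamma>(3) by (auto simp: case_sum_eq_zero_iff)
  have "linking_set E \<Delta>"
    unfolding linking_set_def m_convex_unbounded_iff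
  proof
    show "\<Delta> \<subseteq> vecs (E <+> E)"
      using Q'(1) zero_subset_vecs[of E] by (auto simp: \<Delta>_eq case_sum_in_vecs_iff)
    show "exch \<Delta> \<Delta>"
    proof (rule exchI)
      fix z w i assume "z \<in> \<Delta>" "w \<in> \<Delta>" and i: "w i < z i"
      then obtain x y where xy: "x \<in> Q" "y \<in> Q" "z = case_sum x 0" "w = case_sum y 0"
        by (auto simp: \<Delta>_eq)
      obtain l where l: "i = Inl l" "y l < x l" using i xy by (cases i) auto
      obtain j where j: "x j < y j" "lower x l j \<in> Q" "raise y l j \<in> Q"
        using exchE[OF Q'(2) xy(1,2) l(2)] by blast
      have "lower z i (Inl j) = case_sum (lower x l j) 0"
        "raise w i (Inl j) = case_sum (raise y l j) 0"
        unfolding xy l by (simp_all only: case_sum_diff_Inl case_sum_add_Inl)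
      then have "lower z i (Inl j) \<in> \<Delta>" "raise w i (Inl j) \<in> \<Delta>"
        using j unfolding \<Delta>_eq by (metis imageI)+
      then show "\<exists>j. z j < w j \<and> lower z i j \<in> \<Delta> \<and> raise w i j \<in> \<Delta>"
        using j(1) xy(3,4) by (intro exI[of _ "Inl j"]) simp
    qed
  qed
  moreover have "Q = top_layer E (proj_left \<Delta>)"
  proof -
    have "proj_left \<Delta> = Q"
      unfolding proj_left_def \<Delta>_eq by (auto elim: case_sum_inject)
    moreover have "top_layer E Q = Q"
      using m_convex_sum_eq[OF fin Q] by (auto simp: top_layer_def)
    ultimately show ?thesis by simp
  qed
  moreover have "green_R E \<Gamma> \<Delta>"
    unfolding green_R_def \<Delta>_def
    using zero_subset_vecs[of "E <+> E"] exch_zero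
    by (intro exI[of _ "{0}"]) (simp add: linking_set_def m_convex_unbounded_iff)
  ultimately show ?thesis using \<Gamma> by blast
qed

text \<open>Taking for W the zero vector alone picks the fibre of the gluing over zero, which is
  Q.\<close>

lemma compliant_imp_ind:
  fixes b :: 'b
  assumes fin: "finite E" and P: "m_convex E P" and Q: "m_convex E Q"
    and compl: "compliant E (submod Q) (submod P)"
  shows "\<exists>\<Gamma> W. m_convex (E <+> {b}) \<Gamma> \<and> m_convex {b} W \<and>
    P = top_layer E (proj_left \<Gamma>) \<and> Q = ind \<Gamma> W"
proof -
  obtain R :: "('a + 'b \<Rightarrow> int) set" where R: "m_convex (E <+> {b}) R"
    "P = deletion E R" "Q = {x. case_sum x 0 \<in> R}"
    using quotient_extension[OF fin P Q compl, of b] by blast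
  have "m_convex {b} {0 :: 'b \<Rightarrow> int}"
    using zero_subset_vecs[of "{b}"] exch_zero by (simp add: m_convex_iff)
  moreover have "Q = ind R {0}" using R(3) by (simp add: ind_def)
  ultimately show ?thesis using R unfolding deletion_def by blast
qed

section \<open>Minkowski sums and matroid lifts\<close>

text \<open>These are the bounds on E that remain once the coordinate e has been fixed at a: A is
  bounded directly, and through the bound on A with e added.\<close>

lemma submodular_on_min:
  assumes p: "submodular_on (insert e E) p" and "e \<notin> E" and a: "a \<le> p {e}"
  shows "submodular_on E (\<lambda>A. min (p A) (p (insert e A) - a))"
  unfolding submodular_on_def
proof (intro conjI allI impI)
  show "min (p {}) (p {e} - a) = 0" using p a by (simp add: submodular_on_def)
  fix A B assume AB: "A \<subseteq> E" "B \<subseteq> E"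
  have eqs: "insert e A \<union> insert e B = insert e (A \<union> B)" "insert e A \<inter> insert e B = insert e (A \<inter> B)"
    "A \<union> insert e B = insert e (A \<union> B)" "insert e A \<union> B = insert e (A \<union> B)"
    "A \<inter> insert e B = A \<inter> B" "insert e A \<inter> B = A \<inter> B"
    using AB \<open>e \<notin> E\<close> by auto
  have "A \<subseteq> insert e E" "B \<subseteq> insert e E" "insert e A \<subseteq> insert e E" "insert e B \<subseteq> insert e E"
    using AB by auto
  note sub = submodular_onD[OF p this(1,2)] submodular_onD[OF p this(3,4)]
    submodular_onD[OF p this(1,4)] submodular_onD[OF p this(3,2)]
  show "min (p (A \<union> B)) (p (insert e (A \<union> B)) - a) + min (p (A \<inter> B)) (p (insert e (A \<inter> B)) - a)
      \<le> min (p A) (p (insert e A) - a) + min (p B) (p (insert e B) - a)"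
    using sub unfolding eqs by (auto simp: min_def)
qed

text \<open>Frank's discrete sandwich theorem; the coordinates are fixed one at a time.\<close>

lemma discrete_sandwich:
  assumes "finite E" and "submodular_on E p" and "submodular_on E (\<lambda>A. - g A)"
    and "\<And>A. A \<subseteq> E \<Longrightarrow> g A \<le> p A"
  shows "\<exists>x :: 'a \<Rightarrow> int. \<forall>A\<subseteq>E. g A \<le> sum x A \<and> sum x A \<le> p A"
  using assms
proof (induction E arbitrary: p g rule: finite_induct)
  case empty
  then show ?case by (auto simp: submodular_on_def)
next
  case (insert e E)
  have p: "p (A \<union> B) + p (A \<inter> B) \<le> p A + p B" if "A \<subseteq> insert e E" "B \<subseteq> insert e E" for A B
    by (rule submodular_onD[OF insert.prems(1) that])
  have g: "g A + g B \<le> g (A \<union> B) + g (A \<inter> B)" if "A \<subseteq> insert e E" "B \<subseteq> insert e E" for A B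
    using submodular_onD[OF insert.prems(2) that] by simp
  have g_le_p: "g A \<le> p A" if "A \<subseteq> insert e E" for A by (rule insert.prems(3)[OF that])
  have zero: "p {} = 0" "g {} = 0" using insert.prems(1,2) by (auto simp: submodular_on_def)
  have IE: "insert e A \<union> insert e B = insert e (A \<union> B)" "insert e A \<inter> insert e B = insert e (A \<inter> B)"
    "A \<union> insert e B = insert e (A \<union> B)" "insert e B \<union> A = insert e (A \<union> B)" for A B :: "'a set"
    by auto
  have II: "A \<inter> insert e B = A \<inter> B" "insert e B \<inter> A = A \<inter> B" if "A \<subseteq> E" for A B :: "'a set"
    using that insert.hyps(2) by auto
  \<comment> \<open>The largest value allowed at e: the bound p on A with e added leaves at most
    \<open>p (insert e A)\<close> - x(A), and x(A) is at least g(A).\<close>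
  define \<alpha> where "\<alpha> = Min ((\<lambda>A. p (insert e A) - g A) ` Pow E)"
  have "\<alpha> \<in> (\<lambda>A. p (insert e A) - g A) ` Pow E"
    unfolding \<alpha>_def using insert.hyps(1) by (intro Min_in) auto
  then obtain B where B: "B \<subseteq> E" "\<alpha> = p (insert e B) - g B" by auto
  have ub: "\<alpha> \<le> p (insert e A) - g A" if "A \<subseteq> E" for A
    unfolding \<alpha>_def using insert.hyps(1) that by (intro Min_le) auto
  \<comment> \<open>The lower bounds at e do not exceed \<alpha>: uncross A with the set B at which
    \<alpha> is attained, once for g and once for p.\<close>
  have lb: "g (insert e A) - p A \<le> \<alpha>" if A: "A \<subseteq> E" for A
  proof -
    have "g (insert e A) + g B \<le> g (insert e (A \<union> B)) + g (A \<inter> B)"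
    proof -
      have "insert e A \<subseteq> insert e E" "B \<subseteq> insert e E" using A B(1) by auto
      from g[OF this] show ?thesis by (simp only: IE II[OF B(1)] Un_commute[of B A] Int_commute[of B A])
    qed
    moreover have "g (insert e (A \<union> B)) \<le> p (insert e (A \<union> B))" "g (A \<inter> B) \<le> p (A \<inter> B)"
      using A B(1) by (auto intro!: g_le_p)
    moreover have "p (insert e (A \<union> B)) + p (A \<inter> B) \<le> p A + p (insert e B)"
    proof -
      have "A \<subseteq> insert e E" "insert e B \<subseteq> insert e E" using A B(1) by auto
      from p[OF this] show ?thesis by (simp only: IE II[OF A])
    qed
    ultimately show ?thesis using B(2) by linarith
  qed
  define p' where "p' A = min (p A) (p (insert e A) - \<alpha>)" for A
  define g' where "g' A = max (g A) (g (insert e A) - \<alpha>)" for A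
  have "submodular_on E p'"
    unfolding p'_def using ub[of "{}"] zero
    by (intro submodular_on_min[OF insert.prems(1) insert.hyps(2)]) simp
  moreover have "(\<lambda>A. - g' A) = (\<lambda>A. min (- g A) (- g (insert e A) - (- \<alpha>)))"
    by (auto simp: g'_def fun_eq_iff)
  then have "submodular_on E (\<lambda>A. - g' A)"
    using submodular_on_min[OF insert.prems(2) insert.hyps(2), of "- \<alpha>"] lb[of "{}"] zero by simp
  moreover have "g' A \<le> p' A" if A: "A \<subseteq> E" for A
    using g_le_p[of A] g_le_p[of "insert e A"] ub[OF A] lb[OF A] A by (auto simp: g'_def p'_def)
  ultimately have "\<exists>x :: 'a \<Rightarrow> int. \<forall>A\<subseteq>E. g' A \<le> sum x A \<and> sum x A \<le> p' A"
    by (rule insert.IH)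
  then obtain x :: "'a \<Rightarrow> int" where x: "\<And>A. A \<subseteq> E \<Longrightarrow> g' A \<le> sum x A \<and> sum x A \<le> p' A" by blast
  have "g A \<le> sum (x(e := \<alpha>)) A \<and> sum (x(e := \<alpha>)) A \<le> p A" if A: "A \<subseteq> insert e E" for A
  proof (cases "e \<in> A")
    case False
    then have "A \<subseteq> E" using A by auto
    have "sum (x(e := \<alpha>)) A = sum x A" using False by (intro sum.cong) auto
    then show ?thesis using x[OF \<open>A \<subseteq> E\<close>] by (auto simp: g'_def p'_def)
  next
    case True
    then obtain C where C: "A = insert e C" "e \<notin> C" by (meson mk_disjoint_insert)
    then have "C \<subseteq> E" using A by auto
    have "sum (x(e := \<alpha>)) C = sum x C" using C by (intro sum.cong) auto
    moreover have "finite C" using \<open>C \<subseteq> E\<close> insert.hyps(1) by (rule finite_subset)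
    ultimately have "sum (x(e := \<alpha>)) A = \<alpha> + sum x C" using C by simp
    then show ?thesis using x[OF \<open>C \<subseteq> E\<close>] C by (auto simp: g'_def p'_def)
  qed
  then show ?case by blast
qed

text \<open>With p and q the functions of P and Q, splitting z as x + (z - x) needs an x with z(A) -
  q(A) <= x(A) <= p(A) for all A. The left side is supermodular and lies below p by the bounds on z,
  so the sandwich theorem supplies an integral x.\<close>

lemma m_convex_plus_eq:
  assumes fin: "finite E" and P: "m_convex E P" and Q: "m_convex E Q"
  shows "P + Q = base_points E (\<lambda>A. submod P A + submod Q A)"
proof (intro equalityI subsetI)
  have P': "finite P" "P \<subseteq> vecs E" and Q': "finite Q" "Q \<subseteq> vecs E"
    using P Q by (auto simp: m_convex_iff)
  fix z assume "z \<in> P + Q"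
  then obtain x y where xy: "x \<in> P" "y \<in> Q" "z = x + y" by (auto elim: set_plus_elim)
  have "sum z A \<le> submod P A + submod Q A" for A
    unfolding xy(3) sum_fun_add using submod_ge[OF P'(1) xy(1)] submod_ge[OF Q'(1) xy(2)]
    by (intro add_mono)
  moreover have "sum z E = submod P E + submod Q E"
    unfolding xy(3) sum_fun_add m_convex_sum_eq[OF fin P xy(1)] m_convex_sum_eq[OF fin Q xy(2)] ..
  moreover have "x \<in> vecs E" "y \<in> vecs E" using xy P' Q' by auto
  then have "z \<in> vecs E" unfolding xy(3) vecs_def by simp
  ultimately show "z \<in> base_points E (\<lambda>A. submod P A + submod Q A)"
    unfolding base_points_def by blast
next
  fix z assume z: "z \<in> base_points E (\<lambda>A. submod P A + submod Q A)"
  then have zE: "z \<in> vecs E" "sum z E = submod P E + submod Q E" by (simp_all add: base_points_def)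
  have p: "submodular_on E (submod P)" and q: "submodular_on E (submod Q)"
    using submodular_on_submod[OF fin] P Q by auto
  have "submodular_on E (\<lambda>A. - (sum z A - submod Q A))"
    unfolding submodular_on_def
  proof (intro conjI allI impI)
    show "- (sum z {} - submod Q {}) = 0" using q by (simp add: submodular_on_def)
    fix A B assume AB: "A \<subseteq> E" "B \<subseteq> E"
    then have "sum z (A \<union> B) + sum z (A \<inter> B) = sum z A + sum z B"
      using fin by (intro sum.union_inter) (auto intro: finite_subset)
    then show "- (sum z (A \<union> B) - submod Q (A \<union> B)) + - (sum z (A \<inter> B) - submod Q (A \<inter> B))
        \<le> - (sum z A - submod Q A) + - (sum z B - submod Q B)"
      using submodular_onD[OF q AB] by linarith
  qed
  moreover have "sum z A - submod Q A \<le> submod P A" if "A \<subseteq> E" for A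
    using base_points_leD[OF z that] by simp
  ultimately have "\<exists>x :: 'a \<Rightarrow> int. \<forall>A\<subseteq>E. sum z A - submod Q A \<le> sum x A \<and> sum x A \<le> submod P A"
    by (rule discrete_sandwich[OF fin p])
  then obtain x0 :: "'a \<Rightarrow> int" where x0: "\<And>A. A \<subseteq> E \<Longrightarrow>
      sum z A - submod Q A \<le> sum x0 A \<and> sum x0 A \<le> submod P A"
    by blast
  \<comment> \<open>The sandwich theorem says nothing about coordinates outside E.\<close>
  define x where "x i = (if i \<in> E then x0 i else 0)" for i
  have "sum x A = sum x0 A" if "A \<subseteq> E" for A
    using that by (intro sum.cong) (auto simp: x_def)
  then have x: "sum z A - submod Q A \<le> sum x A" "sum x A \<le> submod P A" if "A \<subseteq> E" for A
    using x0[OF that] that by auto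
  have xE: "x \<in> vecs E" by (simp add: x_def vecs_def)
  have xsum: "sum x E = submod P E"
    using x[OF order_refl] zE(2) by simp
  have "x \<in> base_points E (submod P)"
    unfolding base_points_def using x(2) xE xsum by blast
  moreover have "z - x \<in> base_points E (submod Q)"
    unfolding base_points_def mem_Collect_eq sum_fun_diff
  proof (intro conjI allI impI)
    show "z - x \<in> vecs E" using xE zE(1) by (simp add: vecs_def)
    show "sum z E - sum x E = submod Q E" using xsum zE(2) by simp
    fix A assume "A \<subseteq> E"
    then show "sum z A - sum x A \<le> submod Q A" using x(1)[of A] by simp
  qed
  ultimately have "x \<in> P" "z - x \<in> Q"
    using m_convex_eq_base_points[OF fin] P Q by blast+
  then have "x + (z - x) \<in> P + Q" by (rule set_plus_intro)
  then show "z \<in> P + Q" by simp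
qed

lemma m_convex_plus:
  assumes fin: "finite E" and P: "m_convex E P" and Q: "m_convex E Q"
  shows "m_convex E (P + Q)"
  unfolding m_convex_plus_eq[OF assms]
proof (rule m_convex_base_points[OF fin])
  have p: "submodular_on E (submod P)" and q: "submodular_on E (submod Q)"
    using submodular_on_submod[OF fin] P Q by auto
  show "submodular_on E (\<lambda>A. submod P A + submod Q A)"
    unfolding submodular_on_def
  proof (intro conjI allI impI)
    show "submod P {} + submod Q {} = 0" using p q by (simp add: submodular_on_def)
    fix A B assume AB: "A \<subseteq> E" "B \<subseteq> E"
    show "submod P (A \<union> B) + submod Q (A \<union> B) + (submod P (A \<inter> B) + submod Q (A \<inter> B))
        \<le> submod P A + submod Q A + (submod P B + submod Q B)"
      using submodular_onD[OF p AB] submodular_onD[OF q AB] by linarith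
  qed
  show "base_points E (\<lambda>A. submod P A + submod Q A) \<noteq> {}"
    unfolding m_convex_plus_eq[OF assms, symmetric]
    using P Q by (auto simp: m_convex_iff intro: set_plus_intro)
qed

section \<open>Lifts along a box\<close>

lemma push_add: "push V \<phi> (x + y) = push V \<phi> x + push V \<phi> y"
  unfolding push_def sum_fun_add by (simp add: plus_fun_def)

lemma push_exchange:
  fixes x :: "'v \<Rightarrow> int"
  assumes "finite V" "i \<in> V" "j \<in> V"
  shows "push V \<phi> (lower x i j) = lower (push V \<phi> x) (\<phi> i) (\<phi> j)"
    and "push V \<phi> (raise x i j) = raise (push V \<phi> x) (\<phi> i) (\<phi> j)"
proof -
  have fin: "finite {l \<in> V. \<phi> l = k}" for k using assms(1) by simp
  show "push V \<phi> (lower x i j) = lower (push V \<phi> x) (\<phi> i) (\<phi> j)"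
    unfolding push_def sum_exchange(1)[OF fin] using assms(2,3) by (auto simp: fun_eq_iff unit_vec_apply)
  show "push V \<phi> (raise x i j) = raise (push V \<phi> x) (\<phi> i) (\<phi> j)"
    unfolding push_def sum_exchange(2)[OF fin] using assms(2,3) by (auto simp: fun_eq_iff unit_vec_apply)
qed

lemma sum_push:
  fixes y :: "'v \<Rightarrow> 'b::comm_monoid_add"
  assumes "finite V" "finite X"
  shows "sum (push V \<phi> y) X = sum y {j \<in> V. \<phi> j \<in> X}"
proof -
  have "sum y {j \<in> V. \<phi> j \<in> X} = (\<Sum>i\<in>X. sum y {j \<in> {j \<in> V. \<phi> j \<in> X}. \<phi> j = i})"
    using assms by (intro sum.group[symmetric]) auto
  also have "\<dots> = sum (push V \<phi> y) X"
    unfolding push_def by (intro sum.cong refl arg_cong2[where f = sum]) auto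
  finally show ?thesis ..
qed

lemma int_box_exchange:
  assumes "x \<in> int_box V a b" "y \<in> int_box V a b" "y i < x i" "x j < y j" "i \<in> V" "j \<in> V"
  shows "lower x i j \<in> int_box V a b"
proof -
  have "i \<noteq> j" using assms by auto
  moreover have "a i \<le> y i" "y j \<le> b j" using assms by (auto simp: int_box_def)
  ultimately show ?thesis
    using assms unfolding int_box_def vecs_def by (auto simp: unit_vec_apply)
qed

text \<open>If some j in the fibre of i has \<open>x j < y j\<close>, exchange within the fibre; the
  images do not move. Otherwise the image of x exceeds that of y at \<open>\<phi> i\<close>. The
  partner k found for the images has a larger fibre sum for y than for x, so some j over k has
  \<open>x j < y j\<close>.\<close>

lemma exch_box_lift:
  assumes fin: "finite V" and ex: "exch Q P"
  shows "exch (box_lift V \<phi> v (int_box V a b) Q) (box_lift V \<phi> v (int_box V a b) P)"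
proof (rule exchI)
  fix x y i
  assume x: "x \<in> box_lift V \<phi> v (int_box V a b) Q" and y: "y \<in> box_lift V \<phi> v (int_box V a b) P"
    and i: "y i < x i"
  have xb: "x \<in> int_box V a b" "y \<in> int_box V a b" and xQ: "push V \<phi> x + v \<in> Q" and yP: "push V \<phi> y + v \<in> P"
    using x y by (auto simp: box_lift_def)
  have vecs: "x \<in> vecs V" "y \<in> vecs V" using xb by (auto simp: int_box_def)
  have iV: "i \<in> V" by (rule in_supp_vecs[OF vecs i])
  have "\<exists>j\<in>V. x j < y j \<and> lower (push V \<phi> x + v) (\<phi> i) (\<phi> j) \<in> Q \<and>
      push V \<phi> y + v + unit_vec (\<phi> i) - unit_vec (\<phi> j) \<in> P"
  proof (cases "\<exists>j\<in>V. \<phi> j = \<phi> i \<and> x j < y j")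
    case True
    then obtain j where "j \<in> V" "\<phi> j = \<phi> i" "x j < y j" by blast
    then show ?thesis using xQ yP by (intro bexI[of _ j]) simp_all
  next
    case False
    have "push V \<phi> y (\<phi> i) < push V \<phi> x (\<phi> i)"
      unfolding push_def using fin iV i False by (intro sum_strict_mono_ex1) (auto simp: not_less)
    then have "(push V \<phi> y + v) (\<phi> i) < (push V \<phi> x + v) (\<phi> i)" by simp
    then obtain k where k: "(push V \<phi> x + v) k < (push V \<phi> y + v) k"
      "lower (push V \<phi> x + v) (\<phi> i) k \<in> Q" "raise (push V \<phi> y + v) (\<phi> i) k \<in> P"
      using exchE[OF ex xQ yP] by blast
    have "sum x {j \<in> V. \<phi> j = k} < sum y {j \<in> V. \<phi> j = k}"
      using k(1) by (simp add: push_def)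
    then obtain j where "j \<in> {j \<in> V. \<phi> j = k}" "x j < y j" by (rule sum_less_imp_ex)
    then show ?thesis using k by blast
  qed
  then obtain j where j: "j \<in> V" "x j < y j"
    "lower (push V \<phi> x + v) (\<phi> i) (\<phi> j) \<in> Q"
    "raise (push V \<phi> y + v) (\<phi> i) (\<phi> j) \<in> P"
    by blast
  have 1: "lower x i j \<in> int_box V a b"
    by (rule int_box_exchange[OF xb i j(2) iV j(1)])
  have "lower y j i \<in> int_box V a b"
    by (rule int_box_exchange[OF xb(2,1) j(2) i j(1) iV])
  then have 2: "raise y i j \<in> int_box V a b" by (simp add: algebra_simps)
  have 3: "push V \<phi> (lower x i j) + v = lower (push V \<phi> x + v) (\<phi> i) (\<phi> j)"
    unfolding push_exchange[OF fin iV j(1)] by (simp add: algebra_simps)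
  have 4: "push V \<phi> (raise y i j) + v = raise (push V \<phi> y + v) (\<phi> i) (\<phi> j)"
    unfolding push_exchange[OF fin iV j(1)] by (simp add: algebra_simps)
  show "\<exists>j. x j < y j \<and> lower x i j \<in> box_lift V \<phi> v (int_box V a b) Q \<and>
      y + unit_vec i - unit_vec j \<in> box_lift V \<phi> v (int_box V a b) P"
    unfolding box_lift_def mem_Collect_eq
  proof (intro exI[of _ j] conjI 1 2 j(2))
    show "push V \<phi> (lower x i j) + v \<in> Q" unfolding 3 by (rule j(3))
    show "push V \<phi> (raise y i j) + v \<in> P" unfolding 4 by (rule j(4))
  qed
qed

lemma finite_int_box:
  assumes fin: "finite V"
  shows "finite (int_box V a b)"
proof (rule finite_subset[OF _ finite_bounded_vecs[OF fin]], intro subsetI CollectI conjI ballI)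
  fix x i assume x: "x \<in> int_box V a b" and i: "i \<in> V"
  have "a i \<le> x i" "x i \<le> b i" using x i by (auto simp: int_box_def)
  then show "\<bar>x i\<bar> \<le> \<bar>a i\<bar> + \<bar>b i\<bar>" by linarith
qed (simp add: int_box_def)

lemma m_convex_box_lift:
  assumes fin: "finite V" and P: "m_convex E P"
    and cover: "P \<subseteq> (\<lambda>y. push V \<phi> y + v) ` int_box V a b"
  shows "m_convex V (box_lift V \<phi> v (int_box V a b) P)"
  unfolding m_convex_iff
proof (intro conjI)
  show "box_lift V \<phi> v (int_box V a b) P \<noteq> {}"
    using cover P unfolding m_convex_iff box_lift_def by blast
  have sub: "box_lift V \<phi> v (int_box V a b) P \<subseteq> int_box V a b" by (auto simp: box_lift_def)
  then show "finite (box_lift V \<phi> v (int_box V a b) P)"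
    using finite_int_box[OF fin] by (rule finite_subset)
  show "box_lift V \<phi> v (int_box V a b) P \<subseteq> vecs V"
    using sub by (auto simp: int_box_def)
  show "exch (box_lift V \<phi> v (int_box V a b) P) (box_lift V \<phi> v (int_box V a b) P)"
    using P by (intro exch_box_lift[OF fin]) (simp add: m_convex_iff)
qed

text \<open>Every point of P has a lift, so the maximum over the preimage of X is that of P up to
  the translation. Thus inequalities between lifts descend to P and Q.\<close>

lemma submod_box_lift:
  assumes fin: "finite V" and P: "m_convex E P"
    and cover: "P \<subseteq> (\<lambda>y. push V \<phi> y + v) ` int_box V a b" and X: "finite X"
  shows "submod (box_lift V \<phi> v (int_box V a b) P) {j \<in> V. \<phi> j \<in> X} = submod P X - sum v X"
proof -
  let ?M = "box_lift V \<phi> v (int_box V a b) P"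
  have P': "P \<noteq> {}" "finite P" using P by (auto simp: m_convex_iff)
  have finM: "finite ?M"
    by (rule finite_subset[OF _ finite_int_box[OF fin]]) (auto simp: box_lift_def)
  have sum_eq: "sum (push V \<phi> y + v) X = sum y {j \<in> V. \<phi> j \<in> X} + sum v X" for y
    unfolding sum_fun_add sum_push[OF fin X] ..
  obtain x where x: "x \<in> P" "sum x X = submod P X" using submod_attained[OF P'(2,1)] by blast
  then obtain y where y: "y \<in> int_box V a b" "x = push V \<phi> y + v" using cover by blast
  have "y \<in> ?M" using x y by (simp add: box_lift_def)
  moreover have "sum y {j \<in> V. \<phi> j \<in> X} = submod P X - sum v X"
    using x(2) sum_eq[of y] y(2) by simp
  moreover have "sum z {j \<in> V. \<phi> j \<in> X} \<le> submod P X - sum v X" if "z \<in> ?M" for z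
  proof -
    have "push V \<phi> z + v \<in> P" using that by (simp add: box_lift_def)
    then show ?thesis using submod_ge[OF P'(2), of "push V \<phi> z + v" X] sum_eq[of z] by simp
  qed
  ultimately show ?thesis using submod_eqI[OF finM] by metis
qed

section \<open>Matroid ranks and lifts into the unit box\<close>

lemma matroid_rank_eq_submod:
  assumes fin: "finite V" and M: "M \<noteq> {}" "finite M" "M \<subseteq> {y. range y \<subseteq> {0, 1}}" and A: "A \<subseteq> V"
  shows "int (matroid_rank M A) = submod M A"
proof -
  have finA: "finite A" using A fin by (rule finite_subset)
  have sum_eq: "sum y A = int (card (A \<inter> {j. y j = 1}))" if "y \<in> M" for y
  proof -
    have "y j = 0 \<or> y j = 1" for j using M(3) that by blast
    then have "sum y A = (\<Sum>j\<in>A. of_bool (y j = 1))" by (intro sum.cong) auto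
    then show ?thesis using finA by (simp add: Int_def)
  qed
  obtain y where y: "y \<in> M" "sum y A = submod M A" using submod_attained[OF M(2,1)] by blast
  have "matroid_rank M A = card (A \<inter> {j. y j = 1})"
    unfolding matroid_rank_def
  proof (rule Max_eqI)
    have "{card I | I. I \<subseteq> A \<and> (\<exists>y\<in>M. I \<subseteq> {j. y j = 1})} \<subseteq> card ` Pow A" by auto
    then show "finite {card I | I. I \<subseteq> A \<and> (\<exists>y\<in>M. I \<subseteq> {j. y j = 1})}"
      using finA by (auto intro: finite_subset)
    show "card (A \<inter> {j. y j = 1}) \<in> {card I | I. I \<subseteq> A \<and> (\<exists>y\<in>M. I \<subseteq> {j. y j = 1})}"
      using y(1) by blast
    fix n assume "n \<in> {card I | I. I \<subseteq> A \<and> (\<exists>y\<in>M. I \<subseteq> {j. y j = 1})}"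
    then obtain I z where I: "n = card I" "I \<subseteq> A" "z \<in> M" "I \<subseteq> {j. z j = 1}" by blast
    have "card I \<le> card (A \<inter> {j. z j = 1})" using I finA by (intro card_mono) auto
    also have "int (card (A \<inter> {j. z j = 1})) \<le> submod M A"
      unfolding sum_eq[OF I(3), symmetric] by (rule submod_ge[OF M(2) I(3)])
    also have "\<dots> = int (card (A \<inter> {j. y j = 1}))" using y sum_eq by simp
    finally show "n \<le> card (A \<inter> {j. y j = 1})" using I(1) by simp
  qed
  then show ?thesis using y sum_eq by simp
qed

lemma matroid_quotient_iff_compliant:
  assumes fin: "finite V" and M: "m_convex V M" "M \<subseteq> {y. range y \<subseteq> {0, 1}}"
    and N: "m_convex V N" "N \<subseteq> {y. range y \<subseteq> {0, 1}}"
  shows "matroid_quotient V M N \<longleftrightarrow> compliant V (submod N) (submod M)"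
proof -
  have M': "M \<noteq> {}" "finite M" and N': "N \<noteq> {}" "finite N" using M N by (auto simp: m_convex_iff)
  have rank: "int (matroid_rank M A) = submod M A" "int (matroid_rank N A) = submod N A" if "A \<subseteq> V" for A
    using matroid_rank_eq_submod[OF fin M' M(2) that] matroid_rank_eq_submod[OF fin N' N(2) that] by auto
  have "int (matroid_rank N Y) - int (matroid_rank N X) \<le> int (matroid_rank M Y) - int (matroid_rank M X) \<longleftrightarrow>
      submod N Y - submod N X \<le> submod M Y - submod M X" if "X \<subseteq> Y" "Y \<subseteq> V" for X Y
    using rank[OF that(2)] rank[OF order_trans[OF that]] by simp
  then show ?thesis unfolding matroid_quotient_def compliant_def by blast
qed

lemma compatible_lifts_quotient:
  assumes fin: "finite V" and ex: "exch Q P" and lifts: "compatible_matroid_lifts E P Q V M N"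
  shows "matroid_quotient V M N"
proof -
  obtain \<phi> v a b where "M = box_lift V \<phi> v (int_box V a b) P" "N = box_lift V \<phi> v (int_box V a b) Q"
    using lifts unfolding compatible_matroid_lifts_def by blast
  then have "exch N M" using exch_box_lift[OF fin ex] by simp
  moreover have MN: "m_convex V M" "m_convex V N" "M \<subseteq> {y. range y \<subseteq> {0, 1}}" "N \<subseteq> {y. range y \<subseteq> {0, 1}}"
    using lifts unfolding compatible_matroid_lifts_def by auto
  ultimately have "compliant V (submod N) (submod M)" by (intro exch_imp_compliant[OF fin])
  then show ?thesis using matroid_quotient_iff_compliant[OF fin] MN by blast
qed

abbreviation unit_box :: "'v set \<Rightarrow> ('v \<Rightarrow> int) set"
  where "unit_box V \<equiv> int_box V (\<lambda>_. 0) (\<lambda>_. 1)"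

lemma unit_box_range: "y \<in> unit_box V \<Longrightarrow> range y \<subseteq> {0, 1}"
proof
  fix t assume y: "y \<in> unit_box V" and "t \<in> range y"
  then obtain j where j: "t = y j" by blast
  show "t \<in> {0, 1}"
  proof (cases "j \<in> V")
    case True
    then have "0 \<le> y j" "y j \<le> 1" using y by (auto simp: int_box_def)
    then show ?thesis using j by auto
  next
    case False
    then show ?thesis using y j by (simp add: int_box_def vecs_def)
  qed
qed

text \<open>Shift the points by a bound K for their coordinates, so that entries lie between 0 and
  2K, and replace each element of E by W copies; an entry m is lifted to the indicator of the first
  m copies. The copies are numbered by naturals through h.\<close>

lemma ex_matroid_lift:
  fixes S :: "('a \<Rightarrow> int) set"
  assumes fin: "finite E" and S: "finite S" "S \<subseteq> vecs E"
  obtains V :: "nat set" and \<phi> v where "finite V" "\<phi> ` V = E" "v \<in> vecs E"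
    "S \<subseteq> (\<lambda>y. push V \<phi> y + v) ` unit_box V"
proof -
  define K where "K = (\<Sum>x\<in>S. \<Sum>i\<in>E. \<bar>x i\<bar>)"
  have K: "\<bar>x i\<bar> \<le> K" if "x \<in> S" "i \<in> E" for x i
  proof -
    have "\<bar>x i\<bar> \<le> (\<Sum>i\<in>E. \<bar>x i\<bar>)" using that fin by (intro member_le_sum) auto
    also have "\<dots> \<le> K"
      unfolding K_def using that S by (intro member_le_sum[of x S "\<lambda>x. \<Sum>i\<in>E. \<bar>x i\<bar>"]) (auto intro: sum_nonneg)
    finally show ?thesis .
  qed
  have "0 \<le> K" unfolding K_def by (intro sum_nonneg) auto
  \<comment> \<open>The extra copy keeps every fibre nonempty when K is 0, so that \<phi> is
    onto.\<close>
  define W where "W = nat (2 * K) + 1"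
  have "finite (E \<times> {..<W})" using fin by simp
  then obtain h :: "nat \<Rightarrow> 'a \<times> nat" where h: "bij_betw h {0..<card (E \<times> {..<W})} (E \<times> {..<W})"
    using ex_bij_betw_nat_finite by blast
  define V where "V = {0..<card (E \<times> {..<W})}"
  define \<phi> where "\<phi> = fst \<circ> h"
  define v where "v i = (if i \<in> E then - K else 0)" for i
  note h = h[folded V_def]
  have "\<phi> ` V = fst ` (E \<times> {..<W})"
    unfolding \<phi>_def image_comp[symmetric] bij_betw_imp_surj_on[OF h] ..
  moreover have "W \<noteq> 0" by (simp add: W_def)
  ultimately have \<phi>V: "\<phi> ` V = E" by (simp add: lessThan_empty_iff bot_nat_def)
  have "S \<subseteq> (\<lambda>y. push V \<phi> y + v) ` unit_box V"
  proof
    fix x assume x: "x \<in> S"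
    define m where "m i = nat (x i + K)" for i
    define y where "y j = (if j \<in> V then of_bool (snd (h j) < m (\<phi> j)) else 0 :: int)" for j
    have "y \<in> unit_box V" by (auto simp: int_box_def y_def vecs_def)
    moreover have "x = push V \<phi> y + v"
    proof
      fix i
      show "x i = (push V \<phi> y + v) i"
      proof (cases "i \<in> E")
        case True
        have m: "int (m i) = x i + K" "m i \<le> W"
          using K[OF x True] by (auto simp: m_def W_def)
        have bij: "bij_betw h {j \<in> V. \<phi> j = i} ({i} \<times> {..<W})"
        proof (rule bij_betw_subset[OF h])
          show "h ` {j \<in> V. \<phi> j = i} = {i} \<times> {..<W}"
          proof (intro equalityI subsetI)
            fix t assume "t \<in> h ` {j \<in> V. \<phi> j = i}"
            then obtain j where "j \<in> V" "fst t = i" "t = h j" by (auto simp: \<phi>_def)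
            then show "t \<in> {i} \<times> {..<W}"
              using bij_betwE[OF h] by (metis mem_Times_iff singletonI)
          next
            fix t assume t: "t \<in> {i} \<times> {..<W}"
            then have "t \<in> h ` V" using True bij_betw_imp_surj_on[OF h] by auto
            then obtain j where "j \<in> V" "t = h j" by blast
            then show "t \<in> h ` {j \<in> V. \<phi> j = i}" using t by (intro image_eqI[of _ _ j]) (auto simp: \<phi>_def)
          qed
        qed auto
        have "push V \<phi> y i = (\<Sum>j\<in>{j \<in> V. \<phi> j = i}. of_bool (snd (h j) < m i))"
          unfolding push_def by (intro sum.cong) (auto simp: y_def)
        also have "\<dots> = (\<Sum>t\<in>{i} \<times> {..<W}. of_bool (snd t < m i))"
          by (rule sum.reindex_bij_betw[OF bij])
        also have "\<dots> = (\<Sum>s<W. of_bool (s < m i))"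
          by (rule sum.reindex_bij_witness[of _ "\<lambda>s. (i, s)" snd]) auto
        also have "\<dots> = int (card ({..<W} \<inter> {s. s < m i}))" by (simp add: Int_def)
        also have "{..<W} \<inter> {s. s < m i} = {..<m i}" using m(2) by auto
        finally show ?thesis using m(1) True by (simp add: v_def)
      next
        case False
        then have "{j \<in> V. \<phi> j = i} = {}" using \<phi>V by auto
        then have "push V \<phi> y i = 0" by (simp only: push_def sum.empty)
        moreover have "x i = 0" using x S False by (auto simp: vecs_def)
        ultimately show ?thesis using False by (simp add: v_def)
      qed
    qed
    ultimately show "x \<in> (\<lambda>y. push V \<phi> y + v) ` unit_box V" by blast
  qed
  moreover have "finite V" "v \<in> vecs E" by (simp_all add: V_def v_def vecs_def)
  ultimately show ?thesis using that \<phi>V by blast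
qed

text \<open>A single lift is enough, tested on preimages of subsets of E only; the translation
  contributes the same amount to both sides.\<close>

lemma compliant_if_lifts_quotient:
  assumes fin: "finite E" and P: "m_convex E P" and Q: "m_convex E Q"
    and lifts: "\<And>(V :: nat set) M N. finite V \<Longrightarrow> compatible_matroid_lifts E P Q V M N \<Longrightarrow> matroid_quotient V M N"
  shows "compliant E (submod Q) (submod P)"
proof -
  have PQ: "finite (P \<union> Q)" "P \<union> Q \<subseteq> vecs E" using P Q by (auto simp: m_convex_iff)
  obtain V :: "nat set" and \<phi> v where V: "finite V" "\<phi> ` V = E" "v \<in> vecs E"
    "P \<union> Q \<subseteq> (\<lambda>y. push V \<phi> y + v) ` unit_box V"
    by (rule ex_matroid_lift[OF fin PQ])
  define M where "M = box_lift V \<phi> v (unit_box V) P"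
  define N where "N = box_lift V \<phi> v (unit_box V) Q"
  have cover: "P \<subseteq> (\<lambda>y. push V \<phi> y + v) ` unit_box V" "Q \<subseteq> (\<lambda>y. push V \<phi> y + v) ` unit_box V"
    using V(4) by auto
  have sub: "M \<subseteq> unit_box V" "N \<subseteq> unit_box V" by (auto simp: M_def N_def box_lift_def)
  then have MN01: "M \<subseteq> {y. range y \<subseteq> {0, 1}}" "N \<subseteq> {y. range y \<subseteq> {0, 1}}"
    using unit_box_range by blast+
  have MN: "m_convex V M" "m_convex V N"
    unfolding M_def N_def
    by (rule m_convex_box_lift[OF V(1) P cover(1)], rule m_convex_box_lift[OF V(1) Q cover(2)])
  have "compatible_matroid_lifts E P Q V M N"
    unfolding compatible_matroid_lifts_def
    using MN MN01 V(2,3) sub cover M_def N_def by blast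
  then have "compliant V (submod N) (submod M)"
    using lifts[OF V(1)] matroid_quotient_iff_compliant[OF V(1) MN(1) MN01(1) MN(2) MN01(2)] by blast
  then show ?thesis
    unfolding compliant_def
  proof (intro allI impI)
    fix X Y
    assume compl: "\<forall>X Y. X \<subseteq> Y \<longrightarrow> Y \<subseteq> V \<longrightarrow> submod N Y - submod N X \<le> submod M Y - submod M X"
      and XY: "X \<subseteq> Y" "Y \<subseteq> E"
    have finXY: "finite X" "finite Y" using XY fin by (auto intro: finite_subset)
    have "submod N {j \<in> V. \<phi> j \<in> Y} - submod N {j \<in> V. \<phi> j \<in> X}
        \<le> submod M {j \<in> V. \<phi> j \<in> Y} - submod M {j \<in> V. \<phi> j \<in> X}"
      using XY by (intro compl[rule_format]) auto
    then show "submod Q Y - submod Q X \<le> submod P Y - submod P X"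
      unfolding M_def N_def submod_box_lift[OF V(1) P cover(1) finXY(1)] submod_box_lift[OF V(1) P cover(1) finXY(2)]
        submod_box_lift[OF V(1) Q cover(2) finXY(1)] submod_box_lift[OF V(1) Q cover(2) finXY(2)]
      by simp
  qed
qed

section \<open>Generalized permutohedra\<close>

lemma linear_le_on_convex_hull:
  fixes h :: "'a::real_vector \<Rightarrow> real"
  assumes "linear h" "\<And>w. w \<in> F \<Longrightarrow> h w \<le> m" "x \<in> convex hull F"
  shows "h x \<le> m"
proof -
  have "convex (h -` {..m})" using assms(1) by (rule convex_linear_vimage) simp
  then have "convex hull F \<subseteq> h -` {..m}" using assms(2) by (intro hull_minimal) auto
  then show ?thesis using assms(3) by auto
qed

text \<open>A convex combination of points of F attains m only if the points with h below m have
  weight zero, so the hull of the maximisers is the slice h = m. A segment whose interior meets that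
  slice lies in it, since h is at most m at both ends.\<close>

lemma argmax_face:
  fixes h :: "'a::real_vector \<Rightarrow> real"
  assumes lin: "linear h" and fin: "finite F" and max: "\<And>w. w \<in> F \<Longrightarrow> h w \<le> m"
  shows "convex hull {w \<in> F. h w = m} face_of convex hull F"
proof -
  let ?T = "{x \<in> convex hull F. h x = m}"
  have le: "h x \<le> m" if "x \<in> convex hull F" for x
    using max that by (rule linear_le_on_convex_hull[OF lin])
  have eq: "?T = convex hull {w \<in> F. h w = m}"
  proof (intro equalityI subsetI)
    fix x assume x: "x \<in> convex hull {w \<in> F. h w = m}"
    have "convex (h -` {m})" using lin by (rule convex_linear_vimage) simp
    then have "convex hull {w \<in> F. h w = m} \<subseteq> h -` {m}" by (intro hull_minimal) auto
    moreover have "convex hull {w \<in> F. h w = m} \<subseteq> convex hull F" by (intro hull_mono) auto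
    ultimately show "x \<in> ?T" using x by blast
  next
    fix x assume "x \<in> ?T"
    then have hx: "h x = m" and "x \<in> convex hull F" by auto
    then obtain u where u: "\<forall>w\<in>F. 0 \<le> u w" "sum u F = 1" "(\<Sum>w\<in>F. u w *\<^sub>R w) = x"
      unfolding convex_hull_finite[OF fin] by blast
    have "h x = (\<Sum>w\<in>F. u w * h w)"
      unfolding u(3)[symmetric] linear_sum[OF lin] by (simp add: linear_scale[OF lin])
    then have "(\<Sum>w\<in>F. u w * (m - h w)) = 0"
      using hx u(2) by (simp add: right_diff_distrib sum_subtractf flip: sum_distrib_right)
    moreover have "0 \<le> u w * (m - h w)" if "w \<in> F" for w
      using u(1) max[OF that] that by auto
    ultimately have "\<forall>w\<in>F. u w * (m - h w) = 0"
      using sum_nonneg_eq_0_iff[OF fin, of "\<lambda>w. u w * (m - h w)"] by blast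
    then have zero: "u w = 0" if "w \<in> F" "h w \<noteq> m" for w
      using that by force
    let ?F = "{w \<in> F. h w = m}"
    have "sum u ?F = 1" "(\<Sum>w\<in>?F. u w *\<^sub>R w) = x"
      using u(2,3) zero fin by (auto simp: sum.mono_neutral_left[of F ?F])
    then show "x \<in> convex hull ?F"
      unfolding convex_hull_finite[OF finite_subset[OF _ fin, of ?F, simplified]]
      using u(1) by blast
  qed
  show ?thesis
    unfolding face_of_def
  proof (intro conjI ballI impI convex_convex_hull)
    show "convex hull {w \<in> F. h w = m} \<subseteq> convex hull F" by (intro hull_mono) auto
    fix a b x
    assume ab: "a \<in> convex hull F" "b \<in> convex hull F" and x: "x \<in> convex hull {w \<in> F. h w = m}"
      and seg: "x \<in> open_segment a b"
    obtain u where u: "0 < u" "u < 1" "x = (1 - u) *\<^sub>R a + u *\<^sub>R b"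
      using seg unfolding in_segment by blast
    have "h x = (1 - u) * h a + u * h b"
      unfolding u(3) by (simp add: linear_add[OF lin] linear_scale[OF lin])
    moreover have "h x = m" using x unfolding eq[symmetric] by blast
    ultimately have "(1 - u) * (m - h a) + u * (m - h b) = 0" by (simp add: algebra_simps)
    moreover have "0 \<le> (1 - u) * (m - h a)" "0 \<le> u * (m - h b)"
      using le[OF ab(1)] le[OF ab(2)] u by simp_all
    ultimately have "(1 - u) * (m - h a) = 0" "u * (m - h b) = 0" by linarith+
    then have "h a = m" "h b = m" using u by simp_all
    then show "a \<in> convex hull {w \<in> F. h w = m}" "b \<in> convex hull {w \<in> F. h w = m}"
      using ab unfolding eq[symmetric] by simp_all
  qed
qed

lemma unique_argmax_extreme:
  fixes h :: "'a::real_vector \<Rightarrow> real"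
  assumes "linear h" "finite F" "z \<in> F" "\<And>w. w \<in> F \<Longrightarrow> w \<noteq> z \<Longrightarrow> h w < h z"
  shows "z extreme_point_of convex hull F"
proof -
  have "h w \<le> h z" if "w \<in> F" for w using assms(4)[OF that] by (cases "w = z") auto
  then have "convex hull {w \<in> F. h w = h z} face_of convex hull F"
    by (rule argmax_face[OF assms(1,2)])
  moreover have "{w \<in> F. h w = h z} = {z}" using assms(3,4) by force
  ultimately show ?thesis by (simp add: face_of_singleton)
qed

lemma scaleR_fun_apply [simp]: "(t *\<^sub>R f) i = t *\<^sub>R f i"
  by (simp add: scaleR_fun_def)

section \<open>Generic linear functionals\<close>

definition inner_on :: "'v set \<Rightarrow> ('v \<Rightarrow> real) \<Rightarrow> ('v \<Rightarrow> real) \<Rightarrow> real"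
  where "inner_on V c x = (\<Sum>i\<in>V. c i * x i)"

lemma inner_on_add: "inner_on V c (x + y) = inner_on V c x + inner_on V c y"
  and inner_on_diff: "inner_on V c (x - y) = inner_on V c x - inner_on V c y"
  and inner_on_scaleR: "inner_on V c (t *\<^sub>R x) = t * inner_on V c x"
  and inner_on_add_left: "inner_on V (c + d) x = inner_on V c x + inner_on V d x"
  and inner_on_scaleR_left: "inner_on V (t *\<^sub>R c) x = t * inner_on V c x"
  by (simp_all add: inner_on_def algebra_simps sum.distrib sum_subtractf sum_distrib_left)

lemma linear_inner_on: "linear (inner_on V c)"
  by (rule linearI) (simp_all add: inner_on_add inner_on_scaleR)

lemma sum_scaleR_fun: "sum (t *\<^sub>R x) A = t * sum x A"
  for x :: "'v \<Rightarrow> real"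
  by (simp add: sum_distrib_left)

lemma linear_sum_fun: "linear (\<lambda>x :: 'v \<Rightarrow> real. sum x A)"
  by (rule linearI) (simp_all only: sum_fun_add sum_scaleR_fun real_scaleR_def)

lemma inner_on_unit_vec: "finite V \<Longrightarrow> i \<in> V \<Longrightarrow> inner_on V c (unit_vec i) = c i"
proof -
  assume "finite V" "i \<in> V"
  have "inner_on V c (unit_vec i) = (\<Sum>k\<in>V. if k = i then c k else 0)"
    unfolding inner_on_def by (intro sum.cong) (auto simp: unit_vec_apply)
  then show ?thesis using \<open>finite V\<close> \<open>i \<in> V\<close> by simp
qed

lemma inner_on_self_pos:
  assumes "finite V" "x \<in> vecs V" "x \<noteq> 0"
  shows "0 < inner_on V x x"
proof -
  obtain i where i: "x i \<noteq> 0" using assms(3) by (auto simp: fun_eq_iff)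
  then have "i \<in> V" using assms(2) by (auto simp: vecs_def)
  then show ?thesis
    unfolding inner_on_def using i assms(1) by (intro sum_pos2[of V i]) (auto simp: zero_less_mult_iff)
qed

text \<open>Induct on U and perturb c along the new vector u itself. For each nonzero w the value at
  w vanishes for at most one t: if w is orthogonal to u then w is not u, and c is already nonzero on
  it. Finitely many excluded t leave arbitrarily small ones.\<close>

lemma generic_functional:
  assumes fin: "finite V" and "finite U" and "\<And>u. u \<in> U \<Longrightarrow> u \<in> vecs V" and "e > 0"
  shows "\<exists>c. (\<forall>i. \<bar>c i - c0 i\<bar> < e) \<and> (\<forall>u\<in>U. u \<noteq> 0 \<longrightarrow> inner_on V c u \<noteq> 0)"
  using assms(2-)
proof (induction U arbitrary: e rule: finite_induct)
  case empty
  then show ?case by (intro exI[of _ c0]) simp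
next
  case (insert u U)
  have "\<exists>c. (\<forall>i. \<bar>c i - c0 i\<bar> < e / 2) \<and> (\<forall>u\<in>U. u \<noteq> 0 \<longrightarrow> inner_on V c u \<noteq> 0)"
    by (rule insert.IH) (use insert.prems in auto)
  then obtain c where c: "\<And>i. \<bar>c i - c0 i\<bar> < e / 2" "\<And>w. w \<in> U \<Longrightarrow> w \<noteq> 0 \<Longrightarrow> inner_on V c w \<noteq> 0"
    by blast
  show ?case
  proof (cases "u = 0")
    case True
    have "\<bar>c i - c0 i\<bar> < e" for i using c(1)[of i] insert.prems(2) by linarith
    then show ?thesis using c(2) True by blast
  next
    case False
    \<comment> \<open>A positive strict bound on the entries of u; a t below
      \<open>e / (2 * S)\<close> moves each coordinate by less than \<open>e / 2\<close>.\<close>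
    define S where "S = (\<Sum>i\<in>V. \<bar>u i\<bar>) + 1"
    have S: "\<bar>u i\<bar> < S" "S > 0" for i
    proof -
      have "0 \<le> (\<Sum>i\<in>V. \<bar>u i\<bar>)" by (intro sum_nonneg) auto
      then show "S > 0" unfolding S_def by linarith
      show "\<bar>u i\<bar> < S"
      proof (cases "i \<in> V")
        case True
        then have "\<bar>u i\<bar> \<le> (\<Sum>i\<in>V. \<bar>u i\<bar>)" using fin by (intro member_le_sum) auto
        then show ?thesis unfolding S_def by linarith
      next
        case False
        then have "u i = 0" using insert.prems(1)[of u] by (simp add: vecs_def)
        then show ?thesis using \<open>S > 0\<close> by simp
      qed
    qed
    define bad where "bad w = {t. inner_on V c w + t * inner_on V u w = 0}" for w
    have "finite (bad w)" if w: "w \<in> insert u U" "w \<noteq> 0" for w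
    proof (cases "inner_on V u w = 0")
      case True
      have "w \<noteq> u" using True inner_on_self_pos[OF fin, of u] False insert.prems(1)[of u] by auto
      then have "inner_on V c w \<noteq> 0" using c(2) w by auto
      then show ?thesis using True by (simp add: bad_def)
    next
      case False
      have "bad w \<subseteq> {- inner_on V c w / inner_on V u w}"
        using False by (auto simp: bad_def field_simps)
      then show ?thesis by (rule finite_subset) simp
    qed
    then have "finite (\<Union>w\<in>insert u U - {0}. bad w)"
      using insert.hyps(1) by (intro finite_UN_I) auto
    moreover have "infinite {0<..<e / (2 * S)}"
      using insert.prems(2) S(2) by (intro infinite_Ioo) simp
    ultimately have "infinite ({0<..<e / (2 * S)} - (\<Union>w\<in>insert u U - {0}. bad w))"
      by (rule Diff_infinite_finite)
    then obtain t where t: "t \<in> {0<..<e / (2 * S)}" "t \<notin> (\<Union>w\<in>insert u U - {0}. bad w)"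
      by (metis DiffE ex_in_conv finite.emptyI)
    have "t * S < e / 2" using t(1) S(2) by (simp add: field_simps)
    have "\<bar>(c + t *\<^sub>R u) i - c0 i\<bar> < e" for i
    proof -
      have "\<bar>t * u i\<bar> \<le> t * S" using t(1) S(1)[of i] by (auto simp: abs_mult intro!: mult_left_mono)
      moreover have "(c + t *\<^sub>R u) i - c0 i = (c i - c0 i) + t * u i" by simp
      ultimately show ?thesis using c(1)[of i] \<open>t * S < e / 2\<close> by linarith
    qed
    moreover have "inner_on V (c + t *\<^sub>R u) w \<noteq> 0" if "w \<in> insert u U" "w \<noteq> 0" for w
      using t(2) that by (auto simp: bad_def inner_on_add_left inner_on_scaleR_left)
    ultimately show ?thesis by blast
  qed
qed

text \<open>The coefficients are the gains in x(A), crossed. A functional vanishes on this vector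
  exactly when its changes from z to w and to w' are proportional to these gains, whereas for
  nonzero gains the vector itself vanishes only if w and w' lie on one line through z. Genericity
  turns the first into the second.\<close>

definition cross :: "'v set \<Rightarrow> ('v \<Rightarrow> real) \<Rightarrow> ('v \<Rightarrow> real) \<Rightarrow> ('v \<Rightarrow> real) \<Rightarrow> 'v \<Rightarrow> real"
  where "cross A z w w' = (sum w A - sum z A) *\<^sub>R (w' - z) - (sum w' A - sum z A) *\<^sub>R (w - z)"

text \<open>
  The vertices joined to \<open>z\<close> by an edge are found by maximising the ratio of the gain in \<open>x(A)\<close> to
  the loss in a generic functional \<open>g\<close>; by genericity the maximisers lie on one ray from \<open>z\<close>.
\<close>

lemma generalized_permutohedron_upper_set_max:
  assumes finV: "finite V" and fin: "finite F" and GP: "generalized_permutohedron V (convex hull F)"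
    and z: "z \<in> F" and zmax: "\<And>w. w \<in> F \<Longrightarrow> w \<noteq> z \<Longrightarrow> inner_on V c w < inner_on V c z"
    and A: "A \<subseteq> V" and upper: "\<And>i j. j \<in> A \<Longrightarrow> i \<in> V - A \<Longrightarrow> c i < c j"
    and generic: "\<And>w w'. w \<in> F \<Longrightarrow> w' \<in> F \<Longrightarrow>
      cross A z w w' \<noteq> 0 \<Longrightarrow>
      inner_on V c (cross A z w w') \<noteq> 0"
    and "w0 \<in> F"
  shows "sum w0 A \<le> sum z A"
proof (rule ccontr)
  assume neg: "\<not> ?thesis"
  define g where "g = inner_on V c"
  have finA: "finite A" using A finV by (rule finite_subset)
  let ?f = "\<lambda>x :: 'a \<Rightarrow> real. sum x A"
  define D where "D w = (?f w - ?f z) / (g z - g w)" for w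
  have F': "finite (F - {z})" "w0 \<in> F - {z}" using fin neg \<open>w0 \<in> F\<close> by auto
  obtain w1 where w1: "w1 \<in> F - {z}" "\<And>w. w \<in> F - {z} \<Longrightarrow> D w \<le> D w1"
    using finite_has_maximizer[of "F - {z}" D] F' by blast
  define l where "l = D w1"
  have gz: "g w < g z" if "w \<in> F - {z}" for w using zmax that by (auto simp: g_def)
  have "0 < D w0" using neg gz[OF F'(2)] by (simp add: D_def)
  then have l: "0 < l" using w1(2)[OF F'(2)] by (simp add: l_def)
  \<comment> \<open>With the largest ratio l as multiplier, h is maximal over F at z and takes the
    same value elsewhere exactly at the points of ratio l.\<close>
  define h where "h x = ?f x + l * g x" for x
  have "linear h"
  proof (rule linearI)
    show "h (x + y) = h x + h y" for x y
      unfolding h_def g_def sum_fun_add inner_on_add by (simp add: algebra_simps)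
    show "h (t *\<^sub>R x) = t *\<^sub>R h x" for t x
      unfolding h_def g_def sum_scaleR_fun inner_on_scaleR by (simp add: algebra_simps)
  qed
  have h_max: "h w \<le> h z" if "w \<in> F" for w
  proof (cases "w = z")
    case False
    then have w: "w \<in> F - {z}" using that by simp
    have "?f w - ?f z = D w * (g z - g w)" using gz[OF w] by (simp add: D_def)
    also have "\<dots> \<le> l * (g z - g w)"
      using w1(2)[OF w] gz[OF w] by (intro mult_right_mono) (auto simp: l_def)
    finally show ?thesis by (simp add: h_def algebra_simps)
  qed simp
  define F0 where "F0 = {w \<in> F. h w = h z}"
  have face: "convex hull F0 face_of convex hull F"
    unfolding F0_def by (rule argmax_face[OF \<open>linear h\<close> fin h_max])
  have F0: "?f w - ?f z = l * (g z - g w)" if "w \<in> F0" for w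
    using that by (simp add: F0_def h_def algebra_simps)
  have "w1 \<in> F0" using w1(1) gz[OF w1(1)] by (simp add: F0_def h_def l_def D_def field_simps)
  have "finite F0" using fin by (simp add: F0_def)
  obtain ws where ws: "ws \<in> F0" "\<And>w. w \<in> F0 \<Longrightarrow> ?f w \<le> ?f ws"
    using finite_has_maximizer[of F0 ?f] \<open>finite F0\<close> \<open>w1 \<in> F0\<close> by blast
  have "0 < ?f w1 - ?f z" unfolding F0[OF \<open>w1 \<in> F0\<close>] using l gz[OF w1(1)] by simp
  then have ws_pos: "0 < ?f ws - ?f z" using ws(2)[OF \<open>w1 \<in> F0\<close>] by simp
  \<comment> \<open>On F0 gain and loss are proportional, so g vanishes on the cross vector;
    genericity makes that vector zero, and all of F0 lies between z and the point of largest
    gain.\<close>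
  have on_seg: "w \<in> closed_segment z ws" if w: "w \<in> F0" for w
  proof -
    define u where "u = cross A z w ws"
    have "g u = (?f w - ?f z) * (g ws - g z) - (?f ws - ?f z) * (g w - g z)"
      unfolding u_def cross_def g_def by (simp only: inner_on_diff inner_on_scaleR)
    also have "\<dots> = 0" unfolding F0[OF w] F0[OF ws(1)] by (simp add: algebra_simps)
    finally have "g u = 0" .
    then have "u = 0"
      using generic[of w ws] w ws(1) unfolding u_def g_def F0_def by blast
    define t where "t = (?f w - ?f z) / (?f ws - ?f z)"
    have "0 \<le> ?f w - ?f z"
      unfolding F0[OF w] using l gz[of w] w by (cases "w = z") (auto simp: F0_def)
    then have t: "0 \<le> t" "t \<le> 1" using ws_pos ws(2)[OF w] by (simp_all add: t_def)
    have "(?f ws - ?f z) *\<^sub>R (w - z) = (?f w - ?f z) *\<^sub>R (ws - z)"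
      using \<open>u = 0\<close> unfolding u_def cross_def by simp
    then have "w - z = inverse (?f ws - ?f z) *\<^sub>R ((?f w - ?f z) *\<^sub>R (ws - z))"
      using ws_pos by (metis less_numeral_extra(3) scaleR_one scaleR_scaleR left_inverse)
    then have "w - z = t *\<^sub>R (ws - z)" by (simp add: t_def divide_inverse mult.commute)
    then have "w = (1 - t) *\<^sub>R z + t *\<^sub>R ws" by (simp add: algebra_simps)
    then show ?thesis using t unfolding in_segment by blast
  qed
  have "z \<in> F0" using z by (simp add: F0_def)
  have "convex hull F0 = closed_segment z ws"
  proof
    show "convex hull F0 \<subseteq> closed_segment z ws" using on_seg by (intro hull_minimal) auto
    show "closed_segment z ws \<subseteq> convex hull F0"
      unfolding segment_convex_hull using \<open>z \<in> F0\<close> ws(1) by (intro hull_mono) auto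
  qed
  then have "closed_segment z ws face_of convex hull F" using face by simp
  moreover have "z \<noteq> ws" using ws_pos by auto
  ultimately obtain i j t where ij: "i \<in> V" "j \<in> V" "ws - z = t *\<^sub>R (unit_vec i - unit_vec j)"
    using GP unfolding generalized_permutohedron_def by blast
  \<comment> \<open>The edge from z to ws gains on A, so it moves weight from outside A into A,
    where c is larger; but z is the maximiser for c.\<close>
  have "?f ws - ?f z = t * (of_bool (i \<in> A) - of_bool (j \<in> A))"
    unfolding sum_fun_diff[symmetric] ij(3) sum_scaleR_fun
    unfolding sum_fun_diff sum_unit_vec[OF finA] ..
  note fws = this
  have gws: "g ws - g z = t * (c i - c j)"
    unfolding g_def inner_on_diff[symmetric] ij(3) inner_on_scaleR
    unfolding inner_on_diff using ij(1,2) finV by (simp add: inner_on_unit_vec)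
  have "g ws < g z" using gz[of ws] ws(1) \<open>z \<noteq> ws\<close> by (auto simp: F0_def)
  then have neg: "t * (c i - c j) < 0" using gws by simp
  have pos: "0 < t * (of_bool (i \<in> A) - of_bool (j \<in> A))" using ws_pos fws by simp
  show False
  proof (cases "i \<in> A")
    case True
    then have "j \<notin> A" "0 < t" using pos by (auto simp: of_bool_def split: if_splits)
    then show False using neg upper[of i j] True ij(2) by (auto simp: mult_less_0_iff)
  next
    case False
    then have "j \<in> A" "t < 0" using pos by (auto simp: of_bool_def split: if_splits)
    then show False using neg upper[of j i] False ij(1) by (auto simp: mult_less_0_iff)
  qed
qed

text \<open>Perturb the weight with value 2 on X, 1 on Y - X and 0 elsewhere by less than 1/2: X and
  Y stay upper level sets, and genericity makes the maximiser unique and hence extreme.\<close>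

lemma generalized_permutohedron_chain:
  assumes finV: "finite V" and GP: "generalized_permutohedron V S" and "S \<noteq> {}"
    and XY: "X \<subseteq> Y" "Y \<subseteq> V"
  obtains z where "z extreme_point_of S" "\<And>w. w \<in> S \<Longrightarrow> sum w X \<le> sum z X" "\<And>w. w \<in> S \<Longrightarrow> sum w Y \<le> sum z Y"
proof -
  have S: "polytope S" "S \<subseteq> vecs V" using GP by (simp_all add: generalized_permutohedron_def)
  obtain F where F: "finite F" "S = convex hull F"
    using S(1) unfolding polytope_def by blast
  have "F \<noteq> {}"
  proof
    assume "F = {}"
    then have "S = {}" unfolding F(2) by simp
    then show False using \<open>S \<noteq> {}\<close> by simp
  qed
  have "F \<subseteq> S" unfolding F(2) by (rule hull_subset)
  then have FV: "w \<in> vecs V" if "w \<in> F" for w using S(2) that by blast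
  \<comment> \<open>All z are included because the maximiser is known only after c has been
    chosen.\<close>
  define K where "K A = (\<lambda>(w, w', z). cross A z w w') ` (F \<times> F \<times> F)" for A
  define U where "U = (\<lambda>(w, w'). w - w') ` (F \<times> F) \<union> K X \<union> K Y"
  have "finite U" using F(1) by (simp add: U_def K_def)
  have comb: "a *\<^sub>R (w - z) - b *\<^sub>R (w' - z) \<in> vecs V" "w - z \<in> vecs V" if "w \<in> F" "w' \<in> F" "z \<in> F" for a b w w' z
    using FV[OF that(1)] FV[OF that(2)] FV[OF that(3)] by (simp_all add: vecs_def)
  have "u \<in> vecs V" if "u \<in> U" for u
    using that comb unfolding U_def K_def cross_def by fast
  from generic_functional[OF finV \<open>finite U\<close> this, of "1/2" "\<lambda>i. of_bool (i \<in> X) + of_bool (i \<in> Y)"]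
  obtain c where c: "\<And>i. \<bar>c i - (of_bool (i \<in> X) + of_bool (i \<in> Y))\<bar> < 1/2"
    "\<And>u. u \<in> U \<Longrightarrow> u \<noteq> 0 \<Longrightarrow> inner_on V c u \<noteq> 0"
    by auto
  obtain z where z: "z \<in> F" "\<And>w. w \<in> F \<Longrightarrow> inner_on V c w \<le> inner_on V c z"
    using finite_has_maximizer[OF F(1) \<open>F \<noteq> {}\<close>] by blast
  have zmax: "inner_on V c w < inner_on V c z" if "w \<in> F" "w \<noteq> z" for w
  proof -
    have "w - z \<in> U" using that z(1) by (auto simp: U_def)
    then have "inner_on V c (w - z) \<noteq> 0" using c(2)[of "w - z"] that(2) by simp
    then show ?thesis using z(2)[OF that(1)] by (simp add: inner_on_diff)
  qed
  have ext: "z extreme_point_of S"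
    unfolding F(2)
    by (rule unique_argmax_extreme[where h = "inner_on V c", OF linear_inner_on F(1) z(1)]) (rule zmax)
  have max: "sum w A \<le> sum z A" if A: "A = X \<or> A = Y" and w: "w \<in> F" for A w
  proof (rule generalized_permutohedron_upper_set_max[OF finV F(1) GP[unfolded F(2)] z(1) zmax _ _ _ w])
    show "A \<subseteq> V" using A XY by auto
    fix i j assume ij: "j \<in> A" "i \<in> V - A"
    show "c i < c j"
      using A
    proof
      assume "A = X"
      then have "of_bool (i \<in> X) + of_bool (i \<in> Y) \<le> (1 :: real)"
        "of_bool (j \<in> X) + of_bool (j \<in> Y) = (2 :: real)"
        using ij XY by auto
      then show ?thesis using c(1)[of i] c(1)[of j] by linarith
    next
      assume "A = Y"
      then have "of_bool (i \<in> X) + of_bool (i \<in> Y) = (0 :: real)"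
        "of_bool (j \<in> X) + of_bool (j \<in> Y) \<ge> (1 :: real)"
        using ij XY by auto
      then show ?thesis using c(1)[of i] c(1)[of j] by linarith
    qed
  next
    fix w w' assume w: "w \<in> F" "w' \<in> F"
      and nz: "cross A z w w' \<noteq> 0"
    have "cross A z w w' \<in> K A"
      unfolding K_def using w z(1) by (intro image_eqI[of _ _ "(w, w', z)"]) auto
    then show "inner_on V c (cross A z w w') \<noteq> 0"
      using A nz by (intro c(2)) (auto simp: U_def)
  qed auto
  have "sum w A \<le> sum z A" if "A = X \<or> A = Y" "w \<in> S" for A w
    using max[OF that(1)] that(2) unfolding F(2) by (rule linear_le_on_convex_hull[OF linear_sum_fun])
  then show ?thesis using that ext by blast
qed

text \<open>The point a + b is the midpoint of a' + b and a + b', which also lie in S + T and differ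
  unless a' = a. So an exchange between summands that keeps their sum is impossible at an extreme
  point.\<close>

lemma extreme_point_plus_unique:
  fixes a :: "'a::real_vector"
  assumes ext: "a + b extreme_point_of (S + T)" and "a \<in> S" "b \<in> T" "a' \<in> S" "b' \<in> T" "a' + b' = a + b"
  shows "a' = a"
proof (rule ccontr)
  assume ne: "a' \<noteq> a"
  have 1: "a' + b \<in> S + T" "a + b' \<in> S + T" using assms by (auto intro: set_plus_intro)
  have "b' = a + b - a'" using assms(6) by (simp add: algebra_simps)
  then have ab': "a + b' = 2 *\<^sub>R a + b - a'" by (simp add: scaleR_2 algebra_simps)
  have "a' + b \<noteq> a + b'"
  proof
    assume "a' + b = a + b'"
    then have "2 *\<^sub>R a' = 2 *\<^sub>R a" unfolding ab' by (simp add: scaleR_2 algebra_simps)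
    then show False using ne by simp
  qed
  moreover have "a + b = (1 - 1/2) *\<^sub>R (a' + b) + (1/2 :: real) *\<^sub>R (a + b')"
  proof -
    have "2 *\<^sub>R (a + b) = (a' + b) + (a + b')" unfolding ab' by (simp add: scaleR_2 algebra_simps)
    then have "(1/2 :: real) *\<^sub>R (2 *\<^sub>R (a + b)) = (1/2 :: real) *\<^sub>R ((a' + b) + (a + b'))" by simp
    then show ?thesis by (simp add: scaleR_right_distrib)
  qed
  ultimately have "a + b \<in> open_segment (a' + b) (a + b')"
    unfolding in_segment by (intro conjI exI[of _ "1/2"]) auto
  then show False using ext 1 unfolding extreme_point_of_def by blast
qed

lemma extreme_point_plus_left:
  fixes a :: "'a::real_vector"
  assumes ext: "a + b extreme_point_of (S + T)" and "a \<in> S" "b \<in> T"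
  shows "a extreme_point_of S"
  unfolding extreme_point_of_def
proof (intro conjI ballI assms(2) notI)
  fix p q assume pq: "p \<in> S" "q \<in> S" "a \<in> open_segment p q"
  obtain u where u: "p \<noteq> q" "0 < u" "u < 1" "a = (1 - u) *\<^sub>R p + u *\<^sub>R q"
    using pq(3) unfolding in_segment by blast
  have "a + b = (1 - u) *\<^sub>R (p + b) + u *\<^sub>R (q + b)"
    unfolding u(4) by (simp add: algebra_simps)
  then have "a + b \<in> open_segment (p + b) (q + b)"
    unfolding in_segment using u(1-3) by auto
  moreover have "p + b \<in> S + T" "q + b \<in> S + T" using pq assms(3) by (auto intro: set_plus_intro)
  ultimately show False using ext unfolding extreme_point_of_def by blast
qed

section \<open>Flags of hypersimplices\<close>

definition hypersimplex_vertices :: "'v set \<Rightarrow> int \<Rightarrow> ('v \<Rightarrow> real) set"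
  where "hypersimplex_vertices V m =
    {x \<in> vecs V. (\<forall>j\<in>V. x j = 0 \<or> x j = 1) \<and> sum x V = real_of_int m}"

lemma hypersimplex_eq: "hypersimplex V m = convex hull (hypersimplex_vertices V m)"
  by (simp add: hypersimplex_def hypersimplex_vertices_def)

lemma eq_if_le_and_sum_eq:
  fixes x y :: "'v \<Rightarrow> real"
  assumes "finite V" "x \<in> vecs V" "y \<in> vecs V" "\<And>i. i \<in> V \<Longrightarrow> x i \<le> y i" "sum x V = sum y V"
  shows "x = y"
proof
  fix i
  show "x i = y i"
  proof (cases "i \<in> V")
    case True
    show ?thesis
    proof (rule ccontr)
      assume "x i \<noteq> y i"
      then have "x i < y i" using assms(4)[OF True] by simp
      then have "sum x V < sum y V" using assms(1,4) True by (intro sum_strict_mono_ex1) auto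
      then show False using assms(5) by simp
    qed
  next
    case False
    then show ?thesis using assms(2,3) by (simp add: vecs_def)
  qed
qed

lemma linear_apply: "linear (\<lambda>x :: 'v \<Rightarrow> real. x i)"
  by (rule linearI) simp_all

lemma hypersimplex_bounds:
  assumes x: "x \<in> hypersimplex V m"
  shows "x \<in> vecs V" "i \<in> V \<Longrightarrow> 0 \<le> x i" "i \<in> V \<Longrightarrow> x i \<le> 1" "sum x V = real_of_int m"
proof -
  note x = x[unfolded hypersimplex_eq]
  have "x j = 0" if "j \<notin> V" for j
  proof -
    have "x j \<le> 0"
      by (rule linear_le_on_convex_hull[OF linear_apply _ x])
        (use that in \<open>simp add: hypersimplex_vertices_def vecs_def\<close>)
    moreover have "- x j \<le> 0"
      by (rule linear_le_on_convex_hull[OF linear_compose_neg[OF linear_apply] _ x])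
        (use that in \<open>simp add: hypersimplex_vertices_def vecs_def\<close>)
    ultimately show ?thesis by simp
  qed
  then show "x \<in> vecs V" by (simp add: vecs_def)
  show "0 \<le> x i" if "i \<in> V"
  proof -
    have "- x i \<le> 0"
      by (rule linear_le_on_convex_hull[OF linear_compose_neg[OF linear_apply] _ x])
        (use that in \<open>auto simp: hypersimplex_vertices_def\<close>)
    then show ?thesis by simp
  qed
  show "x i \<le> 1" if "i \<in> V"
    by (rule linear_le_on_convex_hull[OF linear_apply _ x])
      (use that in \<open>auto simp: hypersimplex_vertices_def\<close>)
  have "sum x V \<le> real_of_int m"
    by (rule linear_le_on_convex_hull[OF linear_sum_fun _ x]) (simp add: hypersimplex_vertices_def)
  moreover have "- sum x V \<le> - real_of_int m"
    by (rule linear_le_on_convex_hull[OF linear_compose_neg[OF linear_sum_fun] _ x])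
      (simp add: hypersimplex_vertices_def)
  ultimately show "sum x V = real_of_int m" by simp
qed

lemma hypersimplex_vertices_exchange:
  assumes fin: "finite V" and x: "x \<in> hypersimplex_vertices V m"
    and ij: "i \<in> V" "j \<in> V" "x i = 1" "x j = 0"
  shows "lower x i j \<in> hypersimplex_vertices V m"
  unfolding hypersimplex_vertices_def mem_Collect_eq
proof (intro conjI ballI)
  have x': "x \<in> vecs V" "\<And>k. k \<in> V \<Longrightarrow> x k = 0 \<or> x k = 1" "sum x V = real_of_int m"
    using x by (auto simp: hypersimplex_vertices_def)
  show "lower x i j \<in> vecs V" using x'(1) ij by (auto simp: vecs_def unit_vec_apply)
  show "sum (lower x i j) V = real_of_int m"
    unfolding sum_exchange(1)[OF fin] using x'(3) ij by simp
  show "(lower x i j) k = 0 \<or> (lower x i j) k = 1" if "k \<in> V" for k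
    using x'(2)[OF that] ij by (auto simp: unit_vec_apply)
qed

text \<open>If x1 were 1 and x2 were 0 at i, then r1 <= r2 would provide a j with the opposite
  values, and swapping i and j in both vertices would give another decomposition of the same sum,
  which an extreme point does not admit.\<close>

lemma extreme_point_hypersimplex_plus:
  assumes fin: "finite V" and r: "r1 \<le> r2"
    and x1: "x1 \<in> hypersimplex V r1" and x2: "x2 \<in> hypersimplex V r2"
    and ext: "x1 + x2 extreme_point_of (hypersimplex V r1 + hypersimplex V r2)"
  shows "x1 \<in> hypersimplex_vertices V r1" "x2 \<in> hypersimplex_vertices V r2" "i \<in> V \<Longrightarrow> x1 i \<le> x2 i"
proof -
  have "x1 extreme_point_of hypersimplex V r1"
    by (rule extreme_point_plus_left[OF ext x1 x2])
  then show v1: "x1 \<in> hypersimplex_vertices V r1"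
    unfolding hypersimplex_eq by (rule extreme_point_of_convex_hull)
  have ext': "x2 + x1 extreme_point_of (hypersimplex V r2 + hypersimplex V r1)"
    using ext by (simp add: add.commute)
  have "x2 extreme_point_of hypersimplex V r2"
    by (rule extreme_point_plus_left[OF ext' x2 x1])
  then show v2: "x2 \<in> hypersimplex_vertices V r2"
    unfolding hypersimplex_eq by (rule extreme_point_of_convex_hull)
  have vals: "x1 k = 0 \<or> x1 k = 1" "x2 k = 0 \<or> x2 k = 1" if "k \<in> V" for k
    using v1 v2 that by (auto simp: hypersimplex_vertices_def)
  have vecs: "x1 \<in> vecs V" "x2 \<in> vecs V" and sums: "sum x1 V = r1" "sum x2 V = r2"
    using v1 v2 by (auto simp: hypersimplex_vertices_def)
  show "x1 i \<le> x2 i" if i: "i \<in> V"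
  proof (rule ccontr)
    assume neg: "\<not> x1 i \<le> x2 i"
    then have xi: "x1 i = 1" "x2 i = 0" using vals[OF i] by auto
    have "\<exists>j\<in>V. x1 j < x2 j"
    proof (rule ccontr)
      assume "\<not> ?thesis"
      then have "sum x2 V < sum x1 V"
        using fin neg i by (intro sum_strict_mono_ex1) (auto simp: not_less not_le)
      then show False using sums r by simp
    qed
    then obtain j where j: "j \<in> V" "x1 j < x2 j" by blast
    then have xj: "x1 j = 0" "x2 j = 1" using vals[OF j(1)] by auto
    have "i \<noteq> j" using xi xj by auto
    have 1: "lower x1 i j \<in> hypersimplex V r1"
      unfolding hypersimplex_eq
      by (rule hull_inc[OF hypersimplex_vertices_exchange[OF fin v1 i j(1) xi(1) xj(1)]])
    have 2: "lower x2 j i \<in> hypersimplex V r2"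
      unfolding hypersimplex_eq
      by (rule hull_inc[OF hypersimplex_vertices_exchange[OF fin v2 j(1) i xj(2) xi(2)]])
    have "lower x1 i j = x1"
      by (rule extreme_point_plus_unique[OF ext x1 x2 1 2]) (simp add: algebra_simps)
    then have "(lower x1 i j) i = x1 i" by simp
    then show False using \<open>i \<noteq> j\<close> by (simp add: unit_vec_apply)
  qed
qed

text \<open>
  Conversely a sum of nested vertices is recovered from its coordinates 2 and 0, which any point
  of an open segment passes on to both ends.
\<close>

lemma nested_extreme_point_hypersimplex_plus:
  assumes fin: "finite V" and y1: "y1 \<in> hypersimplex_vertices V r1" and y2: "y2 \<in> hypersimplex_vertices V r2"
    and le: "\<And>i. i \<in> V \<Longrightarrow> y1 i \<le> y2 i"
  shows "y1 + y2 extreme_point_of (hypersimplex V r1 + hypersimplex V r2)"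
proof -
  define z where "z = y1 + y2"
  have vals: "y1 k = 0 \<or> y1 k = 1" "y2 k = 0 \<or> y2 k = 1" if "k \<in> V" for k
    using y1 y2 that by (auto simp: hypersimplex_vertices_def)
  have vecs: "y1 \<in> vecs V" "y2 \<in> vecs V" and sums: "sum y1 V = r1" "sum y2 V = r2"
    using y1 y2 by (auto simp: hypersimplex_vertices_def)
  have bounds: "0 \<le> a i \<and> a i \<le> 2" if a: "a \<in> hypersimplex V r1 + hypersimplex V r2" and "i \<in> V" for a i
  proof -
    obtain a1 a2 where "a1 \<in> hypersimplex V r1" "a2 \<in> hypersimplex V r2" "a = a1 + a2"
      using a by (auto elim: set_plus_elim)
    then show ?thesis
      using hypersimplex_bounds(2,3)[of a1 V r1 i] hypersimplex_bounds(2,3)[of a2 V r2 i] that(2) by simp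
  qed
  \<comment> \<open>Where z is 2 both summands of a must be 1, which gives y1 <= u1; where z is 0
    both must be 0, which gives u2 <= y2. Equal coordinate sums turn both into equalities.\<close>
  have determined: "a = z"
    if a: "a \<in> hypersimplex V r1 + hypersimplex V r2"
      and a2: "\<And>i. i \<in> V \<Longrightarrow> z i = 2 \<Longrightarrow> a i = 2" and a0: "\<And>i. i \<in> V \<Longrightarrow> z i = 0 \<Longrightarrow> a i = 0" for a
  proof -
    obtain u1 u2 where u: "u1 \<in> hypersimplex V r1" "u2 \<in> hypersimplex V r2" "a = u1 + u2"
      using a by (auto elim: set_plus_elim)
    note b1 = hypersimplex_bounds[OF u(1)] and b2 = hypersimplex_bounds[OF u(2)]
    have "y1 = u1"
    proof (rule eq_if_le_and_sum_eq[OF fin vecs(1) b1(1)])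
      show "sum y1 V = sum u1 V" using sums b1(4) by simp
      show "y1 i \<le> u1 i" if i: "i \<in> V" for i
      proof (cases "y1 i = 1")
        case True
        then have "z i = 2" using le[OF i] vals[OF i] by (auto simp: z_def)
        then have "u1 i + u2 i = 2" using a2[OF i] u(3) by simp
        then show ?thesis using b1(3)[OF i] b2(3)[OF i] True by simp
      next
        case False
        then show ?thesis using vals[OF i] b1(2)[OF i] by simp
      qed
    qed
    moreover have "u2 = y2"
    proof (rule eq_if_le_and_sum_eq[OF fin b2(1) vecs(2)])
      show "sum u2 V = sum y2 V" using sums b2(4) by simp
      show "u2 i \<le> y2 i" if i: "i \<in> V" for i
      proof (cases "y2 i = 0")
        case True
        then have "z i = 0" using le[OF i] vals[OF i] by (auto simp: z_def)
        then have "u1 i + u2 i = 0" using a0[OF i] u(3) by simp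
        then show ?thesis using b1(2)[OF i] b2(2)[OF i] True by simp
      next
        case False
        then show ?thesis using vals[OF i] b2(3)[OF i] by simp
      qed
    qed
    ultimately show ?thesis by (simp add: u(3) z_def)
  qed
  show ?thesis
    unfolding extreme_point_of_def z_def[symmetric]
  proof (intro conjI ballI notI)
    show "z \<in> hypersimplex V r1 + hypersimplex V r2"
      unfolding z_def hypersimplex_eq using y1 y2 by (intro set_plus_intro hull_inc)
    fix a b assume a: "a \<in> hypersimplex V r1 + hypersimplex V r2"
      and b: "b \<in> hypersimplex V r1 + hypersimplex V r2" and seg: "z \<in> open_segment a b"
    obtain t where t: "a \<noteq> b" "0 < t" "t < 1" "z = (1 - t) *\<^sub>R a + t *\<^sub>R b"
      using seg unfolding in_segment by blast
    have zi: "z i = (1 - t) * a i + t * b i" for i unfolding t(4) by simp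
    have two: "a i = 2 \<and> b i = 2" if i: "i \<in> V" "z i = 2" for i
    proof -
      have "(1 - t) * (2 - a i) + t * (2 - b i) = 0" using zi[of i] i(2) by (simp add: algebra_simps)
      moreover have "0 \<le> (1 - t) * (2 - a i)" "0 \<le> t * (2 - b i)"
        using bounds[OF a i(1)] bounds[OF b i(1)] t by simp_all
      ultimately have "(1 - t) * (2 - a i) = 0" "t * (2 - b i) = 0" by linarith+
      then show ?thesis using t by simp
    qed
    have zero: "a i = 0 \<and> b i = 0" if i: "i \<in> V" "z i = 0" for i
    proof -
      have "(1 - t) * a i + t * b i = 0" using zi[of i] i(2) by simp
      moreover have "0 \<le> (1 - t) * a i" "0 \<le> t * b i"
        using bounds[OF a i(1)] bounds[OF b i(1)] t by simp_all
      ultimately have "(1 - t) * a i = 0" "t * b i = 0" by linarith+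
      then show ?thesis using t by simp
    qed
    have "a = z" by (rule determined[OF a]) (use two zero in auto)
    moreover have "b = z" by (rule determined[OF b]) (use two zero in auto)
    ultimately show False using t(1) by simp
  qed
qed

section \<open>Pushing forward and integer points\<close>

lemma real_vec_add: "real_vec (x + y) = real_vec x + real_vec y"
  and real_vec_exchange: "real_vec (lower x i j) = real_vec x - unit_vec i + unit_vec j"
    "real_vec (raise x i j) = real_vec x + unit_vec i - unit_vec j"
  by (auto simp: real_vec_def unit_vec_apply fun_eq_iff)

lemma real_vec_inject [simp]: "real_vec x = real_vec y \<longleftrightarrow> x = y"
  by (auto simp: real_vec_def fun_eq_iff)

lemma push_real_vec: "push V \<phi> (real_vec y) = real_vec (push V \<phi> y)"
  unfolding push_def sum_real_vec by (simp add: real_vec_def)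

lemma rk_eq_submod:
  assumes "finite E" "m_convex E P"
  shows "rk E P = submod P E"
  unfolding rk_def
proof (rule the_equality)
  show "\<forall>x\<in>P. sum x E = submod P E" using m_convex_sum_eq[OF assms] by blast
  fix k assume k: "\<forall>x\<in>P. sum x E = k"
  obtain x where "x \<in> P" using assms(2) by (auto simp: m_convex_iff)
  then show "k = submod P E" using k m_convex_sum_eq[OF assms, of x] by simp
qed

lemma sum_push_plus:
  assumes "finite V" "finite X"
  shows "sum (push V \<phi> w + v) X = sum w {j \<in> V. \<phi> j \<in> X} + sum v X"
  unfolding sum_fun_add sum_push[OF assms] ..

text \<open>The real maximum over S is attained at an integral point, so restricting to integer
  points of the image does not lower it.\<close>

lemma submod_int_points_push:
  assumes finV: "finite V" and finX: "finite X" and finQ: "finite Q"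
    and Q: "Q = int_points (push_translate V \<phi> v S)"
    and a: "real_vec a \<in> S" and max: "\<And>w. w \<in> S \<Longrightarrow> sum w {j \<in> V. \<phi> j \<in> X} \<le> sum (real_vec a) {j \<in> V. \<phi> j \<in> X}"
  shows "submod Q X = sum a {j \<in> V. \<phi> j \<in> X} + sum v X"
proof -
  note sum_eq = sum_push_plus[OF finV finX]
  have "real_vec (push V \<phi> a + v) = push V \<phi> (real_vec a) + real_vec v"
    by (simp only: real_vec_add push_real_vec)
  then have "push V \<phi> a + v \<in> Q"
    using a unfolding Q int_points_def push_translate_def by auto
  moreover have "sum y X \<le> sum (push V \<phi> a + v) X" if y: "y \<in> Q" for y
  proof -
    obtain w where w: "w \<in> S" "real_vec y = push V \<phi> w + real_vec v"
      using y unfolding Q int_points_def push_translate_def by auto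
    have "real_of_int (sum y X) = sum (push V \<phi> w + real_vec v) X"
      unfolding w(2)[symmetric] sum_real_vec ..
    also have "\<dots> \<le> sum (real_vec a) {j \<in> V. \<phi> j \<in> X} + sum (real_vec v) X"
      unfolding sum_eq using max[OF w(1)] by simp
    also have "\<dots> = real_of_int (sum (push V \<phi> a + v) X)"
      unfolding sum_eq sum_real_vec by simp
    finally show ?thesis unfolding of_int_le_iff .
  qed
  ultimately have "submod Q X = sum (push V \<phi> a + v) X" by (rule submod_eqI[OF finQ])
  then show ?thesis unfolding sum_eq .
qed

lemma hypersimplex_vertex_real_vec:
  assumes "x \<in> hypersimplex_vertices V m"
  obtains a where "x = real_vec a"
proof -
  have "x j = real_of_int \<lfloor>x j\<rfloor>" for j
  proof (cases "j \<in> V")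
    case True
    then have "x j = 0 \<or> x j = 1" using assms by (simp add: hypersimplex_vertices_def)
    then show ?thesis by auto
  next
    case False
    then show ?thesis using assms by (simp add: hypersimplex_vertices_def vecs_def)
  qed
  then have "x = real_vec (\<lambda>j. \<lfloor>x j\<rfloor>)" by (simp add: real_vec_def fun_eq_iff)
  then show ?thesis using that by blast
qed

text \<open>An extreme point of S1 + S2 that is maximal on the preimages of X and Y splits into
  nested vertices x1 <= x2. Each is integral and maximal in its own summand, so it computes q or p
  at X and Y up to the common translation, and the nesting on the difference set is
  compliance.\<close>

lemma flag_summands_imp_compliant:
  assumes fin: "finite E" and finP: "finite P" "P \<noteq> {}" and finQ: "finite Q" "Q \<noteq> {}"
    and finV: "finite V" and \<phi>: "\<phi> ` V = E" and flag: "flag_summands E r1 r2 V \<phi> Q P"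
  shows "compliant E (submod Q) (submod P)"
  unfolding compliant_def
proof (intro allI impI)
  fix X Y assume XY: "X \<subseteq> Y" "Y \<subseteq> E"
  obtain S1 S2 v where S: "S1 \<subseteq> hypersimplex V r1" "S2 \<subseteq> hypersimplex V r2"
    "flag_permutohedron V [r1, r2] (S1 + S2)"
    and Q: "Q = int_points (push_translate V \<phi> v S1)" and P: "P = int_points (push_translate V \<phi> v S2)"
    using flag unfolding flag_summands_def by blast
  have r: "r1 \<le> r2" and GP: "generalized_permutohedron V (S1 + S2)"
    and ext: "{x. x extreme_point_of (S1 + S2)} \<subseteq> {x. x extreme_point_of (hypersimplex V r1 + hypersimplex V r2)}"
    using S(3) by (simp_all add: flag_permutohedron_def)
  have "S1 \<noteq> {}" "S2 \<noteq> {}"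
    using finP(2) finQ(2) unfolding P Q int_points_def push_translate_def by auto
  then have ne: "S1 + S2 \<noteq> {}" by (metis ex_in_conv set_plus_intro)
  let ?X = "{j \<in> V. \<phi> j \<in> X}" and ?Y = "{j \<in> V. \<phi> j \<in> Y}"
  have sub: "?X \<subseteq> ?Y" "?Y \<subseteq> V" using XY by auto
  obtain z where z: "z extreme_point_of (S1 + S2)"
    "\<And>w. w \<in> S1 + S2 \<Longrightarrow> sum w ?X \<le> sum z ?X" "\<And>w. w \<in> S1 + S2 \<Longrightarrow> sum w ?Y \<le> sum z ?Y"
    using generalized_permutohedron_chain[OF finV GP ne sub] by blast
  have "z \<in> S1 + S2" using z(1) by (simp add: extreme_point_of_def)
  then obtain x1 x2 where x: "x1 \<in> S1" "x2 \<in> S2" "z = x1 + x2" by (auto elim: set_plus_elim)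
  have h: "x1 \<in> hypersimplex V r1" "x2 \<in> hypersimplex V r2" using x S by auto
  have "x1 + x2 extreme_point_of (hypersimplex V r1 + hypersimplex V r2)" using z(1) ext x(3) by auto
  note nested = extreme_point_hypersimplex_plus[OF finV r h this]
  obtain a1 a2 where a: "x1 = real_vec a1" "x2 = real_vec a2"
    using hypersimplex_vertex_real_vec nested(1,2) by metis
  have max1: "sum w A \<le> sum (real_vec a1) A" if "A = ?X \<or> A = ?Y" "w \<in> S1" for w A
  proof -
    have "w + x2 \<in> S1 + S2" using that(2) x(2) by (rule set_plus_intro)
    then have "sum (w + x2) A \<le> sum (x1 + x2) A" using z(2,3) that(1) x(3) by blast
    then show ?thesis unfolding sum_fun_add a(1) by simp
  qed
  have max2: "sum w A \<le> sum (real_vec a2) A" if "A = ?X \<or> A = ?Y" "w \<in> S2" for w A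
  proof -
    have "x1 + w \<in> S1 + S2" using x(1) that(2) by (rule set_plus_intro)
    then have "sum (x1 + w) A \<le> sum (x1 + x2) A" using z(2,3) that(1) x(3) by blast
    then show ?thesis unfolding sum_fun_add a(2) by simp
  qed
  have q: "submod Q Z = sum a1 {j \<in> V. \<phi> j \<in> Z} + sum v Z"
    and p: "submod P Z = sum a2 {j \<in> V. \<phi> j \<in> Z} + sum v Z" if "Z = X \<or> Z = Y" for Z
  proof -
    have finZ: "finite Z" using that XY fin by (auto intro: finite_subset)
    show "submod Q Z = sum a1 {j \<in> V. \<phi> j \<in> Z} + sum v Z"
      by (rule submod_int_points_push[OF finV finZ finQ(1) Q x(1)[unfolded a]]) (use that in \<open>auto intro: max1\<close>)
    show "submod P Z = sum a2 {j \<in> V. \<phi> j \<in> Z} + sum v Z"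
      by (rule submod_int_points_push[OF finV finZ finP(1) P x(2)[unfolded a]]) (use that in \<open>auto intro: max2\<close>)
  qed
  have "sum a1 (?Y - ?X) \<le> sum a2 (?Y - ?X)"
  proof (rule sum_mono)
    fix i assume "i \<in> ?Y - ?X"
    then have "real_vec a1 i \<le> real_vec a2 i" using nested(3)[of i] unfolding a by simp
    then show "a1 i \<le> a2 i" by (simp add: real_vec_def)
  qed
  moreover have "sum a ?Y = sum a (?Y - ?X) + sum a ?X" for a :: "_ \<Rightarrow> int"
    using sub finV by (intro sum.subset_diff) auto
  note this[of a1] this[of a2]
  ultimately show "submod Q Y - submod Q X \<le> submod P Y - submod P X"
    using q[of X] q[of Y] p[of X] p[of Y] by simp
qed

lemma closed_segment_endpoint_extreme:
  fixes a b :: "'a::real_vector"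
  assumes "a \<noteq> b"
  shows "a extreme_point_of closed_segment a b"
  unfolding extreme_point_of_def
proof (intro conjI ballI notI)
  show "a \<in> closed_segment a b" by simp
  fix p q assume p: "p \<in> closed_segment a b" and q: "q \<in> closed_segment a b" and seg: "a \<in> open_segment p q"
  obtain s where s: "0 \<le> s" "p = (1 - s) *\<^sub>R a + s *\<^sub>R b" using p unfolding in_segment by blast
  obtain t where t: "0 \<le> t" "q = (1 - t) *\<^sub>R a + t *\<^sub>R b" using q unfolding in_segment by blast
  obtain u where u: "p \<noteq> q" "0 < u" "u < 1" "a = (1 - u) *\<^sub>R p + u *\<^sub>R q"
    using seg unfolding in_segment by blast
  have ps: "p = a + s *\<^sub>R (b - a)" and qt: "q = a + t *\<^sub>R (b - a)"
    unfolding s(2) t(2) by (simp_all add: algebra_simps)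
  have "a = a + ((1 - u) * s + u * t) *\<^sub>R (b - a)"
    using u(4) unfolding ps qt by (simp add: algebra_simps)
  then have "((1 - u) * s + u * t) *\<^sub>R (b - a) = 0" by simp
  then have "(1 - u) * s + u * t = 0" using assms by simp
  moreover have "0 \<le> (1 - u) * s" "0 \<le> u * t" using u s(1) t(1) by simp_all
  ultimately have "(1 - u) * s = 0" "u * t = 0" by linarith+
  then have "s = 0" "t = 0" using u by simp_all
  then show False using u(1) ps qt by simp
qed

text \<open>The ends a, b of an edge come from points of R. An exchange between them gives a - d and
  b + d in the hull, with the same midpoint as a and b, where d is a difference of unit vectors. The
  edge is a face, so a - d lies on it and b - a is parallel to d.\<close>

lemma generalized_permutohedron_m_convex:
  assumes fin: "finite V" and R: "m_convex V R"
  shows "generalized_permutohedron V (convex hull (real_vec ` R))"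
  unfolding generalized_permutohedron_def
proof (intro conjI allI impI)
  note R' = m_convexD[OF R]
  let ?S = "convex hull (real_vec ` R)"
  show "polytope ?S" using R'(2) by (intro polytope_convex_hull) simp
  show "?S \<subseteq> vecs V"
  proof (rule hull_minimal)
    show "real_vec ` R \<subseteq> vecs V" using R'(3) by auto
    show "convex (vecs V :: ('a \<Rightarrow> real) set)" by (rule convexI) (simp add: vecs_def)
  qed
  fix a b assume ne: "a \<noteq> b" and face: "closed_segment a b face_of ?S"
  have "a extreme_point_of closed_segment a b" "b extreme_point_of closed_segment a b"
    using closed_segment_endpoint_extreme[OF ne] closed_segment_endpoint_extreme[OF ne[symmetric]]
    by (simp_all add: closed_segment_commute)
  then have "a extreme_point_of ?S" "b extreme_point_of ?S"
    using extreme_point_of_face[OF face] by simp_all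
  then have "a \<in> real_vec ` R" "b \<in> real_vec ` R" by (simp_all add: extreme_point_of_convex_hull)
  then obtain x y where xy: "x \<in> R" "y \<in> R" "a = real_vec x" "b = real_vec y" by blast
  have "x \<noteq> y" using ne xy by auto
  have sum: "sum x V = sum y V" by (rule exch_sum_eq[OF fin R'(3,4) xy(1,2)])
  have vecs: "x \<in> vecs V" "y \<in> vecs V" using xy R'(3) by auto
  have "\<exists>i. y i < x i"
  proof (rule ccontr)
    assume "\<not> ?thesis"
    then have le: "x i \<le> y i" for i by (simp add: not_less)
    have "real_vec x = real_vec y"
    proof (rule eq_if_le_and_sum_eq[OF fin])
      show "real_vec x \<in> vecs V" "real_vec y \<in> vecs V" using vecs by simp_all
      show "sum (real_vec x) V = sum (real_vec y) V" unfolding sum_real_vec sum ..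
      show "real_vec x i \<le> real_vec y i" for i using le[of i] by (simp add: real_vec_def)
    qed
    then show False using \<open>x \<noteq> y\<close> by simp
  qed
  then obtain i where i: "y i < x i" by blast
  obtain j where j: "x j < y j" "lower x i j \<in> R" "raise y i j \<in> R"
    using exchE[OF R'(4) xy(1,2) i] by blast
  have ij: "i \<in> V" "j \<in> V" using in_supp_vecs[OF vecs i] in_supp_vecs[OF vecs(2,1) j(1)] by auto
  have "i \<noteq> j" using i j(1) by auto
  define d :: "'a \<Rightarrow> real" where "d = unit_vec i - unit_vec j"
  have "d i = 1" using \<open>i \<noteq> j\<close> by (simp add: d_def unit_vec_apply)
  then have "d \<noteq> 0" by auto
  have "real_vec (lower x i j) = a - d" "real_vec (raise y i j) = b + d"
    unfolding real_vec_exchange xy(3,4) d_def by (simp_all add: algebra_simps)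
  then have in_S: "a - d \<in> ?S" "b + d \<in> ?S" using j(2,3) by (metis hull_inc imageI)+
  have "\<exists>t. b - a = t *\<^sub>R d"
  proof (cases "a - d = b + d")
    \<comment> \<open>Here the second segment degenerates to a point, so the face property cannot be
      applied; the equation itself gives b - a = -2 d.\<close>
    case True
    then have "b - a = (- 2) *\<^sub>R d" by (simp add: scaleR_2 algebra_simps)
    then show ?thesis by blast
  next
    case False
    define m where "m = (1 - 1/2) *\<^sub>R a + (1/2 :: real) *\<^sub>R b"
    have "m \<in> closed_segment a b" unfolding m_def in_segment by (intro exI[of _ "1/2"]) simp
    moreover have "m = (1 - 1/2) *\<^sub>R (a - d) + (1/2 :: real) *\<^sub>R (b + d)"
      unfolding m_def by (simp add: algebra_simps)
    then have "m \<in> open_segment (a - d) (b + d)"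
      unfolding in_segment using False by (intro conjI exI[of _ "1/2"]) auto
    ultimately have "a - d \<in> closed_segment a b"
      using face_ofD[OF face _ in_S] by blast
    then obtain s where s: "a - d = (1 - s) *\<^sub>R a + s *\<^sub>R b" unfolding in_segment by blast
    then have eq: "- d = s *\<^sub>R (b - a)" by (simp add: algebra_simps)
    then have "s \<noteq> 0" using \<open>d \<noteq> 0\<close> by auto
    then have "b - a = (1 / s) *\<^sub>R (s *\<^sub>R (b - a))" by simp
    also have "\<dots> = (- 1 / s) *\<^sub>R d" unfolding eq[symmetric] by simp
    finally show ?thesis by blast
  qed
  then show "\<exists>i\<in>V. \<exists>j\<in>V. \<exists>t. b - a = t *\<^sub>R (unit_vec i - unit_vec j)"
    using ij unfolding d_def by blast
qed

text \<open>Points of the hull inherit the linear bounds that define the base polyhedron of R, whose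
  integer points are R; so passing to the convex hull adds no integer point.\<close>

lemma int_points_push_convex_hull:
  assumes finV: "finite V" and fin: "finite E" and R: "m_convex E R" and \<phi>: "\<phi> ` V = E" and v: "v \<in> vecs E"
    and image: "(\<lambda>y. push V \<phi> y + v) ` R' = R"
  shows "int_points (push_translate V \<phi> v (convex hull (real_vec ` R'))) = R"
proof (intro equalityI subsetI)
  fix x assume "x \<in> R"
  then obtain y where y: "y \<in> R'" "x = push V \<phi> y + v" using image by blast
  have "real_vec x = push V \<phi> (real_vec y) + real_vec v" unfolding y(2) by (simp only: real_vec_add push_real_vec)
  moreover have "real_vec y \<in> convex hull (real_vec ` R')" using y(1) by (intro hull_inc) simp
  ultimately show "x \<in> int_points (push_translate V \<phi> v (convex hull (real_vec ` R')))"
    unfolding int_points_def push_translate_def by blast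
next
  fix x assume "x \<in> int_points (push_translate V \<phi> v (convex hull (real_vec ` R')))"
  then obtain w where w: "w \<in> convex hull (real_vec ` R')" "real_vec x = push V \<phi> w + real_vec v"
    unfolding int_points_def push_translate_def by blast
  have finR: "finite R" using R by (simp add: m_convex_iff)
  have gen: "sum y {j \<in> V. \<phi> j \<in> A} + sum v A = sum (push V \<phi> y + v) A" "push V \<phi> y + v \<in> R"
    if "y \<in> R'" "A \<subseteq> E" for y A
    using image that finite_subset[OF that(2) fin] by (auto simp only: sum_fun_add sum_push[OF finV])
  have sum_x: "real_of_int (sum x A) = sum w {j \<in> V. \<phi> j \<in> A} + real_of_int (sum v A)" if "A \<subseteq> E" for A
    unfolding sum_real_vec[symmetric] w(2) sum_fun_add sum_push[OF finV finite_subset[OF that fin]] ..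
  have ub: "sum x A \<le> submod R A" if A: "A \<subseteq> E" for A
  proof -
    have "sum w {j \<in> V. \<phi> j \<in> A} \<le> real_of_int (submod R A - sum v A)"
    proof (rule linear_le_on_convex_hull[OF linear_sum_fun _ w(1)])
      fix u assume "u \<in> real_vec ` R'"
      then obtain y where y: "y \<in> R'" "u = real_vec y" by blast
      have "sum y {j \<in> V. \<phi> j \<in> A} \<le> submod R A - sum v A"
        using submod_ge[OF finR gen(2)[OF y(1) A], of A] gen(1)[OF y(1) A] by linarith
      then show "sum u {j \<in> V. \<phi> j \<in> A} \<le> real_of_int (submod R A - sum v A)"
        unfolding y(2) sum_real_vec of_int_le_iff .
    qed
    then show ?thesis using sum_x[OF A] by linarith
  qed
  moreover have "submod R E \<le> sum x E"
  proof -
    have "- sum w {j \<in> V. \<phi> j \<in> E} \<le> real_of_int (sum v E - submod R E)"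
    proof (rule linear_le_on_convex_hull[OF linear_compose_neg[OF linear_sum_fun] _ w(1)])
      fix u assume "u \<in> real_vec ` R'"
      then obtain y where y: "y \<in> R'" "u = real_vec y" by blast
      have "- sum y {j \<in> V. \<phi> j \<in> E} = sum v E - submod R E"
        using m_convex_sum_eq[OF fin R gen(2)[OF y(1) order_refl]] gen(1)[OF y(1) order_refl] by linarith
      then show "- sum u {j \<in> V. \<phi> j \<in> E} \<le> real_of_int (sum v E - submod R E)"
        unfolding y(2) sum_real_vec of_int_minus[symmetric] of_int_le_iff by simp
    qed
    then show ?thesis using sum_x[OF order_refl] by linarith
  qed
  moreover have "x \<in> vecs E"
  proof -
    have "x i = 0" if i: "i \<notin> E" for i
    proof -
      have "{j \<in> V. \<phi> j = i} = {}" using i \<phi> by auto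
      then have "push V \<phi> w i = 0" by (simp only: push_def sum.empty)
      moreover have "real_vec x i = push V \<phi> w i + real_vec v i" unfolding w(2) by simp
      ultimately show ?thesis using v i by (simp add: real_vec_def vecs_def)
    qed
    then show ?thesis by (simp add: vecs_def)
  qed
  ultimately have "x \<in> base_points E (submod R)"
    unfolding base_points_def using antisym by blast
  then show "x \<in> R" using m_convex_eq_base_points[OF fin R] by blast
qed

text \<open>At an extreme point of S1 + S2 the summands come from x in N and y in M. If
  \<open>y i < x i\<close> for some i, the exchange between N and M would keep the sum and change x,
  which an extreme point forbids; so x <= y, and sums of nested vertices are extreme for the
  hypersimplices. The M-convexity of N + M gives the edge directions, that of P + Q the integer
  points.\<close>

lemma compliant_imp_flag:
  assumes fin: "finite E" and P: "m_convex E P" and Q: "m_convex E Q"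
    and compl: "compliant E (submod Q) (submod P)"
  shows "\<exists>(V :: nat set) \<phi> l. flag_m_convex_set E [rk E Q + l, rk E P + l] V \<phi> (P + Q) \<and>
    flag_summands E (rk E Q + l) (rk E P + l) V \<phi> Q P"
proof -
  have PQ: "finite (P \<union> Q)" "P \<union> Q \<subseteq> vecs E" using P Q by (auto simp: m_convex_iff)
  obtain V :: "nat set" and \<phi> v where V: "finite V" "\<phi> ` V = E" "v \<in> vecs E"
    "P \<union> Q \<subseteq> (\<lambda>y. push V \<phi> y + v) ` unit_box V"
    by (rule ex_matroid_lift[OF fin PQ])
  define M where "M = box_lift V \<phi> v (unit_box V) P"
  define N where "N = box_lift V \<phi> v (unit_box V) Q"
  have cover: "P \<subseteq> (\<lambda>y. push V \<phi> y + v) ` unit_box V" "Q \<subseteq> (\<lambda>y. push V \<phi> y + v) ` unit_box V"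
    using V(4) by auto
  have images: "(\<lambda>y. push V \<phi> y + v) ` M = P" "(\<lambda>y. push V \<phi> y + v) ` N = Q"
    using cover unfolding M_def N_def box_lift_def by auto
  have M: "m_convex V M" unfolding M_def by (rule m_convex_box_lift[OF V(1) P cover(1)])
  have N: "m_convex V N" unfolding N_def by (rule m_convex_box_lift[OF V(1) Q cover(2)])
  have NM: "m_convex V (N + M)" by (rule m_convex_plus[OF V(1) N M])
  have ex: "exch N M"
    unfolding M_def N_def by (intro exch_box_lift[OF V(1)] compliant_imp_exch[OF fin P Q compl])
  \<comment> \<open>The translation by v shifts coordinate sums by v(E), so the lifts of Q and P
    have sums \<open>rk E Q + l\<close> and \<open>rk E P + l\<close>.\<close>
  define l where "l = - sum v E"
  have V_eq: "{j \<in> V. \<phi> j \<in> E} = V" using V(2) by auto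
  have verts: "real_vec y \<in> hypersimplex_vertices V (rk E R + l)"
    if R: "m_convex E R" and y: "y \<in> unit_box V" "push V \<phi> y + v \<in> R" for y R
  proof -
    have "sum (push V \<phi> y + v) E = rk E R"
      unfolding rk_eq_submod[OF fin R] by (rule m_convex_sum_eq[OF fin R y(2)])
    then have "sum y V = rk E R + l"
      unfolding sum_fun_add sum_push[OF V(1) fin] V_eq by (simp add: l_def)
    moreover have "y j = 0 \<or> y j = 1" for j using unit_box_range[OF y(1)] by blast
    ultimately show ?thesis
      unfolding hypersimplex_vertices_def mem_Collect_eq sum_real_vec
      using y(1) by (auto simp: real_vec_def vecs_def int_box_def)
  qed
  have vM: "real_vec y \<in> hypersimplex_vertices V (rk E P + l)" if "y \<in> M" for y
    using that verts[OF P] by (simp add: M_def box_lift_def)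
  have vN: "real_vec y \<in> hypersimplex_vertices V (rk E Q + l)" if "y \<in> N" for y
    using that verts[OF Q] by (simp add: N_def box_lift_def)
  define S1 where "S1 = convex hull (real_vec ` N)"
  define S2 where "S2 = convex hull (real_vec ` M)"
  let ?H1 = "hypersimplex V (rk E Q + l)" and ?H2 = "hypersimplex V (rk E P + l)"
  have sub: "S1 \<subseteq> ?H1" "S2 \<subseteq> ?H2"
    unfolding S1_def S2_def hypersimplex_eq using vM vN by (intro hull_mono; auto)+
  have "real_vec ` (N + M) = real_vec ` N + real_vec ` M"
    unfolding set_plus_def by (force simp: real_vec_add)
  then have S_eq: "S1 + S2 = convex hull (real_vec ` (N + M))"
    unfolding S1_def S2_def by (simp add: convex_hull_set_plus)
  have poly: "polytope S1" "polytope S2"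
    unfolding S1_def S2_def using M N by (intro polytope_convex_hull; simp add: m_convex_iff)+
  have rank_le: "rk E Q + l \<le> rk E P + l"
    using compliantD[OF compl, of "{}" E] P Q unfolding rk_eq_submod[OF fin P] rk_eq_submod[OF fin Q]
    by (simp add: submod_empty m_convex_iff)
  obtain y0 where "y0 \<in> N" using N by (auto simp: m_convex_iff)
  then have "real_vec y0 \<in> hypersimplex_vertices V (rk E Q + l)" by (rule vN)
  then have "0 \<le> real_of_int (rk E Q + l)"
    unfolding hypersimplex_vertices_def by (metis (mono_tags, lifting) mem_Collect_eq order_refl sum_nonneg zero_le_one)
  then have rank_nonneg: "0 \<le> rk E Q + l" by linarith
  have flag: "flag_permutohedron V [rk E Q + l, rk E P + l] (S1 + S2)"
    unfolding flag_permutohedron_def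
  proof (intro conjI)
    show "sorted [rk E Q + l, rk E P + l]" using rank_le by simp
    show "\<forall>m\<in>set [rk E Q + l, rk E P + l]. 0 \<le> m" using rank_le rank_nonneg by auto
    show "generalized_permutohedron V (S1 + S2)"
      unfolding S_eq by (rule generalized_permutohedron_m_convex[OF V(1) NM])
    have "z extreme_point_of (?H1 + ?H2)" if z: "z extreme_point_of (S1 + S2)" for z
    proof -
      have "z \<in> real_vec ` (N + M)"
        using z unfolding S_eq by (rule extreme_point_of_convex_hull)
      then obtain x y where xy: "x \<in> N" "y \<in> M" "z = real_vec x + real_vec y"
        by (auto simp: real_vec_add elim!: set_plus_elim)
      have in_S: "real_vec x \<in> S1" "real_vec y \<in> S2"
        using xy unfolding S1_def S2_def by (auto intro: hull_inc)
      have "x i \<le> y i" for i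
      proof (rule ccontr)
        assume "\<not> x i \<le> y i"
        then have "y i < x i" by simp
        then obtain j where j: "x j < y j" "lower x i j \<in> N" "raise y i j \<in> M"
          using exchE[OF ex xy(1,2)] by blast
        have "real_vec (lower x i j) \<in> S1" "real_vec (raise y i j) \<in> S2"
          using j unfolding S1_def S2_def by (auto intro: hull_inc)
        then have "real_vec (lower x i j) = real_vec x"
          by (rule extreme_point_plus_unique[OF z[unfolded xy(3)] in_S])
            (simp add: real_vec_exchange algebra_simps)
        then have "lower x i j = x" by simp
        then have "(lower x i j) i = x i" by simp
        moreover have "i \<noteq> j" using j(1) \<open>y i < x i\<close> by auto
        ultimately show False by (simp add: unit_vec_apply)
      qed
      then have "real_vec x i \<le> real_vec y i" for i by (simp add: real_vec_def)
      then show ?thesis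
        unfolding xy(3) by (intro nested_extreme_point_hypersimplex_plus[OF V(1) vN[OF xy(1)] vM[OF xy(2)]])
    qed
    then show "{x. x extreme_point_of (S1 + S2)}
        \<subseteq> {x. x extreme_point_of (\<Sum>m\<leftarrow>[rk E Q + l, rk E P + l]. hypersimplex V m)}"
      by simp blast
  qed
  have Q_eq: "Q = int_points (push_translate V \<phi> v S1)"
    unfolding S1_def by (rule int_points_push_convex_hull[OF V(1) fin Q V(2,3) images(2), symmetric])
  have P_eq: "P = int_points (push_translate V \<phi> v S2)"
    unfolding S2_def by (rule int_points_push_convex_hull[OF V(1) fin P V(2,3) images(1), symmetric])
  have "flag_summands E (rk E Q + l) (rk E P + l) V \<phi> Q P"
    unfolding flag_summands_def using poly sub flag V(3) Q_eq P_eq by blast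
  moreover have "flag_m_convex_set E [rk E Q + l, rk E P + l] V \<phi> (P + Q)"
    unfolding flag_m_convex_set_def
  proof (intro conjI V exI[of _ "S1 + S2"] exI[of _ "v + v"] flag)
    \<comment> \<open>The translation enters once for each summand.\<close>
    show vv: "v + v \<in> vecs E" using V(3) by (simp add: vecs_def)
    have "(\<lambda>y. push V \<phi> y + (v + v)) ` (N + M) = P + Q"
    proof (intro equalityI subsetI)
      fix z assume "z \<in> (\<lambda>y. push V \<phi> y + (v + v)) ` (N + M)"
      then obtain x y where xy: "x \<in> N" "y \<in> M" "z = push V \<phi> (x + y) + (v + v)"
        by (auto elim!: set_plus_elim)
      have "(push V \<phi> y + v) + (push V \<phi> x + v) \<in> P + Q"
        using images xy(1,2) by (intro set_plus_intro) auto
      moreover have "z = (push V \<phi> y + v) + (push V \<phi> x + v)"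
        unfolding xy(3) push_add by (simp add: algebra_simps)
      ultimately show "z \<in> P + Q" by (simp only:)
    next
      fix z assume "z \<in> P + Q"
      then obtain p q where pq: "p \<in> P" "q \<in> Q" "z = p + q" by (auto elim: set_plus_elim)
      obtain y where y: "y \<in> M" "p = push V \<phi> y + v" using images(1) pq(1) by blast
      obtain x where x: "x \<in> N" "q = push V \<phi> x + v" using images(2) pq(2) by blast
      have "z = push V \<phi> (x + y) + (v + v)"
        unfolding pq(3) x(2) y(2) push_add by (simp add: algebra_simps)
      moreover have "x + y \<in> N + M" using x(1) y(1) by (rule set_plus_intro)
      ultimately show "z \<in> (\<lambda>y. push V \<phi> y + (v + v)) ` (N + M)" by blast
    qed
    then show "P + Q = int_points (push_translate V \<phi> (v + v) (S1 + S2))"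
      unfolding S_eq
      by (rule int_points_push_convex_hull[OF V(1) fin m_convex_plus[OF fin P Q] V(2) vv, symmetric])
  qed
  ultimately show ?thesis by blast
qed

section \<open>The equivalence\<close>

theorem theorem1p2:
  fixes E :: "'a set" and P Q :: "('a \<Rightarrow> int) set" and p q :: "'a set \<Rightarrow> int"
  assumes "finite E" and "m_convex E P" and "m_convex E Q"
    and "p = submod P" and "q = submod Q"
  shows "all_equivalent
    [ (\<forall>X Y. X \<subseteq> Y \<longrightarrow> Y \<subseteq> E \<longrightarrow> q Y - q X \<le> p Y - p X),
      (\<forall>\<sigma>. bij_betw \<sigma> {1..card E} E \<longrightarrow> (\<forall>i\<in>E. vertex E P \<sigma> i \<ge> vertex E Q \<sigma> i)),
      (\<forall>X\<subseteq>E. submod_polyhedron (E - X) (contract q X)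
             \<subseteq> submod_polyhedron (E - X) (contract p X)),
      (\<exists>R. mnat_convex E R \<and> P = top_layer E R \<and> Q = bottom_layer E R),
      (\<exists>(X :: nat set) R. finite X \<and> m_convex (E <+> X) R \<and>
             P = deletion E R \<and> Q = contraction E R),
      (\<forall>x\<in>Q. \<forall>y\<in>P. \<forall>i\<in>supp_pos (x - y). \<exists>j\<in>supp_neg (x - y).
             x - unit_vec i + unit_vec j \<in> Q \<and> y + unit_vec i - unit_vec j \<in> P),
      (\<exists>(E' :: nat set) \<Gamma> W. finite E' \<and> m_convex (E <+> E') \<Gamma> \<and> m_convex E' W \<and>
             P = top_layer E (proj_left \<Gamma>) \<and> Q = ind \<Gamma> W),
      (\<exists>\<Gamma> \<Delta>. linking_set E \<Gamma> \<and> linking_set E \<Delta> \<and>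
             P = top_layer E (proj_left \<Gamma>) \<and> Q = top_layer E (proj_left \<Delta>) \<and> green_R E \<Gamma> \<Delta>),
      (\<forall>(V :: nat set) M N. finite V \<longrightarrow> compatible_matroid_lifts E P Q V M N \<longrightarrow>
             matroid_quotient V M N),
      (\<exists>(V :: nat set) \<phi> l. flag_m_convex_set E [rk E Q + l, rk E P + l] V \<phi> (P + Q) \<and>
             flag_summands E (rk E Q + l) (rk E P + l) V \<phi> Q P) ]
    \<and> ((\<exists>R. mnat_convex E R \<and> P = top_layer E R \<and> Q = bottom_layer E R) \<longrightarrow>
        (\<forall>R. mnat_convex E R \<and> P = top_layer E R \<and> Q = bottom_layer E R
             \<longleftrightarrow> R = int_points (g_polymatroid E p (dual E q))))
    \<and> ((\<exists>(X :: nat set) R. finite X \<and> m_convex (E <+> X) R \<and>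
             P = deletion E R \<and> Q = contraction E R) \<longrightarrow>
        (\<exists>(x :: nat) R. m_convex (E <+> {x}) R \<and> P = deletion E R \<and> Q = contraction E R))"
proof -
  let ?C = "compliant E q p"
  note fin = assms(1) and P = assms(2) and Q = assms(3)
  note pq = assms(4,5)
  have finP: "finite P" "P \<noteq> {}" and finQ: "finite Q" "Q \<noteq> {}" using P Q by (auto simp: m_convex_iff)
  have exch_iff: "exch Q P \<longleftrightarrow> ?C"
    unfolding pq by (rule m_convex_exch_iff_compliant[OF fin P Q])
  let ?C4 = "\<exists>R. mnat_convex E R \<and> P = top_layer E R \<and> Q = bottom_layer E R"
  let ?C5 = "\<exists>(X :: nat set) R. finite X \<and> m_convex (E <+> X) R \<and>
             P = deletion E R \<and> Q = contraction E R"
  note c1 = compliant_def[of E q p, symmetric]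
  note c2 = compliant_iff_vertex[OF fin P Q, folded pq, symmetric]
  note c3 = compliant_iff_submod_polyhedron[OF fin P Q, folded pq, symmetric]
  have single: "\<exists>(x :: nat) R. m_convex (E <+> {x}) R \<and> P = deletion E R \<and> Q = contraction E R" if ?C
    using quotient_extension[OF fin P Q that[unfolded pq], of 0] by blast
  have layers: "?C \<and> R = int_points (g_polymatroid E p (dual E q))"
    if "mnat_convex E R" "P = top_layer E R" "Q = bottom_layer E R" for R
    using mnat_convex_top_bottom[OF fin that(1) P[unfolded that(2)] Q[unfolded that(3)]]
    unfolding pq that(2,3)[symmetric] by blast
  have c4: "?C4 \<longleftrightarrow> ?C"
  proof
    assume ?C4
    then show ?C using layers by blast
  next
    assume ?C
    then obtain x :: nat and R where R: "m_convex (E <+> {x}) R" "P = deletion E R" "Q = contraction E R"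
      using single by blast
    then show ?C4
      using mnat_convex_proj_left[OF fin R(1)] unfolding deletion_def contraction_def by blast
  qed
  have c5: "?C5 \<longleftrightarrow> ?C"
  proof
    assume ?C5
    then have "exch Q P" using exch_deletion_contraction[OF fin] by blast
    then show ?C using exch_iff by blast
  next
    assume ?C
    then show ?C5 using single by (meson finite.emptyI finite.insertI)
  qed
  note c6 = exch_iff[unfolded exch_def]
  have c7: "(\<exists>(E' :: nat set) \<Gamma> W. finite E' \<and> m_convex (E <+> E') \<Gamma> \<and> m_convex E' W \<and>
             P = top_layer E (proj_left \<Gamma>) \<and> Q = ind \<Gamma> W) \<longleftrightarrow> ?C" (is "?C7 \<longleftrightarrow> _")
  proof
    assume ?C7
    then have "exch Q P" using exch_ind[OF fin] by blast
    then show ?C using exch_iff by blast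
  next
    assume ?C
    then show ?C7
      using compliant_imp_ind[OF fin P Q, of "0 :: nat"] unfolding pq by (meson finite.emptyI finite.insertI)
  qed
  have c8: "(\<exists>\<Gamma> \<Delta>. linking_set E \<Gamma> \<and> linking_set E \<Delta> \<and>
             P = top_layer E (proj_left \<Gamma>) \<and> Q = top_layer E (proj_left \<Delta>) \<and> green_R E \<Gamma> \<Delta>) \<longleftrightarrow> ?C"
    (is "?C8 \<longleftrightarrow> _")
  proof
    assume ?C8
    then have "exch Q P" using exch_green_R[OF fin] by blast
    then show ?C using exch_iff by blast
  next
    assume ?C
    then show ?C8 unfolding pq by (rule compliant_imp_green_R[OF fin P Q])
  qed
  have c9: "(\<forall>(V :: nat set) M N. finite V \<longrightarrow> compatible_matroid_lifts E P Q V M N \<longrightarrow>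
             matroid_quotient V M N) \<longleftrightarrow> ?C" (is "?C9 \<longleftrightarrow> _")
  proof
    assume ?C9
    then show ?C unfolding pq by (intro compliant_if_lifts_quotient[OF fin P Q]) blast
  next
    assume ?C
    then have "exch Q P" using exch_iff by blast
    then show ?C9 using compatible_lifts_quotient by blast
  qed
  have c10: "(\<exists>(V :: nat set) \<phi> l. flag_m_convex_set E [rk E Q + l, rk E P + l] V \<phi> (P + Q) \<and>
             flag_summands E (rk E Q + l) (rk E P + l) V \<phi> Q P) \<longleftrightarrow> ?C" (is "?C10 \<longleftrightarrow> _")
  proof
    assume ?C10
    then obtain V :: "nat set" and \<phi> l where "finite V" "\<phi> ` V = E"
      "flag_summands E (rk E Q + l) (rk E P + l) V \<phi> Q P"
      unfolding flag_m_convex_set_def by blast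
    then show ?C unfolding pq by (rule flag_summands_imp_compliant[OF fin finP finQ])
  next
    assume ?C
    then show ?C10 unfolding pq by (rule compliant_imp_flag[OF fin P Q])
  qed
  \<comment> \<open>Each condition has been turned into compliance, so the list collapses to copies
    of one condition.\<close>
  show ?thesis
    unfolding all_equivalent_def c1 c2 c3 c4 c5 c6 c7 c8 c9 c10
  proof (intro conjI impI allI)
    fix R assume ?C
    \<comment> \<open>One R' with the required layers exists and every such set equals the
      polymatroid set, so the two properties of R agree.\<close>
    then obtain R' where R': "mnat_convex E R'" "P = top_layer E R'" "Q = bottom_layer E R'"
      using c4 by blast
    then have "R' = int_points (g_polymatroid E p (dual E q))" using layers by blast
    then show "mnat_convex E R \<and> P = top_layer E R \<and> Q = bottom_layer E R
        \<longleftrightarrow> R = int_points (g_polymatroid E p (dual E q))"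
      using R' layers by blast
  qed (simp_all add: single)
qed

end
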